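(* Let $R$ be the unit-edge rhombic dodecahedron defined in the context, $T$ the unit-edge regular tetrahedron defined in the context, $U$ uniformly distributed on $S^2$, $W_R=w_R(U)$ and $B_T=b_T(U)$. Then $W_R=\frac{8}{\sqrt3}B_T$ pointwise for the same random direction $U$. In particular, $W_R$ is absolutely continuous. Put $$\kappa_0=\frac{2\sqrt6}{3},\quad\kappa_1=\frac{4\sqrt2}{3},\quad\kappa_2=2,\quad\kappa_3=\frac{4\sqrt3}{3},$$ and, for $\kappa_0\le s\le\kappa_1$, $$\eta_R(s)=\arcsin\left(\frac{\sqrt6\,s}{2\sqrt{16-3s^2}}\right),\qquad\delta_R(s)=\arccos\left(\frac{\sqrt2\,s}{4\sqrt{4-s^2}}\right).$$ The support of $W_R$ is $[\kappa_0,\kappa_3]$, and a density representative is $$f_R(s)=\begin{cases}0,& s<\kappa_0,\\ \dfrac{3\sqrt3}{\pi}\left(\eta_R(s)-\dfrac\pi4\right)+\dfrac6\pi\left(\dfrac\pi3-\delta_R(s)\right),&\kappa_0\le s<\kappa_1,\\ 2+\dfrac{3\sqrt3}{4},&\kappa_1\le s<\kappa_2,\\ \dfrac{3\sqrt3}{4},&\kappa_2\le s<\kappa_3,\\ 0,& s\ge\kappa_3.\end{cases}$$ Moreover, writing $$J_{\max,R}(s)=\frac{\sqrt3\,s}{8}\eta_R(s)+\frac12\arctan\sqrt{2\left(1-\frac{9s^2}{32}\right)},\qquad J_{\Sigma,R}(s)=\frac{\sqrt3\,s}{8}\delta_R(s)-\frac{\sqrt3}{4}\arctan\left(2\sqrt{2\left(1-\frac{9s^2}{32}\right)}\right),$$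 and $$\Phi_R(s)=\frac{24}{\pi}\left[J_{\max,R}(s)-J_{\max,R}(\kappa_0)-\frac{\pi\sqrt3}{32}(s-\kappa_0)\right]+\frac{48}{\pi\sqrt3}\left[\frac{\pi\sqrt3}{24}(s-\kappa_0)-J_{\Sigma,R}(s)+J_{\Sigma,R}(\kappa_0)\right],$$ the cumulative distribution function of $W_R$ is $$F_R(s)=\begin{cases}0,& s<\kappa_0,\\ \Phi_R(s),&\kappa_0\le s<\kappa_1,\\ \left(2+\dfrac{3\sqrt3}{4}\right)s-6,&\kappa_1\le s<\kappa_2,\\ \dfrac{3\sqrt3}{4}s-2,&\kappa_2\le s<\kappa_3,\\ 1,& s\ge\kappa_3.\end{cases}$$
   Context: Let $\xi_1=(1,1,1)$, $\xi_2=(1,-1,-1)$, $\xi_3=(-1,1,-1)$, $\xi_4=(-1,-1,1)$. The unit-edge rhombic dodecahedron is $R=\frac{8}{\sqrt3}\sum_{i=1}^4\left[-\frac{\xi_i}{16},\frac{\xi_i}{16}\right]$ (Minkowski sum of segments), and $T=\operatorname{conv}\{\xi_1/\sqrt8,\ldots,\xi_4/\sqrt8\}$ is the unit-edge regular tetrahedron. For a compact convex body $K\subset\mathbb{R}^3$ and $u\in S^2$, $w_K(u)=\max_{x\in K}u\cdot x-\min_{x\in K}u\cdot x$ is the width and $b_K(u)$ is the area of the orthogonal projection of $K$ onto $u^{\perp}$ (brightness). $U$ is distributed according to the rotation-invariant probability measure on $S^2$. *)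

theory Defs
  imports "HOL-Probability.Probability" "HOL-Library.Set_Algebras"
begin

definition xi1 :: "real^3" where "xi1 = vector [1, 1, 1]"
definition xi2 :: "real^3" where "xi2 = vector [1, -1, -1]"
definition xi3 :: "real^3" where "xi3 = vector [-1, 1, -1]"
definition xi4 :: "real^3" where "xi4 = vector [-1, -1, 1]"

text \<open>Here \<open>+\<close> on sets is the Minkowski sum.\<close>

definition rhombic_dodecahedron :: "(real^3) set" where
  "rhombic_dodecahedron = (\<lambda>x. (8 / sqrt 3) *\<^sub>R x) `
     (closed_segment (- (xi1 /\<^sub>R 16)) (xi1 /\<^sub>R 16) +
      closed_segment (- (xi2 /\<^sub>R 16)) (xi2 /\<^sub>R 16) +
      closed_segment (- (xi3 /\<^sub>R 16)) (xi3 /\<^sub>R 16) +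
      closed_segment (- (xi4 /\<^sub>R 16)) (xi4 /\<^sub>R 16))"

definition tetrahedron :: "(real^3) set" where
  "tetrahedron = convex hull
     {xi1 /\<^sub>R sqrt 8, xi2 /\<^sub>R sqrt 8, xi3 /\<^sub>R sqrt 8, xi4 /\<^sub>R sqrt 8}"

text \<open>For nonempty compact \<open>K\<close> the supremum and infimum are attained.\<close>

definition width :: "(real^3) set \<Rightarrow> real^3 \<Rightarrow> real" where
  "width K u = (SUP x\<in>K. u \<bullet> x) - (INF x\<in>K. u \<bullet> x)"

text \<open>For a unit vector \<open>u\<close> this is the orthogonal projection onto the plane orthogonal to \<open>u\<close>.\<close>

definition proj_perp :: "real^3 \<Rightarrow> real^3 \<Rightarrow> real^3" where
  "proj_perp u x = x - (u \<bullet> x) *\<^sub>R u"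

definition plane_isometry :: "real^3 \<Rightarrow> (real^2 \<Rightarrow> real^3) \<Rightarrow> bool" where
  "plane_isometry u f \<longleftrightarrow>
     linear f \<and> (\<forall>y. norm (f y) = norm y) \<and> range f = {x. u \<bullet> x = 0}"

text \<open>
  The area of a subset of the plane orthogonal to \<open>u\<close> is the two-dimensional Lebesgue measure
  of its image under a linear isometric identification of that plane with \<open>real^2\<close>.
  Lemma \<open>brightness_eq\<close> below shows that the choice of the identification is immaterial.
\<close>

definition area_in_perp :: "real^3 \<Rightarrow> (real^3) set \<Rightarrow> real" where
  "area_in_perp u S = measure lebesgue ((SOME f. plane_isometry u f) -` S)"

definition brightness :: "(real^3) set \<Rightarrow> real^3 \<Rightarrow> real" where
  "brightness K u = area_in_perp u (proj_perp u ` K)"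

lemma compact_vimage_plane_isometry:
  assumes f: "plane_isometry u f" and S: "compact S"
  shows "compact (f -` S)"
proof -
  have lin: "linear f" and n: "\<And>y. norm (f y) = norm y"
    using f by (auto simp: plane_isometry_def)
  obtain B where B: "\<And>x. x \<in> S \<Longrightarrow> norm x \<le> B"
    using compact_imp_bounded[OF S] by (auto simp: bounded_iff)
  have "bounded (f -` S)"
    unfolding bounded_iff by (rule exI[of _ B]) (use B n in force)
  moreover have "closed (f -` S)"
    using lin S by (intro continuous_closed_vimage)
      (auto intro: compact_imp_closed linear_continuous_at simp: linear_conv_bounded_linear)
  ultimately show ?thesis
    by (simp add: compact_eq_bounded_closed)
qed

lemma measure_vimage_plane_isometry:
  assumes f: "plane_isometry u f" and g: "plane_isometry u g" and S: "compact S"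
  shows "measure lebesgue (f -` S) = measure lebesgue (g -` S)"
proof -
  have lf: "linear f" and nf: "\<And>y. norm (f y) = norm y" and rf: "range f = {x. u \<bullet> x = 0}"
    using f by (auto simp: plane_isometry_def)
  have lg: "linear g" and ng: "\<And>y. norm (g y) = norm y" and rg: "range g = {x. u \<bullet> x = 0}"
    using g by (auto simp: plane_isometry_def)
  have ig: "inj g"
  proof (rule injI)
    fix x y assume "g x = g y"
    then have "norm (g (x - y)) = 0" by (simp add: linear_diff[OF lg])
    then have "norm (x - y) = 0" by (simp only: ng)
    then show "x = y" by simp
  qed
  define h where "h = (\<lambda>y. inv g (f y))"
  have gh: "g (h y) = f y" for y
    unfolding h_def by (rule f_inv_into_f) (use rf rg in auto)
  have lh: "linear h"
  proof (rule linearI)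
    show "h (x + y) = h x + h y" for x y
      by (rule injD[OF ig]) (simp add: gh linear_add[OF lg] linear_add[OF lf])
    show "h (c *\<^sub>R x) = c *\<^sub>R h x" for c x
      by (rule injD[OF ig]) (simp add: gh linear_scale[OF lg] linear_scale[OF lf])
  qed
  have oh: "orthogonal_transformation h"
    unfolding orthogonal_transformation
  proof (intro conjI allI lh)
    show "norm (h y) = norm y" for y using ng[of "h y"] by (simp add: gh nf)
  qed
  have "g -` S = h ` (f -` S)"
  proof (intro equalityI subsetI)
    fix y assume "y \<in> g -` S"
    have "g y \<in> range f" using rf rg by auto
    then obtain x where x: "f x = g y" by (metis rangeE)
    have "h x = y" by (rule injD[OF ig]) (simp add: gh x)
    moreover have "x \<in> f -` S" using \<open>y \<in> g -` S\<close> x by simp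
    ultimately show "y \<in> h ` (f -` S)" by blast
  qed (auto simp: gh)
  then show ?thesis
    using measure_orthogonal_image[OF oh, of "f -` S"]
      lmeasurable_compact[OF compact_vimage_plane_isometry[OF f S]]
    by (simp add: fmeasurableD)
qed

lemma brightness_eq:
  assumes "compact K" and "plane_isometry u f"
  shows "brightness K u = measure lebesgue (f -` (proj_perp u ` K))"
proof -
  have "plane_isometry u (SOME f. plane_isometry u f)"
    by (rule someI[of "plane_isometry u", OF assms(2)])
  moreover have "compact (proj_perp u ` K)"
    unfolding proj_perp_def
    by (intro compact_continuous_image continuous_intros assms(1))
  ultimately show ?thesis
    unfolding brightness_def area_in_perp_def
    using measure_vimage_plane_isometry assms(2) by blast
qed

text \<open>
  \<open>U\<close> takes values in the unit sphere and its law is invariant under all rotations; this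
  determines the law of \<open>U\<close> uniquely.
\<close>

definition uniform_on_sphere :: "'a measure \<Rightarrow> ('a \<Rightarrow> real^3) \<Rightarrow> bool" where
  "uniform_on_sphere M U \<longleftrightarrow>
     U \<in> M \<rightarrow>\<^sub>M restrict_space borel (sphere 0 1) \<and>
     (\<forall>A. rotation_matrix A \<longrightarrow> distr M borel (\<lambda>\<omega>. A *v U \<omega>) = distr M borel U)"

definition measure_support :: "real measure \<Rightarrow> real set" where
  "measure_support N = {x. \<forall>V. open V \<and> x \<in> V \<longrightarrow> emeasure N V > 0}"

definition kappa0 :: real where "kappa0 = 2 * sqrt 6 / 3"
definition kappa1 :: real where "kappa1 = 4 * sqrt 2 / 3"
definition kappa2 :: real where "kappa2 = 2"
definition kappa3 :: real where "kappa3 = 4 * sqrt 3 / 3"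

definition eta_R :: "real \<Rightarrow> real" where
  "eta_R s = arcsin (sqrt 6 * s / (2 * sqrt (16 - 3 * s\<^sup>2)))"

definition delta_R :: "real \<Rightarrow> real" where
  "delta_R s = arccos (sqrt 2 * s / (4 * sqrt (4 - s\<^sup>2)))"

definition f_R :: "real \<Rightarrow> real" where
  "f_R s =
    (if s < kappa0 then 0
     else if s < kappa1 then
       3 * sqrt 3 / pi * (eta_R s - pi / 4) + 6 / pi * (pi / 3 - delta_R s)
     else if s < kappa2 then 2 + 3 * sqrt 3 / 4
     else if s < kappa3 then 3 * sqrt 3 / 4
     else 0)"

definition J_max_R :: "real \<Rightarrow> real" where
  "J_max_R s = sqrt 3 * s / 8 * eta_R s + 1 / 2 * arctan (sqrt (2 * (1 - 9 * s\<^sup>2 / 32)))"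

definition J_Sigma_R :: "real \<Rightarrow> real" where
  "J_Sigma_R s =
     sqrt 3 * s / 8 * delta_R s - sqrt 3 / 4 * arctan (2 * sqrt (2 * (1 - 9 * s\<^sup>2 / 32)))"

definition Phi_R :: "real \<Rightarrow> real" where
  "Phi_R s =
     24 / pi * (J_max_R s - J_max_R kappa0 - pi * sqrt 3 / 32 * (s - kappa0)) +
     48 / (pi * sqrt 3) *
       (pi * sqrt 3 / 24 * (s - kappa0) - J_Sigma_R s + J_Sigma_R kappa0)"

definition F_R :: "real \<Rightarrow> real" where
  "F_R s =
    (if s < kappa0 then 0
     else if s < kappa1 then Phi_R s
     else if s < kappa2 then (2 + 3 * sqrt 3 / 4) * s - 6
     else if s < kappa3 then 3 * sqrt 3 / 4 * s - 2
     else 1)"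

end

theory Submission
  imports Defs
begin

text \<open>
  The vertices of \<open>T\<close> are \<open>\<xi>\<^sub>i / sqrt 8\<close>, and \<open>\<Sum>\<^sub>i (\<xi>\<^sub>i \<bullet> u) \<xi>\<^sub>i = 4u\<close>. So the numbers \<open>\<xi>\<^sub>i \<bullet> u\<close> are an affine dependency of
  their projections to \<open>u\<^sup>\<bottom>\<close>, and the triangle missing the \<open>i\<close>-th vertex has area \<open>\<bar>\<xi>\<^sub>i \<bullet> u\<bar> / 4\<close>.
  Hence \<open>b\<^sub>T u = (1/8) \<Sum>\<^sub>i \<bar>\<xi>\<^sub>i \<bullet> u\<bar>\<close>, which is the width of the zonotope \<open>R\<close> up to the factor.

  In coordinates \<open>w\<^sub>R u = max (4 \<parallel>u\<parallel>\<^sub>\<infinity>) (2 \<parallel>u\<parallel>\<^sub>1) / sqrt 3\<close>. The first term wins on six cones around the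
  coordinate axes and the second on eight cones around the diagonals. On each cone \<open>w\<^sub>R\<close> is a multiple
  of the height along the axis of the cone; this height is uniformly distributed (Archimedes), and the
  share of each parallel circle that lies in the cone is a complement of four, respectively three,
  disjoint arcs. This gives the density directly, and \<open>F\<^sub>R\<close> is its integral.
\<close>

section \<open>Width of the rhombic dodecahedron\<close>

text \<open>The level sets of \<open>radial_width\<close>, the closed form of the width, are
  cuboctahedra: the six cones are spanned by their squares, the eight by their triangles. A unit
  vector has width \<open>kappa0\<close> in the direction of a vertex, \<open>kappa1\<close> of the
  midpoint of an edge, \<open>kappa2\<close> of the centre of a triangle and \<open>kappa3\<close>
  of the centre of a square; hence the breakpoints. Strictly between \<open>kappa0\<close> and
  \<open>kappa1\<close> a parallel circle leaves its cone across every side of the face; from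
  \<open>kappa1\<close> on it stays inside. Each edge borders one square and one triangle, so both
  kinds of cone switch at the same width. The obstacle is that the law of \<open>U\<close> is known
  only through its invariance. There is no surface measure or parametrisation to compute with, so
  heights, longitudes and null sets have to be derived from invariance and from volumes. Reflections
  are not among the given symmetries, which decides how the cones are identified with each
  other.\<close>

lemma inner_vec3: "(x::real^3) \<bullet> y = x$1 * y$1 + x$2 * y$2 + x$3 * y$3"
  by (simp add: inner_vec_def sum_3)

lemmas xi_defs = xi1_def xi2_def xi3_def xi4_def

lemma inner_closed_segment_bounds:
  assumes "x \<in> closed_segment (- v) v"
  shows "\<bar>u \<bullet> x\<bar> \<le> \<bar>u \<bullet> v\<bar>"
proof -
  obtain t where t: "0 \<le> t" "t \<le> 1" "x = (1 - t) *\<^sub>R (- v) + t *\<^sub>R v"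
    using assms by (auto simp: in_segment)
  have "u \<bullet> x = (2 * t - 1) * (u \<bullet> v)"
    by (simp add: t algebra_simps)
  then have "\<bar>u \<bullet> x\<bar> = \<bar>2 * t - 1\<bar> * \<bar>u \<bullet> v\<bar>"
    by (simp add: abs_mult)
  also have "\<dots> \<le> 1 * \<bar>u \<bullet> v\<bar>"
    using t by (intro mult_right_mono) auto
  finally show ?thesis by simp
qed

lemma closed_segment_inner_attains:
  obtains x where "x \<in> closed_segment (- v) v" "u \<bullet> x = \<bar>u \<bullet> v\<bar>"
proof (cases "u \<bullet> v \<ge> 0")
  case True then show ?thesis using that[of v] by simp
next
  case False then show ?thesis using that[of "- v"] by simp
qed

lemma width_eqI:
  assumes "\<And>x. x \<in> K \<Longrightarrow> \<bar>u \<bullet> x\<bar> \<le> h" and "x \<in> K" "u \<bullet> x = h" and "y \<in> K" "u \<bullet> y = - h"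
  shows "width K u = 2 * h"
proof -
  have "(SUP x\<in>K. u \<bullet> x) = h"
    by (rule cSup_eq_maximum) (use assms in \<open>force simp: abs_le_iff\<close>)+
  moreover have "(INF x\<in>K. u \<bullet> x) = - h"
    by (rule cInf_eq_minimum) (use assms in \<open>force simp: abs_le_iff\<close>)+
  ultimately show ?thesis by (simp add: width_def)
qed

text \<open>Support functions add under Minkowski sums, and the segment from \<open>- v\<close> to
  \<open>v\<close> contributes the absolute value of \<open>u \<bullet> v\<close>. The sum is
  symmetric about the origin, so its width is twice its support function.\<close>

lemma width_rhombic_dodecahedron:
  "width rhombic_dodecahedron u =
     (\<bar>u \<bullet> xi1\<bar> + \<bar>u \<bullet> xi2\<bar> + \<bar>u \<bullet> xi3\<bar> + \<bar>u \<bullet> xi4\<bar>) / sqrt 3"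
proof -
  let ?h = "8 / sqrt 3 * ((\<bar>u \<bullet> xi1\<bar> + \<bar>u \<bullet> xi2\<bar> + \<bar>u \<bullet> xi3\<bar> + \<bar>u \<bullet> xi4\<bar>) / 16)"
  let ?S = "\<lambda>v. closed_segment (- (v /\<^sub>R 16)) (v /\<^sub>R 16)"
  have mem: "x \<in> rhombic_dodecahedron \<longleftrightarrow> (\<exists>a b c d. a \<in> ?S xi1 \<and> b \<in> ?S xi2 \<and> c \<in> ?S xi3 \<and> d \<in> ?S xi4
      \<and> x = (8 / sqrt 3) *\<^sub>R (a + b + c + d))" for x
    unfolding rhombic_dodecahedron_def image_iff Bex_def set_plus_def by blast
  have bound: "\<bar>u \<bullet> x\<bar> \<le> ?h" if "x \<in> rhombic_dodecahedron" for x
  proof -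
    obtain a b c d where abcd: "a \<in> ?S xi1" "b \<in> ?S xi2" "c \<in> ?S xi3" "d \<in> ?S xi4"
      and x: "x = (8 / sqrt 3) *\<^sub>R (a + b + c + d)"
      using \<open>x \<in> _\<close> unfolding mem by blast
    have "\<bar>u \<bullet> a + u \<bullet> b + u \<bullet> c + u \<bullet> d\<bar> \<le> (\<bar>u \<bullet> xi1\<bar> + \<bar>u \<bullet> xi2\<bar> + \<bar>u \<bullet> xi3\<bar> + \<bar>u \<bullet> xi4\<bar>) / 16"
    proof -
      have tri: "\<bar>p + q + r + s\<bar> \<le> (P + Q + R + S) / 16"
        if "\<bar>p\<bar> \<le> P / 16" "\<bar>q\<bar> \<le> Q / 16" "\<bar>r\<bar> \<le> R / 16" "\<bar>s\<bar> \<le> S / 16"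
        for p q r s P Q R S :: real
        using that unfolding abs_le_iff by auto
      show ?thesis
        by (rule tri) (use abcd[THEN inner_closed_segment_bounds, of u] in \<open>simp_all add: abs_mult\<close>)
    qed
    then have "8 / sqrt 3 * \<bar>u \<bullet> a + u \<bullet> b + u \<bullet> c + u \<bullet> d\<bar> \<le> ?h"
      by (intro mult_left_mono) auto
    moreover have "u \<bullet> x = 8 / sqrt 3 * (u \<bullet> a + u \<bullet> b + u \<bullet> c + u \<bullet> d)"
      by (simp add: x inner_add_right)
    then have "\<bar>u \<bullet> x\<bar> = \<bar>8 / sqrt 3\<bar> * \<bar>u \<bullet> a + u \<bullet> b + u \<bullet> c + u \<bullet> d\<bar>"
      by (simp only: abs_mult)
    moreover have "\<bar>8 / sqrt 3\<bar> = 8 / sqrt 3" by simp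
    ultimately show ?thesis by (simp only:)
  qed
  obtain a b c d where abcd: "a \<in> ?S xi1" "b \<in> ?S xi2" "c \<in> ?S xi3" "d \<in> ?S xi4"
    and eq: "u \<bullet> a = \<bar>u \<bullet> (xi1 /\<^sub>R 16)\<bar>" "u \<bullet> b = \<bar>u \<bullet> (xi2 /\<^sub>R 16)\<bar>"
      "u \<bullet> c = \<bar>u \<bullet> (xi3 /\<^sub>R 16)\<bar>" "u \<bullet> d = \<bar>u \<bullet> (xi4 /\<^sub>R 16)\<bar>"
    by (metis closed_segment_inner_attains)
  let ?x = "(8 / sqrt 3) *\<^sub>R (a + b + c + d)"
  have "?x \<in> rhombic_dodecahedron"
    unfolding mem using abcd by blast
  moreover have "- ?x \<in> rhombic_dodecahedron"
  proof -
    have "- y \<in> ?S v" if "y \<in> ?S v" for y v :: "real^3"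
    proof -
      obtain t where "0 \<le> t" "t \<le> 1" "y = (1 - t) *\<^sub>R (- (v /\<^sub>R 16)) + t *\<^sub>R (v /\<^sub>R 16)"
        using \<open>y \<in> _\<close> unfolding in_segment by blast
      then show ?thesis
        unfolding in_segment by (intro exI[of _ "1 - t"]) (simp add: algebra_simps)
    qed
    then show ?thesis unfolding mem using abcd
      by (intro exI[of _ "-a"] exI[of _ "-b"] exI[of _ "-c"] exI[of _ "-d"]) (simp add: algebra_simps)
  qed
  moreover have "u \<bullet> ?x = ?h"
    by (simp add: inner_add_right eq abs_mult add_divide_distrib)
  ultimately have "width rhombic_dodecahedron u = 2 * ?h"
    by (intro width_eqI[of _ u ?h ?x "- ?x"] bound) simp_all
  then show ?thesis by (simp add: field_simps)
qed

text \<open>Let a, b, c be the absolute values of the coordinates. In some order the four terms are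
  a+b+c and the absolute values of b+c-a, a+c-b, a+b-c. If the last three numbers are nonnegative,
  everything adds up to 2(a+b+c); otherwise the largest coordinate decides all signs and the sum is
  four times it.\<close>

lemma sum_abs_inner_xi:
  "\<bar>u \<bullet> xi1\<bar> + \<bar>u \<bullet> xi2\<bar> + \<bar>u \<bullet> xi3\<bar> + \<bar>u \<bullet> xi4\<bar> =
     max (4 * max \<bar>u$1\<bar> (max \<bar>u$2\<bar> \<bar>u$3\<bar>)) (2 * (\<bar>u$1\<bar> + \<bar>u$2\<bar> + \<bar>u$3\<bar>))"
  unfolding inner_vec3 xi_defs by (simp add: max_def abs_if)

section \<open>Area of the convex hull of four points in the plane\<close>

lemma convex_hull_4:
  "convex hull {a, b, c, d} =
     {s *\<^sub>R a + t *\<^sub>R b + v *\<^sub>R c + w *\<^sub>R d | s t v w.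
        0 \<le> s \<and> 0 \<le> t \<and> 0 \<le> v \<and> 0 \<le> w \<and> s + t + v + w = (1::real)}" (is "_ = ?R")
proof (intro equalityI subsetI)
  fix x assume "x \<in> convex hull {a, b, c, d}"
  then obtain s r y where s: "0 \<le> s" "0 \<le> r" "s + r = 1" "y \<in> convex hull {b, c, d}"
    and x: "x = s *\<^sub>R a + r *\<^sub>R y"
    by (subst (asm) convex_hull_insert) auto
  then obtain t v w where "0 \<le> t" "0 \<le> v" "0 \<le> w" "t + v + w = 1"
    and y: "y = t *\<^sub>R b + v *\<^sub>R c + w *\<^sub>R d"
    by (auto simp: convex_hull_3)
  moreover have "s + r * t + r * v + r * w = s + r * (t + v + w)"
    by (simp add: algebra_simps)
  ultimately show "x \<in> ?R"
    using s unfolding mem_Collect_eq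
    by (intro exI[of _ s] exI[of _ "r * t"] exI[of _ "r * v"] exI[of _ "r * w"])
      (simp add: x y algebra_simps)
next
  fix x assume "x \<in> ?R"
  then obtain s t v w where "0 \<le> s" "0 \<le> t" "0 \<le> v" "0 \<le> w" "s + t + v + w = 1"
    and x: "x = s *\<^sub>R a + t *\<^sub>R b + v *\<^sub>R c + w *\<^sub>R d" by blast
  then have *: "s + (t + (v + w)) = 1" by simp
  let ?H = "convex hull {a, b, c, d}"
  \<comment> \<open>Indexing by numbers instead of by points keeps the combination correct when some
    of the four points coincide.\<close>
  let ?f = "\<lambda>i::nat. if i = 0 then s else if i = 1 then t else if i = 2 then v else w"
  let ?p = "\<lambda>i::nat. if i = 0 then a else if i = 1 then b else if i = 2 then c else d"
  have "(\<Sum>i\<in>{0,1,2,3}. ?f i *\<^sub>R ?p i) \<in> ?H"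
    by (rule convex_sum) (use \<open>0 \<le> s\<close> \<open>0 \<le> t\<close> \<open>0 \<le> v\<close> \<open>0 \<le> w\<close> * in \<open>auto intro: hull_inc\<close>)
  then show "x \<in> ?H" by (simp add: x add.assoc)
qed

text \<open>The affine dependency can be added to a convex combination until the coefficient of
  \<open>c\<close> or of \<open>d\<close> vanishes.\<close>

lemma convex_hull_4_split:
  fixes a b c d :: "'v::real_vector"
  assumes sum: "k + l + m + n = (0::real)" and dep: "k *\<^sub>R a + l *\<^sub>R b + m *\<^sub>R c + n *\<^sub>R d = 0"
    and sgn: "0 \<le> k" "0 \<le> l" "m \<le> 0" "n \<le> 0" and ne: "m \<noteq> 0 \<or> n \<noteq> 0"
  shows "convex hull {a, b, c, d} = convex hull {a, b, c} \<union> convex hull {a, b, d}"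
proof (intro equalityI subsetI)
  fix x assume "x \<in> convex hull {a, b, c, d}"
  then obtain s t v w where nonneg: "0 \<le> s" "0 \<le> t" "0 \<le> v" "0 \<le> w" and one: "s + t + v + w = 1"
    and x: "x = s *\<^sub>R a + t *\<^sub>R b + v *\<^sub>R c + w *\<^sub>R d"
    unfolding convex_hull_4 by blast
  have shift: "x = (s + r * k) *\<^sub>R a + (t + r * l) *\<^sub>R b + (v + r * m) *\<^sub>R c + (w + r * n) *\<^sub>R d" for r
  proof -
    have "x = x + r *\<^sub>R (k *\<^sub>R a + l *\<^sub>R b + m *\<^sub>R c + n *\<^sub>R d)" by (simp add: dep)
    then show ?thesis by (simp add: x algebra_simps)
  qed
  have total: "(s + r * k) + (t + r * l) + (v + r * m) + (w + r * n) = 1" for r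
  proof -
    have "(s + r * k) + (t + r * l) + (v + r * m) + (w + r * n) = 1 + r * (k + l + m + n)"
      by (simp add: one[symmetric] algebra_simps)
    then show ?thesis by (simp add: sum)
  qed
  show "x \<in> convex hull {a, b, c} \<union> convex hull {a, b, d}"
  \<comment> \<open>The coefficients of \<open>c\<close> and \<open>d\<close> vanish at
    \<open>r = v / (- m)\<close> and \<open>r = w / (- n)\<close>. The smaller value has to be
    taken, so that the other coefficient is still nonnegative; the comparison is cleared of
    denominators because \<open>m\<close> or \<open>n\<close> may be 0.\<close>
  proof (cases "m < 0 \<and> v * n \<ge> w * m")
    case True
    define r where "r = v / (- m)"
    have r: "0 \<le> r" "v + r * m = 0"
      using True nonneg by (auto simp: r_def divide_simps)
    have "w + r * n \<ge> 0"
      using True by (simp add: r_def field_simps)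
    then have "x \<in> convex hull {a, b, d}"
      unfolding convex_hull_3 using shift[of r] total[of r] r nonneg sgn
      by (intro CollectI exI[of _ "s + r * k"] exI[of _ "t + r * l"] exI[of _ "w + r * n"]) simp
    then show ?thesis ..
  next
    case False
    have n: "n < 0"
    proof (rule ccontr)
      assume "\<not> n < 0"
      then have "n = 0" "m < 0" using sgn ne by auto
      with False nonneg show False by (auto simp: mult_nonneg_nonpos)
    qed
    define r where "r = w / (- n)"
    have r: "0 \<le> r" "w + r * n = 0"
      using n nonneg by (auto simp: r_def divide_simps)
    have "m = 0 \<or> v * n \<le> w * m" using False sgn by auto
    then have "v + r * m \<ge> 0"
      using n nonneg by (auto simp: r_def field_simps mult_nonpos_nonneg)
    then have "x \<in> convex hull {a, b, c}"
      unfolding convex_hull_3 using shift[of r] total[of r] r nonneg sgn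
      by (intro CollectI exI[of _ "s + r * k"] exI[of _ "t + r * l"] exI[of _ "v + r * m"]) simp
    then show ?thesis ..
  qed
qed (use hull_mono[of "{a,b,c}" "{a,b,c,d}" convex] hull_mono[of "{a,b,d}" "{a,b,c,d}" convex] in auto)

lemma lmeasurable_convex_hull_finite:
  "finite S \<Longrightarrow> convex hull S \<in> lmeasurable" for S :: "(real^2) set"
  by (intro lmeasurable_compact finite_imp_compact_convex_hull)

lemma area_triangle:
  fixes A B C :: "real^2"
  shows "measure lebesgue (convex hull {A, B, C}) =
    \<bar>(C$1 - A$1) * (B$2 - A$2) - (B$1 - A$1) * (C$2 - A$2)\<bar> / 2"
  unfolding content_triangle[symmetric]
  by (intro measure_completion) (simp add: borel_compact finite_imp_compact_convex_hull)

lemma measure_Un_null_Int: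
  assumes "S \<in> lmeasurable" "T \<in> lmeasurable" "negligible (S \<inter> T)"
  shows "measure lebesgue (S \<union> T) = measure lebesgue S + measure lebesgue T"
  using assms measure_Un3[of S lebesgue T] negligible_imp_measure0 by fastforce

text \<open>Apply the functional that vanishes on the line through \<open>a\<close> and
  \<open>b\<close> to the dependency: only the terms of \<open>c\<close> and \<open>d\<close>
  survive, and as \<open>m\<close> and \<open>n\<close> have the same sign, these points lie on
  opposite sides of the line. The triangles can then overlap only within the line.\<close>

lemma area_quadrilateral_diagonal:
  fixes a b c d :: "real^2"
  assumes sum: "k + l + m + n = (0::real)" and dep: "k *\<^sub>R a + l *\<^sub>R b + m *\<^sub>R c + n *\<^sub>R d = 0"
    and sgn: "m < 0" "n < 0"
    and pos: "measure lebesgue (convex hull {a, b, c}) \<noteq> 0"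
  shows "negligible (convex hull {a, b, c} \<inter> convex hull {a, b, d})"
proof -
  define q :: "real^2" where "q = vector [b$2 - a$2, a$1 - b$1]"
  define D where "D x = q \<bullet> x - q \<bullet> a" for x
  have q: "q \<bullet> x = (b$2 - a$2) * x$1 + (a$1 - b$1) * x$2" for x
    by (simp add: q_def inner_vec_def sum_2)
  \<comment> \<open>Up to sign, \<open>D c\<close> is twice the area of the triangle
    \<open>a\<close>, \<open>b\<close>, \<open>c\<close>.\<close>
  have "D c \<noteq> 0"
    using pos unfolding area_triangle by (auto simp: D_def q algebra_simps)
  then have "q \<noteq> 0" by (auto simp: D_def)
  have Dab: "D a = 0" "D b = 0" by (simp_all add: D_def q algebra_simps)
  have "0 = q \<bullet> (k *\<^sub>R a + l *\<^sub>R b + m *\<^sub>R c + n *\<^sub>R d) - (k + l + m + n) * (q \<bullet> a)"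
    by (simp add: sum dep)
  also have "\<dots> = l * D b + m * D c + n * D d"
    by (simp add: D_def inner_add_right algebra_simps)
  finally have rel: "m * D c = - n * D d" by (simp add: Dab)
  have hull: "convex hull S \<subseteq> {x. \<sigma> * D x \<ge> 0}" if "\<And>x. x \<in> S \<Longrightarrow> \<sigma> * D x \<ge> 0" for S \<sigma>
  proof (rule hull_minimal)
    have "{x. \<sigma> * D x \<ge> 0} = {x. (\<sigma> *\<^sub>R q) \<bullet> x \<ge> \<sigma> * (q \<bullet> a)}"
      by (auto simp: D_def algebra_simps)
    then show "convex {x. \<sigma> * D x \<ge> 0}" by (simp only: convex_halfspace_ge)
  qed (use that in auto)
  have opp: "sgn (D c) * D d \<le> 0"
  proof -
    have "D d = - (m / n) * D c" using rel sgn by (simp add: field_simps)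
    then have "sgn (D c) * D d = - (m / n) * \<bar>D c\<bar>" by (simp add: abs_sgn)
    then show ?thesis using sgn by (simp add: mult_le_0_iff divide_nonpos_neg zero_le_divide_iff)
  qed
  have "convex hull {a, b, c} \<subseteq> {x. sgn (D c) * D x \<ge> 0}"
    by (rule hull) (auto simp: Dab sgn_if)
  moreover have "convex hull {a, b, d} \<subseteq> {x. - sgn (D c) * D x \<ge> 0}"
    by (rule hull) (use opp in \<open>auto simp: Dab\<close>)
  ultimately have "convex hull {a, b, c} \<inter> convex hull {a, b, d} \<subseteq> {x. q \<bullet> x = q \<bullet> a}"
    using \<open>D c \<noteq> 0\<close> by (force simp: sgn_if D_def split: if_splits)
  moreover have "negligible {x. q \<bullet> x = q \<bullet> a}"
    by (rule negligible_hyperplane) (use \<open>q \<noteq> 0\<close> in simp)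
  ultimately show ?thesis by (rule negligible_subset[rotated])
qed

text \<open>The diagonal from \<open>a\<close> to \<open>b\<close> cuts the hull into two triangles
  whose areas add up. Since the coefficients sum to zero, the absolute values of \<open>m\<close>
  and \<open>n\<close> make up half of all four, which brings the result into a form symmetric in
  the points.\<close>

lemma area_hull_two_two:
  fixes a b c d :: "real^2"
  assumes sum: "k + l + m + n = (0::real)" and dep: "k *\<^sub>R a + l *\<^sub>R b + m *\<^sub>R c + n *\<^sub>R d = 0"
    and sgn: "0 \<le> k" "0 \<le> l" "m \<le> 0" "n \<le> 0" and ne: "m \<noteq> 0 \<or> n \<noteq> 0"
    and area: "measure lebesgue (convex hull {a, b, c}) = r * \<bar>n\<bar>"
      "measure lebesgue (convex hull {a, b, d}) = r * \<bar>m\<bar>"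
  shows "measure lebesgue (convex hull {a, b, c, d}) = r * (\<bar>k\<bar> + \<bar>l\<bar> + \<bar>m\<bar> + \<bar>n\<bar>) / 2"
proof -
  have "negligible (convex hull {a, b, c} \<inter> convex hull {a, b, d})"
  \<comment> \<open>A triangle without area is itself a null set; this disposes of the case that
    \<open>m\<close> or \<open>n\<close> vanishes.\<close>
  proof (cases "measure lebesgue (convex hull {a, b, c}) = 0 \<or> measure lebesgue (convex hull {a, b, d}) = 0")
    case True
    then have "negligible (convex hull {a, b, c}) \<or> negligible (convex hull {a, b, d})"
      by (simp add: negligible_iff_measure lmeasurable_convex_hull_finite)
    then show ?thesis by (metis negligible_Int)
  next
    case False
    then have "m < 0" "n < 0" using sgn area by auto
    with False show ?thesis by (intro area_quadrilateral_diagonal[OF sum dep]) auto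
  qed
  then have "measure lebesgue (convex hull {a, b, c, d}) = r * \<bar>n\<bar> + r * \<bar>m\<bar>"
    using sgn ne by (simp add: convex_hull_4_split[OF sum dep] measure_Un_null_Int
        lmeasurable_convex_hull_finite area)
  also have "\<dots> = r * (\<bar>k\<bar> + \<bar>l\<bar> + \<bar>m\<bar> + \<bar>n\<bar>) / 2"
  proof -
    have "\<bar>k\<bar> + \<bar>l\<bar> = \<bar>m\<bar> + \<bar>n\<bar>" using sum sgn by simp
    then show ?thesis by (simp add: algebra_simps)
  qed
  finally show ?thesis .
qed

text \<open>Solving the dependency for \<open>d\<close> exhibits it as a convex combination of the
  other three points, so the hull is a single triangle. The result is written in the same symmetric
  form as in \<open>area_hull_two_two\<close>.\<close>

lemma area_hull_three_one:
  fixes a b c d :: "real^2"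
  assumes sum: "k + l + m + n = (0::real)" and dep: "k *\<^sub>R a + l *\<^sub>R b + m *\<^sub>R c + n *\<^sub>R d = 0"
    and sgn: "0 \<le> k" "0 \<le> l" "0 \<le> m" "n < 0"
    and area: "measure lebesgue (convex hull {a, b, c}) = r * \<bar>n\<bar>"
  shows "measure lebesgue (convex hull {a, b, c, d}) = r * (\<bar>k\<bar> + \<bar>l\<bar> + \<bar>m\<bar> + \<bar>n\<bar>) / 2"
proof -
  have "k / (-n) + l / (-n) + m / (-n) = (k + l + m) / (-n)"
    by (simp add: add_divide_distrib)
  also have "k + l + m = - n" using sum by simp
  finally have "k / (-n) + l / (-n) + m / (-n) = 1" using sgn by simp
  moreover have "d = (k / (-n)) *\<^sub>R a + (l / (-n)) *\<^sub>R b + (m / (-n)) *\<^sub>R c"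
  proof -
    have "(-n) *\<^sub>R d = k *\<^sub>R a + l *\<^sub>R b + m *\<^sub>R c"
      using dep by (simp add: add_eq_0_iff2)
    then have "d = (1 / (-n)) *\<^sub>R (k *\<^sub>R a + l *\<^sub>R b + m *\<^sub>R c)"
      using sgn by (metis neg_equal_0_iff_equal order_less_irrefl scaleR_one scaleR_scaleR nonzero_eq_divide_eq)
    then show ?thesis by (simp add: scaleR_add_right)
  qed
  ultimately have "d \<in> convex hull {a, b, c}"
    unfolding convex_hull_3 using sgn
    by (intro CollectI exI[of _ "k / (-n)"] exI[of _ "l / (-n)"] exI[of _ "m / (-n)"])
      (simp add: divide_nonneg_neg)
  then have "convex hull {a, b, c, d} = convex hull {a, b, c}"
    by (metis hull_redundant insert_commute)
  moreover have "\<bar>k\<bar> + \<bar>l\<bar> + \<bar>m\<bar> = \<bar>n\<bar>" using sum sgn by simp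
  ultimately show ?thesis by (simp add: area)
qed

text \<open>The seven patterns are the four choices of one exceptional sign and the three ways to
  split the points into two pairs. Every other pattern compatible with sum zero is the negative of
  one of these.\<close>

lemma area_hull_4_signs:
  fixes a b c d :: "real^2"
  assumes sum: "k + l + m + n = (0::real)" and dep: "k *\<^sub>R a + l *\<^sub>R b + m *\<^sub>R c + n *\<^sub>R d = 0"
    and ne: "k \<noteq> 0 \<or> l \<noteq> 0 \<or> m \<noteq> 0 \<or> n \<noteq> 0"
    and area: "measure lebesgue (convex hull {b, c, d}) = r * \<bar>k\<bar>"
      "measure lebesgue (convex hull {a, c, d}) = r * \<bar>l\<bar>"
      "measure lebesgue (convex hull {a, b, d}) = r * \<bar>m\<bar>"
      "measure lebesgue (convex hull {a, b, c}) = r * \<bar>n\<bar>"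
    and sgn: "(0 \<le> k \<and> 0 \<le> l \<and> 0 \<le> m \<and> n \<le> 0) \<or>
      (0 \<le> k \<and> 0 \<le> l \<and> m \<le> 0 \<and> 0 \<le> n) \<or>
      (0 \<le> k \<and> l \<le> 0 \<and> 0 \<le> m \<and> 0 \<le> n) \<or>
      (k \<le> 0 \<and> 0 \<le> l \<and> 0 \<le> m \<and> 0 \<le> n) \<or>
      (0 \<le> k \<and> 0 \<le> l \<and> m \<le> 0 \<and> n \<le> 0) \<or>
      (0 \<le> k \<and> l \<le> 0 \<and> 0 \<le> m \<and> n \<le> 0) \<or>
      (0 \<le> k \<and> l \<le> 0 \<and> m \<le> 0 \<and> 0 \<le> n)"
  shows "measure lebesgue (convex hull {a, b, c, d}) = r * (\<bar>k\<bar> + \<bar>l\<bar> + \<bar>m\<bar> + \<bar>n\<bar>) / 2"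
  using sgn
proof (elim disjE conjE)
  assume *: "0 \<le> k" "0 \<le> l" "0 \<le> m" "n \<le> 0"
  have "measure lebesgue (convex hull {a, b, c, d}) = r * (\<bar>k\<bar> + \<bar>l\<bar> + \<bar>m\<bar> + \<bar>n\<bar>) / 2"
    by (rule area_hull_three_one; (use * sum ne in linarith)?; (use dep in \<open>simp only: add_ac\<close>)?; simp add: area insert_commute)
  then show ?thesis by (simp only: insert_commute add_ac)
next
  assume *: "0 \<le> k" "0 \<le> l" "m \<le> 0" "0 \<le> n"
  have "measure lebesgue (convex hull {a, b, d, c}) = r * (\<bar>k\<bar> + \<bar>l\<bar> + \<bar>n\<bar> + \<bar>m\<bar>) / 2"
    by (rule area_hull_three_one; (use * sum ne in linarith)?; (use dep in \<open>simp only: add_ac\<close>)?; simp add: area insert_commute)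
  then show ?thesis by (simp only: insert_commute add_ac)
next
  assume *: "0 \<le> k" "l \<le> 0" "0 \<le> m" "0 \<le> n"
  have "measure lebesgue (convex hull {a, c, d, b}) = r * (\<bar>k\<bar> + \<bar>m\<bar> + \<bar>n\<bar> + \<bar>l\<bar>) / 2"
    by (rule area_hull_three_one; (use * sum ne in linarith)?; (use dep in \<open>simp only: add_ac\<close>)?; simp add: area insert_commute)
  then show ?thesis by (simp only: insert_commute add_ac)
next
  assume *: "k \<le> 0" "0 \<le> l" "0 \<le> m" "0 \<le> n"
  have "measure lebesgue (convex hull {b, c, d, a}) = r * (\<bar>l\<bar> + \<bar>m\<bar> + \<bar>n\<bar> + \<bar>k\<bar>) / 2"
    by (rule area_hull_three_one; (use * sum ne in linarith)?; (use dep in \<open>simp only: add_ac\<close>)?; simp add: area insert_commute)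
  then show ?thesis by (simp only: insert_commute add_ac)
next
  assume *: "0 \<le> k" "0 \<le> l" "m \<le> 0" "n \<le> 0"
  have "measure lebesgue (convex hull {a, b, c, d}) = r * (\<bar>k\<bar> + \<bar>l\<bar> + \<bar>m\<bar> + \<bar>n\<bar>) / 2"
    by (rule area_hull_two_two; (use * sum ne in linarith)?; (use dep in \<open>simp only: add_ac\<close>)?; simp add: area insert_commute)
  then show ?thesis by (simp only: insert_commute add_ac)
next
  assume *: "0 \<le> k" "l \<le> 0" "0 \<le> m" "n \<le> 0"
  have "measure lebesgue (convex hull {a, c, b, d}) = r * (\<bar>k\<bar> + \<bar>m\<bar> + \<bar>l\<bar> + \<bar>n\<bar>) / 2"
    by (rule area_hull_two_two; (use * sum ne in linarith)?; (use dep in \<open>simp only: add_ac\<close>)?; simp add: area insert_commute)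
  then show ?thesis by (simp only: insert_commute add_ac)
next
  assume *: "0 \<le> k" "l \<le> 0" "m \<le> 0" "0 \<le> n"
  have "measure lebesgue (convex hull {a, d, b, c}) = r * (\<bar>k\<bar> + \<bar>n\<bar> + \<bar>l\<bar> + \<bar>m\<bar>) / 2"
    by (rule area_hull_two_two; (use * sum ne in linarith)?; (use dep in \<open>simp only: add_ac\<close>)?; simp add: area insert_commute)
  then show ?thesis by (simp only: insert_commute add_ac)
qed

lemma area_hull_4:
  fixes a b c d :: "real^2"
  assumes sum: "k + l + m + n = (0::real)" and dep: "k *\<^sub>R a + l *\<^sub>R b + m *\<^sub>R c + n *\<^sub>R d = 0"
    and ne: "k \<noteq> 0 \<or> l \<noteq> 0 \<or> m \<noteq> 0 \<or> n \<noteq> 0"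
    and area: "measure lebesgue (convex hull {b, c, d}) = r * \<bar>k\<bar>"
      "measure lebesgue (convex hull {a, c, d}) = r * \<bar>l\<bar>"
      "measure lebesgue (convex hull {a, b, d}) = r * \<bar>m\<bar>"
      "measure lebesgue (convex hull {a, b, c}) = r * \<bar>n\<bar>"
  shows "measure lebesgue (convex hull {a, b, c, d}) = r * (\<bar>k\<bar> + \<bar>l\<bar> + \<bar>m\<bar> + \<bar>n\<bar>) / 2"
proof -
  let ?sgn = "\<lambda>k l m n. (0 \<le> k \<and> 0 \<le> l \<and> 0 \<le> m \<and> n \<le> (0::real)) \<or>
      (0 \<le> k \<and> 0 \<le> l \<and> m \<le> (0::real) \<and> 0 \<le> n) \<or>
      (0 \<le> k \<and> l \<le> (0::real) \<and> 0 \<le> m \<and> 0 \<le> n) \<or>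
      (k \<le> (0::real) \<and> 0 \<le> l \<and> 0 \<le> m \<and> 0 \<le> n) \<or>
      (0 \<le> k \<and> 0 \<le> l \<and> m \<le> (0::real) \<and> n \<le> (0::real)) \<or>
      (0 \<le> k \<and> l \<le> (0::real) \<and> 0 \<le> m \<and> n \<le> (0::real)) \<or>
      (0 \<le> k \<and> l \<le> (0::real) \<and> m \<le> (0::real) \<and> 0 \<le> n)"
  have "?sgn k l m n \<or> ?sgn (-k) (-l) (-m) (-n)"
    using sum by (cases "0 \<le> k"; cases "0 \<le> l"; cases "0 \<le> m"; cases "0 \<le> n") simp_all
  then show ?thesis
  proof
    assume "?sgn k l m n"
    then show ?thesis by (rule area_hull_4_signs[OF assms])
  next
    assume sgn: "?sgn (-k) (-l) (-m) (-n)"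
    have dep': "(-k) *\<^sub>R a + (-l) *\<^sub>R b + (-m) *\<^sub>R c + (-n) *\<^sub>R d = 0"
      using arg_cong[OF dep, of uminus] by (simp add: algebra_simps)
    have "measure lebesgue (convex hull {a, b, c, d}) = r * (\<bar>-k\<bar> + \<bar>-l\<bar> + \<bar>-m\<bar> + \<bar>-n\<bar>) / 2"
      by (rule area_hull_4_signs[OF _ dep' _ _ _ _ _ sgn]) (use sum ne area in auto)
    then show ?thesis by simp
  qed
qed

section \<open>Brightness of the tetrahedron\<close>

unbundle cross3_syntax

lemma vector_3_eq_iff: "(x::real^3) = y \<longleftrightarrow> x$1 = y$1 \<and> x$2 = y$2 \<and> x$3 = y$3"
  by (simp add: vec_eq_iff forall_3)

lemma vector_2_eq_iff: "(x::real^2) = y \<longleftrightarrow> x$1 = y$1 \<and> x$2 = y$2"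
  by (simp add: vec_eq_iff forall_2)

lemma orthogonal_matrix_inverse:
  "orthogonal_matrix (A::real^'n^'n) \<Longrightarrow> A *v (x v* A) = x"
  "orthogonal_matrix (A::real^'n^'n) \<Longrightarrow> (A *v x) v* A = x"
  by (simp_all add: orthogonal_matrix_def matrix_vector_mul_assoc
      del: transpose_matrix_vector flip: transpose_matrix_vector)

lemma inner_column_vector_matrix_mult:
  fixes A :: "real^'n^'m"
  assumes "A *v axis i 1 = u"
  shows "u \<bullet> x = (x v* A)$i"
  by (metis assms dot_lmul_matrix inner_axis inner_commute inner_real_def mult.right_neutral)

text \<open>The isometry is \<open>y \<mapsto> A (y\<^sub>1, y\<^sub>2, 0)\<close> for a rotation \<open>A\<close> taking the third axis to \<open>u\<close>.\<close>

lemma brightness_rotated: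
  fixes u :: "real^3"
  assumes A: "rotation_matrix A" and u: "A *v axis 3 1 = u" and K: "compact K"
  shows "brightness K u = measure lebesgue
    ((\<lambda>x. vector [(x v* A)$1, (x v* A)$2]) ` K :: (real^2) set)"
proof -
  define f :: "real^2 \<Rightarrow> real^3" where "f y = A *v vector [y$1, y$2, 0]" for y
  define g :: "real^3 \<Rightarrow> real^2" where
    "g x = vector [(x v* A)$1, (x v* A)$2]" for x
  have orth: "orthogonal_matrix A" using A by (simp add: rotation_matrix_def)
  have orthT: "orthogonal_transformation ((*v) A)"
    using orth by (simp add: orthogonal_transformation_matrix)
  note u3 = inner_column_vector_matrix_mult[OF u]
  have uA: "u \<bullet> (A *v x) = x$3" for x
    by (simp add: u3 orthogonal_matrix_inverse[OF orth])
  have uA': "u v* A = axis 3 1"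
    by (simp add: orthogonal_matrix_inverse[OF orth] flip: u)
  have f: "plane_isometry u f"
    unfolding plane_isometry_def
  proof (intro conjI allI)
    show "linear f"
    proof (rule linearI)
      have "vector [(x + y)$1, (x + y)$2, 0] = vector [x$1, x$2, 0] + (vector [y$1, y$2, 0] :: real^3)" for x y :: "real^2"
        by (simp add: vector_3_eq_iff)
      then show "f (x + y) = f x + f y" for x y
        by (simp add: f_def matrix_vector_right_distrib)
      have "vector [(r *\<^sub>R x)$1, (r *\<^sub>R x)$2, 0] = r *\<^sub>R (vector [x$1, x$2, 0] :: real^3)" for r and x :: "real^2"
        by (simp add: vector_3_eq_iff)
      then show "f (r *\<^sub>R x) = r *\<^sub>R f x" for r x
        by (simp add: f_def matrix_vector_mult_scaleR)
    qed
    show "norm (f y) = norm y" for y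
    proof -
      have "norm (f y) = norm (vector [y$1, y$2, 0] :: real^3)"
        unfolding f_def using orthT by (rule orthogonal_transformation_norm)
      then show ?thesis by (simp add: norm_vec_def L2_set_def sum_3 sum_2)
    qed
    show "range f = {x. u \<bullet> x = 0}"
    proof (intro equalityI subsetI)
      fix x assume "x \<in> {x. u \<bullet> x = 0}"
      then have "vector [g x $ 1, g x $ 2, 0] = x v* A"
        by (simp add: vector_3_eq_iff g_def u3)
      then have "x = f (g x)"
        by (simp add: f_def orthogonal_matrix_inverse[OF orth])
      then show "x \<in> range f" by blast
    qed (auto simp: f_def uA)
  qed
  have "f -` (proj_perp u ` K) = g ` K"
  proof -
    have fg: "f (g x) = proj_perp u x" for x
    proof -
      have "(f (g x)) v* A = (proj_perp u x) v* A"
        by (simp add: proj_perp_def vector_matrix_mult_diff_distrib vector_3_eq_iff f_def axis_def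
            orthogonal_matrix_inverse[OF orth] g_def u3 scaleR_vector_matrix_assoc uA')
      then show ?thesis by (metis orthogonal_matrix_inverse(1)[OF orth])
    qed
    have "inj f"
    proof (rule injI)
      fix x y assume "f x = f y"
      then have "(f x) v* A = (f y) v* A" by simp
      then show "x = y"
        by (simp add: f_def orthogonal_matrix_inverse[OF orth] vector_3_eq_iff vector_2_eq_iff)
    qed
    have "proj_perp u ` K = f ` g ` K" by (simp add: image_image fg)
    then show ?thesis using \<open>inj f\<close> by (simp add: inj_vimage_image_eq)
  qed
  then show ?thesis
    using brightness_eq[OF K f] by (simp add: g_def)
qed

lemma brightness_tetrahedron:
  fixes u :: "real^3"
  assumes "norm u = 1"
  shows "brightness tetrahedron u =
     (\<bar>u \<bullet> xi1\<bar> + \<bar>u \<bullet> xi2\<bar> + \<bar>u \<bullet> xi3\<bar> + \<bar>u \<bullet> xi4\<bar>) / 8"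
proof -
  obtain A where A: "rotation_matrix A" and u: "A *v axis 3 1 = u"
    using rotation_matrix_exists_basis[of u 3] assms by auto
  define g :: "real^3 \<Rightarrow> real^2" where
    "g x = vector [(x v* A)$1, (x v* A)$2]" for x
  have lin: "linear g"
    by (rule linearI) (simp_all add: g_def vector_2_eq_iff vector_matrix_left_distrib scaleR_vector_matrix_assoc)
  have orth: "orthogonal_matrix A" and rotT: "rotation_matrix (transpose A)"
    using A by (simp_all add: rotation_matrix_def orthogonal_matrix_transpose)
  note u3 = inner_column_vector_matrix_mult[OF u]
  \<comment> \<open>Rotating \<open>u\<close> to the third axis turns the triple product into the
    third component of a cross product, which is twice the signed area of the projected triangle.
    Dividing the vertices by \<open>sqrt 8\<close> divides areas by 8, hence 16.\<close>
  have area: "measure lebesgue (convex hull {g (p /\<^sub>R sqrt 8), g (q /\<^sub>R sqrt 8), g (r /\<^sub>R sqrt 8)})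
      = \<bar>u \<bullet> ((q - p) \<times> (r - p))\<bar> / 16" for p q r
  proof -
    have "u \<bullet> ((q - p) \<times> (r - p)) = (((q - p) v* A) \<times> ((r - p) v* A))$3"
      by (simp add: u3 cross_rotation_matrix[OF rotT, simplified])
    also have "\<dots> = 
        ((q v* A)$1 - (p v* A)$1) * ((r v* A)$2 - (p v* A)$2)
      - ((q v* A)$2 - (p v* A)$2) * ((r v* A)$1 - (p v* A)$1)"
      by (simp add: cross3_simps vector_matrix_mult_diff_distrib)
    finally have "\<bar>u \<bullet> ((q - p) \<times> (r - p))\<bar> =
      \<bar>((r v* A)$1 - (p v* A)$1) * ((q v* A)$2 - (p v* A)$2)
      - ((q v* A)$1 - (p v* A)$1) * ((r v* A)$2 - (p v* A)$2)\<bar>"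
      by (simp add: abs_minus_commute mult.commute)
    moreover have "(x / sqrt 8 - x' / sqrt 8) * (y / sqrt 8 - y' / sqrt 8) = (x - x') * (y - y') / 8"
      for x x' y y' :: real
      by (simp flip: diff_divide_distrib)
    moreover have "g (x /\<^sub>R sqrt 8) $ 1 = (x v* A)$1 / sqrt 8" "g (x /\<^sub>R sqrt 8) $ 2 = (x v* A)$2 / sqrt 8" for x
      by (simp_all add: g_def scaleR_vector_matrix_assoc field_simps)
    ultimately show ?thesis
      by (simp add: area_triangle flip: diff_divide_distrib)
  qed
  have "brightness tetrahedron u = measure lebesgue (g ` tetrahedron)"
    unfolding g_def by (rule brightness_rotated[OF A u])
      (simp add: tetrahedron_def finite_imp_compact_convex_hull)
  also have "g ` tetrahedron = convex hull {g (xi1 /\<^sub>R sqrt 8), g (xi2 /\<^sub>R sqrt 8), g (xi3 /\<^sub>R sqrt 8), g (xi4 /\<^sub>R sqrt 8)}"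
    by (simp add: tetrahedron_def convex_hull_linear_image[OF lin])
  also have "measure lebesgue \<dots> =
      1 / 4 * (\<bar>u \<bullet> xi1\<bar> + \<bar>u \<bullet> xi2\<bar> + \<bar>u \<bullet> xi3\<bar> + \<bar>u \<bullet> xi4\<bar>) / 2"
  proof (rule area_hull_4)
    show "u \<bullet> xi1 + u \<bullet> xi2 + u \<bullet> xi3 + u \<bullet> xi4 = 0"
      by (simp add: inner_vec3 xi_defs)
    have "(u \<bullet> xi1) *\<^sub>R xi1 + (u \<bullet> xi2) *\<^sub>R xi2 + (u \<bullet> xi3) *\<^sub>R xi3 + (u \<bullet> xi4) *\<^sub>R xi4 = 4 *\<^sub>R u"
      by (simp add: inner_vec3 xi_defs vector_3_eq_iff)
    then have "(u \<bullet> xi1) *\<^sub>R g xi1 + (u \<bullet> xi2) *\<^sub>R g xi2 + (u \<bullet> xi3) *\<^sub>R g xi3 + (u \<bullet> xi4) *\<^sub>R g xi4 = 4 *\<^sub>R g u"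
      by (metis linear_add[OF lin] linear_scale[OF lin])
    also have "g u = 0"
      by (simp add: g_def orthogonal_matrix_inverse[OF orth] vector_2_eq_iff axis_def flip: u)
    finally show "(u \<bullet> xi1) *\<^sub>R g (xi1 /\<^sub>R sqrt 8) + (u \<bullet> xi2) *\<^sub>R g (xi2 /\<^sub>R sqrt 8)
        + (u \<bullet> xi3) *\<^sub>R g (xi3 /\<^sub>R sqrt 8) + (u \<bullet> xi4) *\<^sub>R g (xi4 /\<^sub>R sqrt 8) = 0"
      by (simp add: linear_scale[OF lin] scaleR_left_commute[of "u \<bullet> _"] del: scaleR_scaleR flip: scaleR_add_right)
    show "u \<bullet> xi1 \<noteq> 0 \<or> u \<bullet> xi2 \<noteq> 0 \<or> u \<bullet> xi3 \<noteq> 0 \<or> u \<bullet> xi4 \<noteq> 0"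
    proof (rule ccontr)
      assume "\<not> ?thesis"
      then have "u = 0" by (simp add: inner_vec3 xi_defs vector_3_eq_iff)
      with assms show False by simp
    qed
  \<comment> \<open>For the triangle without the i-th vertex, the cross product of two sides is 4 or
    -4 times the vector \<open>\<xi>\<^sub>i\<close>; with the factor 1/16 from \<open>area\<close>
    this explains the constant \<open>1 / 4\<close>.\<close>
  qed (simp_all add: area, simp_all add: inner_vec3 xi_defs cross3_simps,
      simp_all add: abs_if)
  finally show ?thesis by simp
qed

unbundle no cross3_syntax


section \<open>Rotation-invariant distributions on the sphere\<close>

lemma prod_Basis_cart: "(\<Prod>b\<in>Basis. x \<bullet> b) = (\<Prod>i\<in>UNIV. x $ i)" for x :: "real^'n"
proof -
  have B: "(Basis :: (real^'n) set) = (\<lambda>i. axis i 1) ` UNIV"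
    by (auto simp: Basis_vec_def)
  have "inj (\<lambda>i::'n. axis i (1::real))"
    by (auto simp: inj_def axis_eq_axis)
  then show ?thesis
    unfolding B by (subst prod.reindex) (simp_all add: inner_axis)
qed

lemma prod_2: "prod f (UNIV :: 2 set) = f 1 * f 2"
  unfolding UNIV_2 by simp

lemma prod_3: "prod f (UNIV :: 3 set) = f 1 * f 2 * f 3"
  unfolding UNIV_3 by (simp add: ac_simps)

lemma mem_box_vec3: "(x::real^3) \<in> box l u \<longleftrightarrow> l$1 < x$1 \<and> x$1 < u$1 \<and> l$2 < x$2 \<and> x$2 < u$2 \<and> l$3 < x$3 \<and> x$3 < u$3"
  by (auto simp: mem_box_cart forall_3)

lemma norm_vec3: "norm (x::real^3) = sqrt ((x$1)\<^sup>2 + (x$2)\<^sup>2 + (x$3)\<^sup>2)"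
  by (simp add: norm_vec_def L2_set_def sum_3)

lemma measurable_vector_3 [measurable]:
  assumes [measurable]: "f \<in> borel_measurable M" "g \<in> borel_measurable M" "h \<in> borel_measurable M"
  shows "(\<lambda>x. vector [f x, g x, h x] :: real^3) \<in> borel_measurable M"
proof (subst borel_measurable_euclidean_space, intro ballI)
  fix b :: "real^3" assume "b \<in> Basis"
  then obtain i where "b = axis i 1" by (auto simp: Basis_vec_def)
  then show "(\<lambda>x. vector [f x, g x, h x] \<bullet> b) \<in> borel_measurable M"
    using exhaust_3[of i] by (auto simp: inner_axis)
qed

lemma measurable_vec_nth [measurable]: "(\<lambda>x. x $ i) \<in> borel_measurable (borel :: (real^'n) measure)"
  by (intro borel_measurable_continuous_onI continuous_intros)

section \<open>Volume of a spherical sector\<close>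

definition join3 :: "real \<times> (real^2) \<Rightarrow> real^3" where
  "join3 = (\<lambda>(z, v). vector [z, v$1, v$2])"

lemma measurable_join3 [measurable]: "join3 \<in> borel_measurable borel"
  unfolding join3_def borel_prod[symmetric] case_prod_beta by measurable

lemma distr_lborel_join3:
  "distr (lborel :: (real \<times> (real^2)) measure) borel join3 = lborel"
proof (rule lborel_eqI[symmetric])
  fix l u :: "real^3" assume "\<And>b. b \<in> Basis \<Longrightarrow> l \<bullet> b \<le> u \<bullet> b"
  then have le: "l$1 \<le> u$1" "l$2 \<le> u$2" "l$3 \<le> u$3"
    by (metis axis_in_Basis_iff inner_axis inner_real_def mult.right_neutral real_inner_1_right Basis_real_def insertI1)+
  have eq: "join3 -` box l u = {l$1 <..< u$1} \<times> box (vector [l$2, l$3]) (vector [u$2, u$3])"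
    by (auto simp: join3_def mem_box_vec3 mem_box_cart forall_2)
  have b2: "emeasure lborel (box (vector [l$2, l$3]) (vector [u$2, u$3]) :: (real^2) set)
      = ennreal ((u$2 - l$2) * (u$3 - l$3))"
  proof -
    let ?a = "vector [l$2, l$3] :: real^2" and ?b = "vector [u$2, u$3] :: real^2"
    have "?a \<bullet> b \<le> ?b \<bullet> b" if "b \<in> Basis" for b
    proof -
      obtain i where "b = axis i 1" using \<open>b \<in> Basis\<close> by (auto simp: Basis_vec_def)
      then show ?thesis using exhaust_2[of i] le by (auto simp: inner_axis)
    qed
    then have "emeasure lborel (box ?a ?b) = ennreal (\<Prod>b\<in>Basis. (?b - ?a) \<bullet> b)"
      by (rule emeasure_lborel_box)
    then show ?thesis by (simp only: prod_Basis_cart prod_2) simp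
  qed
  have "emeasure (distr lborel borel join3) (box l u) =
     emeasure (lborel \<Otimes>\<^sub>M lborel) ({l$1 <..< u$1} \<times> box (vector [l$2, l$3]) (vector [u$2, u$3]) :: (real \<times> (real^2)) set)"
    by (subst emeasure_distr) (simp_all add: eq lborel_prod)
  also have "\<dots> = ennreal (u$1 - l$1) * ennreal ((u$2 - l$2) * (u$3 - l$3))"
    using le by (subst lborel.emeasure_pair_measure_Times) (simp_all add: b2)
  also have "\<dots> = ennreal ((u$1 - l$1) * ((u$2 - l$2) * (u$3 - l$3)))"
    using le by (intro ennreal_mult[symmetric]) simp_all
  also have "(u$1 - l$1) * ((u$2 - l$2) * (u$3 - l$3)) = (\<Prod>b\<in>Basis. (u - l) \<bullet> b)"
    by (simp only: prod_Basis_cart prod_3 vector_minus_component mult.assoc)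
  finally show "emeasure (distr lborel borel join3) (box l u) = ennreal (\<Prod>b\<in>Basis. (u - l) \<bullet> b)" .
qed simp

lemma emeasure_sector:
  assumes h: "0 < h" "h < 1"
  shows "emeasure lborel {y::real^3. norm y < 1 \<and> h * norm y < y$1} = ennreal (2 * pi / 3 * (1 - h))"
proof -
  \<comment> \<open>The squared radius of the disc at height \<open>z\<close>: the cone bounds it up
    to \<open>z = h\<close>, the unit sphere from there on.\<close>
  let ?r = "\<lambda>z. min (1 - z\<^sup>2) (z\<^sup>2 * (1 / h\<^sup>2 - 1))"
  let ?S = "{y::real^3. norm y < 1 \<and> h * norm y < y$1}"
  have slice: "Pair z -` (join3 -` ?S) = (if z \<in> {0<..<1} then ball 0 (sqrt (?r z)) else {})" for z
  proof -
    have "norm (join3 (z, v)) < 1 \<and> h * norm (join3 (z, v)) < z \<longleftrightarrow> 0 < z \<and> (norm v)\<^sup>2 < ?r z" for v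
    proof -
      have n: "norm (join3 (z, v)) = sqrt (z\<^sup>2 + (norm v)\<^sup>2)"
        by (simp add: norm_vec3 join3_def norm_vec_def[of v] L2_set_def sum_2 add.assoc)
      have 1: "norm (join3 (z, v)) < 1 \<longleftrightarrow> (norm v)\<^sup>2 < 1 - z\<^sup>2"
        unfolding n by auto
      have 2: "h * norm (join3 (z, v)) < z \<longleftrightarrow> 0 < z \<and> (norm v)\<^sup>2 < z\<^sup>2 * (1 / h\<^sup>2 - 1)"
      proof (cases "0 < z")
        case True
        have "h * norm (join3 (z, v)) < z \<longleftrightarrow> sqrt (h\<^sup>2 * (z\<^sup>2 + (norm v)\<^sup>2)) < sqrt (z\<^sup>2)"
          using h True by (simp add: n real_sqrt_mult)
        also have "\<dots> \<longleftrightarrow> h\<^sup>2 * (z\<^sup>2 + (norm v)\<^sup>2) < z\<^sup>2"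
          by (rule real_sqrt_less_iff)
        also have "\<dots> \<longleftrightarrow> (norm v)\<^sup>2 < z\<^sup>2 * (1 / h\<^sup>2 - 1)"
          using h by (simp add: field_simps)
        finally show ?thesis using True by simp
      next
        case False
        have "0 \<le> h * norm (join3 (z, v))" using h by simp
        then show ?thesis using False by auto
      qed
      show ?thesis using 1 2 by auto
    qed
    moreover have "(norm v)\<^sup>2 < ?r z \<longleftrightarrow> norm v < sqrt (?r z)" for v :: "real^2"
      by (metis real_sqrt_abs real_sqrt_less_iff abs_norm_cancel)
    moreover have "z < 1" if "(norm v)\<^sup>2 < ?r z" for v :: "real^2"
    proof -
      have "z\<^sup>2 < 1" using that zero_le_power2[of "norm v"] by linarith
      then show ?thesis by (simp add: power2_less_1_iff abs_less_iff)
    qed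
    ultimately show ?thesis
      by (auto simp: join3_def) 
  qed
  have nonneg: "0 \<le> ?r z" if "z \<in> {0..1}" for z
  proof -
    have "h\<^sup>2 \<le> 1" "z\<^sup>2 \<le> 1" using h that by (auto simp: power_le_one)
    then show ?thesis using h by (simp add: field_simps mult_left_le_one_le)
  qed
  have "emeasure lborel ?S = emeasure (lborel \<Otimes>\<^sub>M lborel) (join3 -` ?S)"
    by (subst distr_lborel_join3[symmetric], subst emeasure_distr) (simp_all add: lborel_prod)
  also have "\<dots> = (\<integral>\<^sup>+z. emeasure lborel (Pair z -` (join3 -` ?S)) \<partial>lborel)"
  proof (rule lborel.emeasure_pair_measure_alt)
    have "join3 -` ?S \<in> sets borel"
      by (rule measurable_sets_borel[OF measurable_join3]) measurable
    then show "join3 -` ?S \<in> sets (lborel \<Otimes>\<^sub>M lborel)" by (simp only: lborel_prod sets_lborel)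
  qed
  also have "\<dots> = (\<integral>\<^sup>+z. ennreal (pi * ?r z) * indicator {0..1} z \<partial>lborel)"
  proof (intro nn_integral_cong_AE)
    have "AE z in lborel. z \<noteq> (0::real)" "AE z in lborel. z \<noteq> (1::real)"
      by (rule AE_lborel_singleton)+
    then show "AE z in lborel. emeasure lborel (Pair z -` (join3 -` ?S)) = ennreal (pi * ?r z) * indicator {0..1} z"
    proof eventually_elim
      case (elim z)
      then show ?case
        unfolding slice using nonneg[of z]
        by (auto simp: emeasure_ball unit_ball_vol_2 indicator_def simp del: min_less_iff_conj)
    qed
  qed
  also have "\<dots> = ennreal (2 * pi / 3 * (1 - h))"
  proof (rule nn_integral_has_integral_lebesgue')
    show "0 \<le> pi * ?r z" if "z \<in> {0..1}" for z using nonneg[OF that] by simp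
    have 1: "((\<lambda>z. pi * (z\<^sup>2 * (1 / h\<^sup>2 - 1))) has_integral
        (pi * (h^3/3 * (1 / h\<^sup>2 - 1)) - pi * (0^3/3 * (1 / h\<^sup>2 - 1)))) {0..h}"
      using h by (intro fundamental_theorem_of_calculus)
        (auto intro!: derivative_eq_intros simp flip: has_real_derivative_iff_has_vector_derivative)
    have 2: "((\<lambda>z. pi * (1 - z\<^sup>2)) has_integral
        (pi * (1 - 1^3/3) - pi * (h - h^3/3))) {h..1}"
      using h by (intro fundamental_theorem_of_calculus)
        (auto intro!: derivative_eq_intros simp flip: has_real_derivative_iff_has_vector_derivative)
    have e1: "?r z = z\<^sup>2 * (1 / h\<^sup>2 - 1)" if "z \<in> {0..h}" for z
    proof -
      have "z\<^sup>2 \<le> h\<^sup>2" using that by (auto intro: power_mono)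
      then show ?thesis using h by (simp add: min_def field_simps)
    qed
    have e2: "?r z = 1 - z\<^sup>2" if "z \<in> {h..1}" for z
    proof -
      have "h\<^sup>2 \<le> z\<^sup>2" using that h by (auto intro: power_mono)
      then show ?thesis using h by (simp add: min_def field_simps)
    qed
    have "((\<lambda>z. pi * ?r z) has_integral
      (pi * (h^3/3 * (1 / h\<^sup>2 - 1)) - pi * (0^3/3 * (1 / h\<^sup>2 - 1))) +
      (pi * (1 - 1^3/3) - pi * (h - h^3/3))) {0..1}"
    proof (rule has_integral_combine[of 0 h 1])
      show "((\<lambda>z. pi * ?r z) has_integral
          (pi * (h^3/3 * (1 / h\<^sup>2 - 1)) - pi * (0^3/3 * (1 / h\<^sup>2 - 1)))) {0..h}"
        by (rule has_integral_eq[OF _ 1]) (simp only: e1)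
      show "((\<lambda>z. pi * ?r z) has_integral (pi * (1 - 1^3/3) - pi * (h - h^3/3))) {h..1}"
        by (rule has_integral_eq[OF _ 2]) (simp only: e2)
    qed (use h in auto)
    also have "(pi * (h^3/3 * (1 / h\<^sup>2 - 1)) - pi * (0^3/3 * (1 / h\<^sup>2 - 1))) +
      (pi * (1 - 1^3/3) - pi * (h - h^3/3)) = 2 * pi / 3 * (1 - h)"
      using h by (simp add: field_simps power3_eq_cube power2_eq_square)
    finally show "((\<lambda>z. pi * ?r z) has_integral 2 * pi / 3 * (1 - h)) {0..1}" .
  qed
  finally show ?thesis .
qed


lemma emeasure_lborel_sector:
  assumes h: "0 < h" "h < 1" and c: "norm c = 1"
  shows "emeasure lborel {y::real^3. norm y < 1 \<and> h * norm y < c \<bullet> y} = ennreal (2 * pi / 3 * (1 - h))"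
proof -
  obtain A where A: "rotation_matrix A" and Ac: "A *v axis 1 1 = c"
    using rotation_matrix_exists_basis[of c 1] c by auto
  let ?S = "\<lambda>c. {y::real^3. norm y < 1 \<and> h * norm y < c \<bullet> y}"
  have orth: "orthogonal_transformation ((*v) A)"
    using A by (simp add: rotation_matrix_def orthogonal_transformation_matrix)
  have lm: "?S c \<in> lmeasurable" for c
  proof (rule lmeasurable_open)
    show "bounded (?S c)" by (rule bounded_subset[of "ball 0 1"]) auto
    show "open (?S c)" by (intro open_Collect_conj open_Collect_less continuous_intros)
  qed
  have bor: "?S c \<in> sets borel" for c by measurable
  have eq: "(*v) A ` ?S (axis 1 1) = ?S c"
  proof -
    have "surj ((*v) A)" using orth by (rule orthogonal_transformation_surj)
    moreover have "(A *v y) \<in> ?S c \<longleftrightarrow> y \<in> ?S (axis 1 1)" for y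
      using orth by (simp add: orthogonal_transformation_norm flip: Ac) (simp add: orthogonal_transformation_def)
    ultimately show ?thesis by (fastforce simp: surj_def image_iff)
  qed
  have vol: "emeasure lborel (?S c) = ennreal (measure lebesgue (?S c))" for c
  proof -
    have "emeasure lborel (?S c) = emeasure lebesgue (?S c)" using bor[of c] by simp
    then show ?thesis using emeasure_eq_measure2[OF lm[of c]] by simp
  qed
  have "emeasure lborel (?S c) = emeasure lborel (?S (axis 1 1))"
    using measure_orthogonal_image[OF orth lm[of "axis 1 1"]] unfolding vol eq by (simp only:)
  then show ?thesis using emeasure_sector[OF h] by (simp add: inner_axis')
qed

section \<open>Rotation-invariant laws and their caps\<close>

lemma measurable_matrix_mult [measurable]: "(*v) A \<in> borel_measurable (borel :: (real^'n) measure)"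
  for A :: "real^'n^'m"
  by (intro borel_measurable_continuous_onI linear_continuous_on matrix_vector_mul_bounded_linear)

text \<open>The law is kept as a Borel measure on the whole space that is concentrated on the
  sphere, so that products with Lebesgue measure can be formed without restricted
  sigma-algebras.\<close>

locale rotation_invariant = prob_space N for N :: "(real^3) measure" +
  assumes sets_N [measurable_cong]: "sets N = sets borel"
    and AE_norm: "AE x in N. norm x = 1"
    and distr_rotation: "rotation_matrix A \<Longrightarrow> distr N borel ((*v) A) = N"
begin

lemma space_N [simp]: "space N = UNIV"
  using sets_eq_imp_space_eq[OF sets_N] by simp

lemma emeasure_rotation:
  assumes "rotation_matrix A" and "S \<in> sets borel"
  shows "emeasure N {x. A *v x \<in> S} = emeasure N S"
proof -
  have "emeasure N S = emeasure (distr N borel ((*v) A)) S"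
    using assms by (simp add: distr_rotation)
  also have "\<dots> = emeasure N {x. A *v x \<in> S}"
    using assms by (subst emeasure_distr) (auto simp: vimage_def sets_N cong: measurable_cong_sets)
  finally show ?thesis ..
qed

lemma emeasure_cap_eq:
  assumes c: "norm c = 1"
  shows "emeasure N {x. h < x \<bullet> c} = emeasure N {x. h < x$1}"
proof -
  obtain A where A: "rotation_matrix A" and Ac: "A *v axis 1 1 = c"
    using rotation_matrix_exists_basis[of c 1] c by auto
  have "x \<bullet> c = (transpose A *v x)$1" for x
    using inner_column_vector_matrix_mult[OF Ac, of x] by (simp add: inner_commute)
  then have "{x. h < x \<bullet> c} = {x. transpose A *v x \<in> {x. h < x$1}}" by simp
  also have "emeasure N \<dots> = emeasure N {x. h < x$1}"
    by (rule emeasure_rotation) (use A in \<open>simp_all add: rotation_matrix_def orthogonal_matrix_transpose\<close>)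
  finally show ?thesis .
qed

end

section \<open>Periodic sets, rotation matrices and polar coordinates\<close>

lemma emeasure_lborel_translate:
  fixes a :: "'b::euclidean_space"
  assumes "S \<in> sets borel"
  shows "emeasure lborel {x. a + x \<in> S} = emeasure lborel S"
proof -
  have "emeasure lborel S = emeasure (distr lborel borel ((+) a)) S"
    by (simp add: lborel_distr_plus)
  also have "\<dots> = emeasure lborel {x. a + x \<in> S}"
    using assms by (subst emeasure_distr) (auto simp: vimage_def)
  finally show ?thesis ..
qed

text \<open>The shifted window \<open>{a..<a + c}\<close> is cut at \<open>c\<close>, and the part
  beyond \<open>c\<close> is moved back by one period.\<close>

lemma emeasure_periodic_shift:
  fixes a c :: real
  assumes P [measurable]: "P \<in> sets borel" and per: "\<And>t. c + t \<in> P \<longleftrightarrow> t \<in> P" and a: "0 \<le> a" "a \<le> c"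
  shows "emeasure lborel {t\<in>{0..<c}. a + t \<in> P} = emeasure lborel {t\<in>{0..<c}. t \<in> P}"
proof -
  have "emeasure lborel {t\<in>{0..<c}. a + t \<in> P} = emeasure lborel {t. a + t \<in> {a..<a + c} \<inter> P}"
    by (rule arg_cong[where f = "emeasure lborel"]) auto
  also have "\<dots> = emeasure lborel ({a..<a + c} \<inter> P)"
    by (rule emeasure_lborel_translate) simp
  also have "{a..<a + c} \<inter> P = ({a..<c} \<inter> P) \<union> ({c..<c + a} \<inter> P)"
    using a by auto
  also have "emeasure lborel \<dots> = emeasure lborel ({a..<c} \<inter> P) + emeasure lborel ({c..<c + a} \<inter> P)"
    by (rule plus_emeasure[symmetric]) auto
  also have "emeasure lborel ({c..<c + a} \<inter> P) = emeasure lborel {t. c + t \<in> {c..<c + a} \<inter> P}"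
    by (rule emeasure_lborel_translate[symmetric]) simp
  also have "{t. c + t \<in> {c..<c + a} \<inter> P} = {0..<a} \<inter> P"
    by (auto simp: per)
  also have "emeasure lborel ({a..<c} \<inter> P) + emeasure lborel ({0..<a} \<inter> P) =
      emeasure lborel (({a..<c} \<inter> P) \<union> ({0..<a} \<inter> P))"
    by (rule plus_emeasure) auto
  also have "({a..<c} \<inter> P) \<union> ({0..<a} \<inter> P) = {t\<in>{0..<c}. t \<in> P}"
    using a by auto
  finally show ?thesis .
qed

lemma rotation_matrix_3I:
  fixes A :: "real^3^3"
  assumes "A ** transpose A = mat 1" "det A = 1"
  shows "rotation_matrix A"
  using assms by (simp add: rotation_matrix_def orthogonal_matrix_def matrix_left_right_inverse)

definition rows3 :: "real^3 \<Rightarrow> real^3 \<Rightarrow> real^3 \<Rightarrow> real^3^3" where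
  "rows3 a b c = vector [a, b, c]"

lemma rows3_mult: "rows3 a b c *v x = vector [a \<bullet> x, b \<bullet> x, c \<bullet> x]"
  by (simp add: rows3_def matrix_vector_mult_def inner_vec_def vector_3_eq_iff)

lemma rotation_rows3:
  assumes "a \<bullet> a = 1" "b \<bullet> b = 1" "c \<bullet> c = 1" "a \<bullet> b = 0" "a \<bullet> c = 0" "b \<bullet> c = 0"
    and "det (rows3 a b c) = 1"
  shows "rotation_matrix (rows3 a b c)"
proof (rule rotation_matrix_3I)
  show "rows3 a b c ** transpose (rows3 a b c) = mat 1"
    using assms by (simp add: rows3_def matrix_matrix_mult_def transpose_def mat_def inner_vec_def
        vec_eq_iff forall_3 sum_3 mult.commute)
qed fact

lemma det_rows3: "det (rows3 a b c) = a$1 * (b$2 * c$3 - b$3 * c$2) - a$2 * (b$1 * c$3 - b$3 * c$1)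
    + a$3 * (b$1 * c$2 - b$2 * c$1)"
  by (simp add: det_3 rows3_def algebra_simps)

lemma sphere_polar:
  fixes x :: "real^3"
  assumes "norm x = 1"
  obtains t where "0 \<le> t" "t < 2 * pi" 
    "x$2 = sqrt (1 - (x$1)\<^sup>2) * cos t" "x$3 = sqrt (1 - (x$1)\<^sup>2) * sin t"
proof -
  let ?r = "sqrt (1 - (x$1)\<^sup>2)"
  have sq: "(x$1)\<^sup>2 + (x$2)\<^sup>2 + (x$3)\<^sup>2 = 1"
    using assms by (simp add: norm_vec3)
  then have r2: "?r\<^sup>2 = (x$2)\<^sup>2 + (x$3)\<^sup>2"
    using zero_le_power2[of "x$2"] zero_le_power2[of "x$3"] by (subst real_sqrt_pow2) linarith+
  show thesis
  proof (cases "?r = 0")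
    case True
    then have "x$2 = 0" "x$3 = 0" using r2 by (simp_all add: add_nonneg_eq_0_iff)
    then show thesis using that[of 0] True by simp
  next
    case False
    then have "(x$2 / ?r)\<^sup>2 + (x$3 / ?r)\<^sup>2 = 1"
      unfolding power_divide add_divide_distrib[symmetric] r2[symmetric] by simp
    then obtain t where "0 \<le> t" "t < 2 * pi" "x$2 / ?r = cos t" "x$3 / ?r = sin t"
      using sincos_total_2pi by blast
    then show thesis using that[of t] False by (simp add: field_simps)
  qed
qed

definition parallel_fraction :: "(real^3) set \<Rightarrow> real \<Rightarrow> ennreal" where
  "parallel_fraction S z = emeasure lborel {t\<in>{0..<2*pi}.
     vector [z, sqrt (1 - z\<^sup>2) * cos t, sqrt (1 - z\<^sup>2) * sin t] \<in> S} / ennreal (2 * pi)"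

lemma measurable_parallel_fraction [measurable]:
  assumes [measurable]: "S \<in> sets borel"
  shows "parallel_fraction S \<in> borel_measurable borel"
proof -
  define T where "T = {p :: real \<times> real. snd p \<in> {0..<2*pi} \<and>
      vector [fst p, sqrt (1 - (fst p)\<^sup>2) * cos (snd p), sqrt (1 - (fst p)\<^sup>2) * sin (snd p)] \<in> S}"
  have T: "T \<in> sets (borel \<Otimes>\<^sub>M lborel)"
  proof -
    have "T = {p \<in> space (borel \<Otimes>\<^sub>M lborel). snd p \<in> {0..<2*pi} \<and>
      vector [fst p, sqrt (1 - (fst p)\<^sup>2) * cos (snd p), sqrt (1 - (fst p)\<^sup>2) * sin (snd p)] \<in> S}"
      by (simp add: T_def space_pair_measure)
    also have "\<dots> \<in> sets (borel \<Otimes>\<^sub>M lborel)" by measurable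
    finally show ?thesis .
  qed
  have "(\<lambda>z. emeasure lborel (Pair z -` T) / ennreal (2 * pi)) \<in> borel_measurable borel"
    using lborel.measurable_emeasure_Pair[OF T] by measurable
  then show ?thesis
    by (rule measurable_cong[THEN iffD1, rotated]) (simp add: parallel_fraction_def T_def)
qed

section \<open>Law of the height and of the longitude\<close>

context rotation_invariant
begin

text \<open>
  Let \<open>y\<close> range over the unit ball with Lebesgue measure. The mass of \<open>{x. h * norm y < x \<bullet> y}\<close> does not
  depend on \<open>y\<close>, and the volume of \<open>{y. h * norm y < x \<bullet> y}\<close> does not depend on \<open>x\<close>, so Fubini equates
  the mass of the cap with the relative volume of a spherical sector.
\<close>

lemma emeasure_cap:
  assumes h: "0 < h" "h < 1"
  shows "emeasure N {x. h < x$1} = ennreal ((1 - h) / 2)"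
proof -
  interpret L: pair_sigma_finite N "lborel :: (real^3) measure" ..
  let ?V = "ennreal (2 * pi / 3 * (1 - h))" and ?q = "emeasure N {x. h < x$1}"
  define T where "T = {p :: (real^3) \<times> (real^3). norm (snd p) < 1 \<and> h * norm (snd p) < fst p \<bullet> snd p}"
  have "open T"
    unfolding T_def by (intro open_Collect_conj open_Collect_less continuous_intros)
  then have "T \<in> sets (borel \<Otimes>\<^sub>M borel)"
    using borel_open unfolding borel_prod by blast
  then have T: "T \<in> sets (N \<Otimes>\<^sub>M lborel)"
    by (metis sets_N sets_lborel sets_pair_measure_cong)
  have "emeasure (N \<Otimes>\<^sub>M lborel) T = (\<integral>\<^sup>+x. emeasure lborel (Pair x -` T) \<partial>N)"
    by (rule lborel.emeasure_pair_measure_alt[OF T])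
  also have "\<dots> = (\<integral>\<^sup>+x. ?V \<partial>N)"
    by (rule nn_integral_cong_AE, use AE_norm in eventually_elim)
      (use emeasure_lborel_sector[OF h] in \<open>simp add: T_def\<close>)
  also have "\<dots> = ?V"
    by (simp add: emeasure_space_1[simplified])
  finally have V: "emeasure (N \<Otimes>\<^sub>M lborel) T = ?V" .
  have "emeasure (N \<Otimes>\<^sub>M lborel) T = (\<integral>\<^sup>+y. emeasure N ((\<lambda>x. (x, y)) -` T) \<partial>lborel)"
    by (rule L.emeasure_pair_measure_alt2[OF T])
  also have "\<dots> = (\<integral>\<^sup>+y. ?q * indicator (ball 0 1 :: (real^3) set) y \<partial>lborel)"
  proof (rule nn_integral_cong_AE)
    \<comment> \<open>For nonzero \<open>y\<close> in the ball the condition on \<open>x\<close> is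
      a cap around the direction of \<open>y\<close>, whose mass does not depend on that direction.
      The origin, which has no direction, is a null set.\<close>
    have "AE y in lborel. y \<noteq> (0::real^3)" by (rule AE_lborel_singleton)
    then show "AE y in lborel. emeasure N ((\<lambda>x. (x, y)) -` T) = ?q * indicator (ball 0 1) y"
    proof eventually_elim
      case (elim y)
      have "(\<lambda>x. (x, y)) -` T = (if norm y < 1 then {x. h < x \<bullet> (y /\<^sub>R norm y)} else {})"
        using elim by (auto simp: T_def field_simps)
      then show ?case
        using emeasure_cap_eq[of "y /\<^sub>R norm y" h] elim by (simp add: indicator_def)
    qed
  qed
  also have "\<dots> = ?q * emeasure lborel (ball 0 1 :: (real^3) set)"
    by (rule nn_integral_cmult_indicator) simp
  also have "\<dots> = ?q * ennreal (4 / 3 * pi)"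
    by (simp add: emeasure_ball unit_ball_vol_3)
  finally have "ennreal (prob {x. h < x$1}) * ennreal (4 / 3 * pi) = ?V"
    using V by (simp add: emeasure_eq_measure)
  then have "prob {x. h < x$1} * (4 / 3 * pi) = 2 * pi / 3 * (1 - h)"
    using h by (subst (asm) ennreal_mult[symmetric], simp_all)
  then have "prob {x. h < x$1} * (4 / 3 * pi) = (1 - h) / 2 * (4 / 3 * pi)"
    by simp
  then have "prob {x. h < x$1} = (1 - h) / 2"
    by (subst (asm) mult_right_cancel) simp_all
  then show ?thesis by (simp only: emeasure_eq_measure)
qed

lemma emeasure_first_coord_flip: "emeasure N {x. x$1 < 0} = emeasure N {x. 0 < x$1}"
proof -
  let ?A = "rows3 (vector [-1, 0, 0]) (vector [0, -1, 0]) (vector [0, 0, 1])"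
  have "rotation_matrix ?A"
    by (rule rotation_rows3) (simp_all add: det_rows3 inner_vec3)
  from emeasure_rotation[OF this, of "{x. 0 < x$1}"] show ?thesis
    by (simp add: rows3_mult inner_vec3)
qed

text \<open>Two disjoint opposite half-spaces of equal mass have at most one half each; the caps of
  height tending to 0 force at least one half. Consequently the great circle between them has no
  mass.\<close>

lemma prob_halfspace: "prob {x. 0 < x$1} = 1 / 2"
proof -
  let ?p = "prob {x. 0 < x$1}"
  have [measurable]: "{x. 0 < x$1} \<in> events" "{x. x$1 < 0} \<in> events" "{x. h < x$1} \<in> events" for h by measurable
  have "prob {x. x$1 < 0} = ?p"
    using emeasure_first_coord_flip by (simp add: emeasure_eq_measure)
  moreover have "prob {x. x$1 < 0} + ?p = prob ({x. x$1 < 0} \<union> {x. 0 < x$1})"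
    by (rule finite_measure_Union[symmetric]) auto
  ultimately have "?p \<le> 1 / 2" using prob_le_1[of "{x. x$1 < 0} \<union> {x. 0 < x$1}"] by linarith
  moreover have "1 / 2 \<le> ?p"
  proof (rule field_le_epsilon)
    fix e :: real assume "0 < e"
    define d where "d = min e (1 / 2)"
    have d: "0 < d" "d < 1" "d \<le> e" using \<open>0 < e\<close> by (auto simp: d_def)
    have "(1 - d) / 2 = prob {x. d < x$1}"
      using emeasure_cap[OF d(1,2)] d by (simp add: emeasure_eq_measure)
    also have "\<dots> \<le> ?p" using d by (intro finite_measure_mono) auto
    finally show "1 / 2 \<le> ?p + e" using d by (simp add: field_simps)
  qed
  ultimately show ?thesis by simp
qed

lemma emeasure_first_coord_zero: "emeasure N {x. x$1 = 0} = 0"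
proof -
  have [measurable]: "{x. 0 < x$1} \<in> events" "{x. x$1 < 0} \<in> events" "{x. x$1 = 0} \<in> events" by measurable
  have "1 = prob ({x. x$1 < 0} \<union> ({x. 0 < x$1} \<union> {x. x$1 = 0}))"
    by (subst prob_space[symmetric]) (auto intro!: arg_cong[of _ _ prob])
  also have "\<dots> = prob {x. x$1 < 0} + (prob {x. 0 < x$1} + prob {x. x$1 = 0})"
    by (subst finite_measure_Union; (subst finite_measure_Union)?) auto
  finally show ?thesis
    using prob_halfspace emeasure_first_coord_flip by (simp add: emeasure_eq_measure)
qed

lemma emeasure_cap_empty: "1 \<le> h \<Longrightarrow> emeasure N {x. h < x$1} = 0"
proof -
  assume h: "1 \<le> h"
  have "AE x in N. \<not> h < x$1"
    using AE_norm
  proof eventually_elim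
    case (elim x)
    then show ?case using component_le_norm_cart[of x 1] h by simp
  qed
  then show ?thesis by (subst (asm) AE_iff_measurable[of "{x. h < x$1}"]) (auto simp: sets_N)
qed

text \<open>Both measures are compared on the rays \<open>{t<..}\<close>, where the left one gives
  the mass of a cap. Positive heights are enough, because each cone lies on the positive side of its
  own axis.\<close>

lemma density_first_coord:
  "density (distr N borel (\<lambda>x. x$1)) (indicator {0<..}) =
   density lborel (\<lambda>z. ennreal (1 / 2) * indicator {0<..<1} z)" (is "?M1 = ?M2")
proof (rule measure_eqI_lessThan)
  have M1: "emeasure ?M1 {t<..} = emeasure N {x. max t 0 < x$1}" for t
  proof -
    have "emeasure ?M1 {t<..} = (\<integral>\<^sup>+x. indicator {0<..} (x$1) * indicator {t<..} (x$1) \<partial>N)"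
      by (subst emeasure_density, simp, simp) (subst nn_integral_distr, simp_all)
    also have "\<dots> = (\<integral>\<^sup>+x. indicator {x. max t 0 < x$1} x \<partial>N)"
      by (rule nn_integral_cong) (auto simp: indicator_def)
    also have "\<dots> = emeasure N {x. max t 0 < x$1}"
      by (rule nn_integral_indicator) simp
    finally show ?thesis .
  qed
  show "emeasure ?M1 {t<..} < \<infinity>" for t
    unfolding M1 by (simp add: emeasure_eq_measure)
  show "emeasure ?M1 {t<..} = emeasure ?M2 {t<..}" for t
  proof -
    have "emeasure ?M2 {t<..} = (\<integral>\<^sup>+z. ennreal (1 / 2) * indicator {max t 0<..<1} z \<partial>lborel)"
      by (subst emeasure_density) (auto simp: indicator_def intro!: nn_integral_cong)
    also have "\<dots> = ennreal (1 / 2) * emeasure lborel {max t 0<..<1}"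
      by (rule nn_integral_cmult_indicator) simp
    also have "\<dots> = emeasure N {x. max t 0 < x$1}"
    proof (cases "t < 1")
      case True
      then have "ennreal (1 / 2) * emeasure lborel {max t 0<..<1} = ennreal (1 / 2) * ennreal (1 - max t 0)"
        by simp
      also have "\<dots> = ennreal (1 / 2 * (1 - max t 0))"
        using True by (intro ennreal_mult[symmetric]) auto
      also have "\<dots> = emeasure N {x. max t 0 < x$1}"
      proof (cases "0 < t")
        case True
        then show ?thesis using emeasure_cap[of t] \<open>t < 1\<close> by (simp add: max_def)
      next
        case False
        then have "max t 0 = 0" by simp
        then show ?thesis by (simp only: emeasure_eq_measure prob_halfspace) simp
      qed
      finally show ?thesis .
    next
      case False
      then show ?thesis using emeasure_cap_empty[of t] by (simp add: max_def)
    qed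
    finally show ?thesis by (simp add: M1)
  qed
qed simp_all

lemma nn_integral_first_coord:
  assumes [measurable]: "f \<in> borel_measurable borel" and "\<And>z. z \<le> 0 \<Longrightarrow> f z = 0"
  shows "(\<integral>\<^sup>+x. f (x$1) \<partial>N) = (\<integral>\<^sup>+z. ennreal (1 / 2) * f z * indicator {0<..<1} z \<partial>lborel)"
proof -
  have "(\<integral>\<^sup>+x. f (x$1) \<partial>N) = (\<integral>\<^sup>+z. f z \<partial>density (distr N borel (\<lambda>x. x$1)) (indicator {0<..}))"
    using assms by (auto simp: nn_integral_density nn_integral_distr indicator_def intro!: nn_integral_cong)
  also have "\<dots> = (\<integral>\<^sup>+z. ennreal (1 / 2) * f z * indicator {0<..<1} z \<partial>lborel)"
    unfolding density_first_coord
    by (auto simp: nn_integral_density indicator_def intro!: nn_integral_cong)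
  finally show ?thesis .
qed

text \<open>Averaging over all rotations about the first axis makes the longitude uniform.\<close>

lemma emeasure_eq_parallel_fraction:
  assumes S [measurable]: "S \<in> sets borel" and pos: "\<And>x. x \<in> S \<Longrightarrow> 0 < x$1"
  shows "emeasure N S = (\<integral>\<^sup>+z. ennreal (1 / 2) * parallel_fraction S z * indicator {0<..<1} z \<partial>lborel)"
proof -
  interpret L: pair_sigma_finite N "lborel :: real measure" ..
  let ?R = "\<lambda>t x. vector [x$1, cos t * x$2 - sin t * x$3, sin t * x$2 + cos t * x$3] :: real^3"
  have rot: "rotation_matrix (rows3 (vector [1, 0, 0]) (vector [0, cos t, - sin t]) (vector [0, sin t, cos t]))" for t
    by (rule rotation_rows3) (simp_all add: det_rows3 inner_vec3 flip: power2_eq_square)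
  define T where "T = {p :: (real^3) \<times> real. snd p \<in> {0..<2*pi} \<and> ?R (snd p) (fst p) \<in> S}"
  have T: "T \<in> sets (N \<Otimes>\<^sub>M lborel)"
  proof -
    have "T = {p \<in> space (N \<Otimes>\<^sub>M lborel). snd p \<in> {0..<2*pi} \<and> ?R (snd p) (fst p) \<in> S}"
      by (simp add: T_def space_pair_measure)
    also have "\<dots> \<in> sets (N \<Otimes>\<^sub>M lborel)" by measurable
    finally show ?thesis .
  qed
  have "emeasure (N \<Otimes>\<^sub>M lborel) T = (\<integral>\<^sup>+t. emeasure N ((\<lambda>x. (x, t)) -` T) \<partial>lborel)"
    by (rule L.emeasure_pair_measure_alt2[OF T])
  also have "\<dots> = (\<integral>\<^sup>+t. emeasure N S * indicator {0..<2*pi} t \<partial>lborel)"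
  proof (rule nn_integral_cong)
    fix t
    have "emeasure N {x. ?R t x \<in> S} = emeasure N S"
      using emeasure_rotation[OF rot[of t] S] by (simp add: rows3_mult inner_vec3)
    then show "emeasure N ((\<lambda>x. (x, t)) -` T) = emeasure N S * indicator {0..<2*pi} t"
      by (auto simp: T_def indicator_def vimage_def)
  qed
  also have "\<dots> = emeasure N S * ennreal (2 * pi)"
    by (subst nn_integral_cmult) simp_all
  finally have A: "emeasure N S = emeasure (N \<Otimes>\<^sub>M lborel) T / ennreal (2 * pi)"
    by (simp add: ennreal_mult_divide_eq)
  have "emeasure (N \<Otimes>\<^sub>M lborel) T / ennreal (2 * pi) =
      (\<integral>\<^sup>+x. emeasure lborel (Pair x -` T) \<partial>N) / ennreal (2 * pi)"
    by (simp only: lborel.emeasure_pair_measure_alt[OF T])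
  also have "\<dots> = (\<integral>\<^sup>+x. emeasure lborel (Pair x -` T) / ennreal (2 * pi) \<partial>N)"
    using lborel.measurable_emeasure_Pair[OF T] by (simp add: nn_integral_divide)
  also have "\<dots> = (\<integral>\<^sup>+x. parallel_fraction S (x$1) \<partial>N)"
  proof (rule nn_integral_cong_AE, use AE_norm in eventually_elim)
    fix x :: "real^3" assume "norm x = 1"
    let ?r = "sqrt (1 - (x$1)\<^sup>2)"
    \<comment> \<open>If \<open>x\<close> has longitude \<open>a\<close>, rotation by
      \<open>t\<close> moves it to longitude \<open>a + t\<close>. By periodicity the angles that
      bring \<open>x\<close> into \<open>S\<close> then have a total length that depends on the
      height of \<open>x\<close> only.\<close>
    obtain a where a: "0 \<le> a" "a < 2 * pi" and x: "x$2 = ?r * cos a" "x$3 = ?r * sin a"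
      using sphere_polar[OF \<open>norm x = 1\<close>] .
    let ?P = "{t. vector [x$1, ?r * cos t, ?r * sin t] \<in> S}"
    have "?R t x = vector [x$1, ?r * cos (a + t), ?r * sin (a + t)]" for t
      by (simp add: x cos_add sin_add algebra_simps)
    then have 1: "Pair x -` T = {t\<in>{0..<2*pi}. a + t \<in> ?P}"
      by (auto simp: T_def)
    have 2: "emeasure lborel {t\<in>{0..<2*pi}. a + t \<in> ?P} = emeasure lborel {t\<in>{0..<2*pi}. t \<in> ?P}"
      using a by (intro emeasure_periodic_shift) (simp_all add: cos_add sin_add)
    show "emeasure lborel (Pair x -` T) / ennreal (2 * pi) = parallel_fraction S (x$1)"
      unfolding parallel_fraction_def 1 2 by simp
  qed
  finally have B: "emeasure (N \<Otimes>\<^sub>M lborel) T / ennreal (2 * pi) = (\<integral>\<^sup>+x. parallel_fraction S (x$1) \<partial>N)" .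
  show ?thesis
    unfolding A B
  proof (rule nn_integral_first_coord)
    fix z :: real assume "z \<le> 0"
    then have E: "{t\<in>{0..<2*pi}. vector [z, sqrt (1 - z\<^sup>2) * cos t, sqrt (1 - z\<^sup>2) * sin t] \<in> S} = {}"
      using pos[of "vector [z, _, _]"] by auto
    show "parallel_fraction S z = 0" unfolding parallel_fraction_def E by simp
  qed simp
qed

end

section \<open>Arcs on parallel circles\<close>

lemma emeasure_cos_superlevel:
  fixes c :: real
  assumes c: "0 \<le> c" and rel: "rel = (<) \<or> rel = (\<le>)"
  shows "emeasure lborel {t\<in>{0..<2*pi}. rel c (cos t)} = ennreal (2 * arccos (min 1 c))"
proof -
  define \<alpha> where "\<alpha> = arccos (min 1 c)"
  let ?P = "{t\<in>{0..<2*pi}. rel c (cos t)}"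
  have \<alpha>: "0 \<le> \<alpha>" "\<alpha> \<le> pi / 2" "cos \<alpha> = min 1 c"
    unfolding \<alpha>_def using c arccos_le_pi2[of "min 1 c"] by (auto intro!: arccos_lbound)
  have P [measurable]: "?P \<in> sets borel"
    using rel by (elim disjE) (simp_all add: measurable)
  have less: "c < cos t" if "0 \<le> t" "t < \<alpha>" for t
  proof -
    have "cos \<alpha> < cos t" by (rule cos_monotone_0_pi) (use that \<alpha> in auto)
    then show ?thesis using \<alpha>(3) cos_le_one[of t] unfolding min_def by (smt (verit))
  qed
  have le: "cos t < c" if "\<alpha> < t" "t \<le> pi" for t
  proof -
    have "cos t < cos \<alpha>" by (rule cos_monotone_0_pi) (use that \<alpha> in auto)
    then show ?thesis using \<alpha>(3) by (auto simp: min_def split: if_splits)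
  qed
  have refl: "cos t = cos (2 * pi - t)" for t by simp
  have "ennreal (2 * \<alpha>) = emeasure lborel ({0..<\<alpha>} \<union> {2 * pi - \<alpha><..<2 * pi})"
    using \<alpha> by (subst plus_emeasure[symmetric]) (auto simp flip: ennreal_plus)
  also have "\<dots> \<le> emeasure lborel ?P"
  proof (rule emeasure_mono)
    have "rel c (cos t)" if "c < cos t" for t using rel that by auto
    then show "{0..<\<alpha>} \<union> {2 * pi - \<alpha><..<2 * pi} \<subseteq> ?P"
      using \<alpha> less less[of "2 * pi - _", folded refl] by auto
  qed (use P in simp)
  finally have 1: "ennreal (2 * \<alpha>) \<le> emeasure lborel ?P" .
  have "emeasure lborel ?P \<le> emeasure lborel ({0..\<alpha>} \<union> {2 * pi - \<alpha>..<2 * pi})"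
  proof (rule emeasure_mono)
    show "?P \<subseteq> {0..\<alpha>} \<union> {2 * pi - \<alpha>..<2 * pi}"
    proof
      fix t assume t: "t \<in> ?P"
      then have "c \<le> cos t" using rel by auto
      then show "t \<in> {0..\<alpha>} \<union> {2 * pi - \<alpha>..<2 * pi}"
        using t le[of t] le[of "2 * pi - t", folded refl]
        by (cases "t \<le> pi") fastforce+
    qed
  qed simp
  also have "\<dots> \<le> emeasure lborel {0..\<alpha>} + emeasure lborel {2 * pi - \<alpha>..<2 * pi}"
    by (rule emeasure_subadditive) auto
  also have "\<dots> = ennreal (2 * \<alpha>)"
    using \<alpha> by (simp flip: ennreal_plus)
  finally show ?thesis using 1 unfolding \<alpha>_def by (rule antisym)
qed

lemma emeasure_arc:
  fixes c A B R :: real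
  assumes c: "0 \<le> c" and rel: "rel = (<) \<or> rel = (\<le>)" and R: "0 < R" "A\<^sup>2 + B\<^sup>2 = R\<^sup>2"
  shows "emeasure lborel {t\<in>{0..<2*pi}. rel (c * R) (A * cos t + B * sin t)} = ennreal (2 * arccos (min 1 c))"
proof -
  have "(A / R)\<^sup>2 + (B / R)\<^sup>2 = 1"
    unfolding power_divide add_divide_distrib[symmetric] R(2) using R(1) by simp
  then obtain b where b: "0 \<le> b" "b < 2 * pi" "A / R = cos b" "B / R = sin b"
    using sincos_total_2pi by blast
  then have AB: "A = R * cos b" "B = R * sin b" using R(1) by (auto simp: field_simps)
  let ?P = "{t. rel c (cos t)}"
  have P: "?P \<in> sets borel"
    using rel by (elim disjE) simp_all
  \<comment> \<open>The phase shift by \<open>- b\<close> is replaced by \<open>2 * pi - b\<close>,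
    which lies between 0 and the period as \<open>emeasure_periodic_shift\<close> demands.\<close>
  have "A * cos t + B * sin t = R * cos ((2 * pi - b) + t)" for t
  proof -
    have "(2 * pi - b) + t = (t - b) + 2 * pi" by simp
    then have "cos ((2 * pi - b) + t) = cos (t - b)" by (simp only: cos_periodic)
    then show ?thesis by (simp add: AB cos_diff algebra_simps)
  qed
  then have "rel (c * R) (A * cos t + B * sin t) \<longleftrightarrow> (2 * pi - b) + t \<in> ?P" for t
    using rel R(1) by (elim disjE) (simp_all add: mult.commute[of c])
  then have "emeasure lborel {t\<in>{0..<2*pi}. rel (c * R) (A * cos t + B * sin t)} =
     emeasure lborel {t\<in>{0..<2*pi}. (2 * pi - b) + t \<in> ?P}" by simp
  also have "\<dots> = emeasure lborel {t\<in>{0..<2*pi}. t \<in> ?P}"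
    using b P by (intro emeasure_periodic_shift) (auto simp: cos_add)
  also have "\<dots> = ennreal (2 * arccos (min 1 c))"
    using emeasure_cos_superlevel[OF c rel] by simp
  finally show ?thesis .
qed

lemma complement_fraction:
  fixes F :: "'i \<Rightarrow> real set"
  assumes "finite I" and F: "\<And>i. i \<in> I \<Longrightarrow> F i \<in> sets borel" "\<And>i. i \<in> I \<Longrightarrow> F i \<subseteq> {0..<2*pi}"
    "\<And>i. i \<in> I \<Longrightarrow> emeasure lborel (F i) = ennreal (2 * \<alpha>)" and \<alpha>: "0 \<le> \<alpha>"
    and disj: "disjoint_family_on F I"
  shows "emeasure lborel ({0..<2*pi} - (\<Union>i\<in>I. F i)) / ennreal (2 * pi) = ennreal (1 - real (card I) * \<alpha> / pi)"
proof -
  have U: "emeasure lborel (\<Union>i\<in>I. F i) = ennreal (real (card I) * (2 * \<alpha>))"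
  proof -
    have "emeasure lborel (\<Union>i\<in>I. F i) = (\<Sum>i\<in>I. emeasure lborel (F i))"
      using assms by (intro sum_emeasure[symmetric]) auto
    also have "\<dots> = ennreal (real (card I) * (2 * \<alpha>))"
      using F(3) \<alpha> by (simp add: ennreal_of_nat_eq_real_of_nat ennreal_mult)
    finally show ?thesis .
  qed
  have "emeasure lborel ({0..<2*pi} - (\<Union>i\<in>I. F i)) = ennreal (2 * pi) - ennreal (real (card I) * (2 * \<alpha>))"
    using assms U by (subst emeasure_Diff) (auto simp: UN_subset_iff)
  also have "\<dots> = ennreal (2 * pi - real (card I) * (2 * \<alpha>))"
    using \<alpha> by (intro ennreal_minus) simp
  finally show ?thesis
  proof (simp only:)
    have "ennreal (2 * pi - real (card I) * (2 * \<alpha>)) / ennreal (2 * pi) =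
        ennreal ((2 * pi - real (card I) * (2 * \<alpha>)) / (2 * pi))"
    \<comment> \<open>Since \<open>ennreal\<close> sends negative numbers to 0, the formula also
      holds in the negative case, and no upper bound on \<alpha> has to be established.\<close>
    proof (cases "0 \<le> 2 * pi - real (card I) * (2 * \<alpha>)")
      case True
      then show ?thesis by (rule divide_ennreal) simp
    next
      case False
      then have neg: "2 * pi - real (card I) * (2 * \<alpha>) \<le> 0" by simp
      then have "(2 * pi - real (card I) * (2 * \<alpha>)) / (2 * pi) \<le> 0"
        by (rule divide_nonpos_pos) simp
      with neg show ?thesis by (simp only: ennreal_neg ennreal_zero_divide)
    qed
    also have "(2 * pi - real (card I) * (2 * \<alpha>)) / (2 * pi) = 1 - real (card I) * \<alpha> / pi"
      by (simp add: diff_divide_distrib)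
    finally show "ennreal (2 * pi - real (card I) * (2 * \<alpha>)) / ennreal (2 * pi) = ennreal (1 - real (card I) * \<alpha> / pi)" .
  qed
qed

text \<open>
  The shares of the parallel circle at height \<open>z\<close> that lie in the cone around a coordinate axis and
  around a diagonal. The minimum with \<open>1\<close> covers the circles that lie entirely in the cone
  (\<open>arccos\<close> is unspecified above \<open>1\<close>).
\<close>

definition axis_fraction :: "real \<Rightarrow> real" where
  "axis_fraction z = (if z\<^sup>2 < 1 / 2 then 0
     else 1 - 4 * arccos (min 1 (z / (sqrt 2 * sqrt (1 - z\<^sup>2)))) / pi)"

definition vertex_fraction :: "real \<Rightarrow> real" where
  "vertex_fraction t = (if t\<^sup>2 < 2 / 3 then 0
     else 1 - 3 * arccos (min 1 (t / (2 * sqrt 2 * sqrt (1 - t\<^sup>2)))) / pi)"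

definition axis_region :: "real set \<Rightarrow> (real^3) set" where
  "axis_region V = {x. x$1 \<in> V \<and> \<bar>x$2\<bar> + \<bar>x$3\<bar> < x$1}"

text \<open>No coordinate exceeds the sum of the other two; adding two of these inequalities shows
  that all coordinates are nonnegative. The cone contains its faces and the axis cones do not, so
  common boundaries are counted once.\<close>

definition vertex_region :: "real set \<Rightarrow> (real^3) set" where
  "vertex_region V = {x. (x$1 + x$2 + x$3) / sqrt 3 \<in> V \<and> 0 < x$1 + x$2 + x$3 \<and>
     (\<forall>i. 2 * x$i \<le> x$1 + x$2 + x$3)}"

lemma parallel_fraction_axis_region:
  assumes z: "0 < z" "z < 1" "z\<^sup>2 \<noteq> 1 / 2"
  shows "parallel_fraction (axis_region V) z = ennreal (axis_fraction z) * indicator V z"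
proof (cases "z \<in> V")
  case False
  then show ?thesis by (simp add: parallel_fraction_def axis_region_def)
next
  case True
  define r where "r = sqrt (1 - z\<^sup>2)"
  have "z\<^sup>2 < 1" using z by (simp add: power_less_one_iff)
  then have r: "0 < r" "r\<^sup>2 = 1 - z\<^sup>2" by (simp_all add: r_def)
  have circle: "(r * cos t)\<^sup>2 + (r * sin t)\<^sup>2 = r\<^sup>2" for t
    by (simp add: power_mult_distrib flip: distrib_left)
  let ?E = "{t\<in>{0..<2*pi}. \<bar>r * cos t\<bar> + \<bar>r * sin t\<bar> < z}"
  have pf: "parallel_fraction (axis_region V) z = emeasure lborel ?E / ennreal (2 * pi)"
    using True by (simp add: parallel_fraction_def axis_region_def r_def)
  show ?thesis
  proof (cases "z\<^sup>2 < 1 / 2")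
    case small: True
    have "\<not> \<bar>r * cos t\<bar> + \<bar>r * sin t\<bar> < z" for t
    proof
      assume "\<bar>r * cos t\<bar> + \<bar>r * sin t\<bar> < z"
      then have "(\<bar>r * cos t\<bar> + \<bar>r * sin t\<bar>)\<^sup>2 < z\<^sup>2"
        by (intro power_strict_mono) auto
      moreover have "(\<bar>r * cos t\<bar> + \<bar>r * sin t\<bar>)\<^sup>2 = r\<^sup>2 + 2 * (\<bar>r * cos t\<bar> * \<bar>r * sin t\<bar>)"
        by (simp add: power2_sum flip: circle[of t])
      moreover have "0 \<le> \<bar>r * cos t\<bar> * \<bar>r * sin t\<bar>" by simp
      ultimately show False using small r by linarith
    qed
    then have "?E = {}" by blast
    then show ?thesis using small by (simp only: pf axis_fraction_def) simp
  next
    case False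
    then have "1 / 2 < z\<^sup>2" using z by simp
    then have "r\<^sup>2 < z\<^sup>2" using r by simp
    then have rz: "r < z" using z by (simp add: power2_less_imp_less)
    \<comment> \<open>The sinusoid with signs \<open>s\<close> and \<open>u\<close> has amplitude
      \<open>sqrt 2 * r\<close>; \<open>?c\<close> is the threshold \<open>z\<close> in units of
      this amplitude.\<close>
    let ?c = "z / (sqrt 2 * r)" and ?I = "{1, -1 :: real} \<times> {1, -1 :: real}"
    define F where "F = (\<lambda>(s, u). {t\<in>{0..<2*pi}. ?c * (sqrt 2 * r) \<le> s * r * cos t + u * r * sin t})"
    have c: "?c * (sqrt 2 * r) = z" using r by simp
    have E: "?E = {0..<2*pi} - (\<Union>i\<in>?I. F i)"
    proof -
      have abs_sum: "\<bar>a\<bar> + \<bar>b\<bar> < z \<longleftrightarrow> \<not> (z \<le> a + b \<or> z \<le> a - b \<or> z \<le> b - a \<or> z \<le> - b - a)" for a b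
        by linarith
      have "(\<Union>i\<in>?I. F i) = {t\<in>{0..<2*pi}. z \<le> r * cos t + r * sin t \<or> z \<le> r * cos t - r * sin t \<or>
          z \<le> r * sin t - r * cos t \<or> z \<le> - (r * sin t) - r * cos t}"
        using r(1) by (simp add: F_def c) blast
      then show ?thesis unfolding abs_sum by blast
    qed
    have "emeasure lborel ({0..<2*pi} - (\<Union>i\<in>?I. F i)) / ennreal (2 * pi) =
        ennreal (1 - real (card ?I) * arccos (min 1 ?c) / pi)"
    proof (rule complement_fraction)
      show "F i \<in> sets borel" "F i \<subseteq> {0..<2*pi}" for i
        unfolding F_def by (cases i; simp; fail | cases i; auto)+
      show "emeasure lborel (F i) = ennreal (2 * arccos (min 1 ?c))" if "i \<in> ?I" for i
      proof -
        obtain s u where i: "i = (s, u)" "s\<^sup>2 = 1" "u\<^sup>2 = 1" using \<open>i \<in> ?I\<close> by auto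
        show ?thesis unfolding F_def i prod.case
          by (rule emeasure_arc) (use r z i in \<open>auto simp: power_mult_distrib\<close>)
      qed
      have "0 \<le> ?c" using z r by simp
      then show "0 \<le> arccos (min 1 ?c)" by (intro arccos_lbound) auto
      \<comment> \<open>If the sign pairs differ, adding the two inequalities cancels at least one
        trigonometric term and leaves at most \<open>2 * r\<close> on the right, against
        \<open>r < z\<close>.\<close>
      have *: "z \<le> s * r * cos t + u * r * sin t \<Longrightarrow> z \<le> s' * r * cos t + u' * r * sin t \<Longrightarrow>
         s = s' \<and> u = u'" if "s \<in> {1, -1}" "s' \<in> {1, -1}" "u \<in> {1, -1}" "u' \<in> {1, -1}" for s u s' u' t
      proof -
        have "\<bar>r * cos t\<bar> \<le> r * 1" "\<bar>r * sin t\<bar> \<le> r * 1"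
          using r by (auto simp: abs_mult intro!: mult_left_mono)
        then show "z \<le> s * r * cos t + u * r * sin t \<Longrightarrow> z \<le> s' * r * cos t + u' * r * sin t \<Longrightarrow>
         s = s' \<and> u = u'"
          using that rz z by (auto simp: abs_le_iff)
      qed
      show "disjoint_family_on F ?I"
      proof (unfold disjoint_family_on_def, intro ballI impI)
        fix i j assume ij: "i \<in> ?I" "j \<in> ?I" "i \<noteq> j"
        obtain s u s' u' where [simp]: "i = (s, u)" "j = (s', u')" by (cases i, cases j)
        have "s = s' \<and> u = u'" if "t \<in> F i" "t \<in> F j" for t
          by (rule *[of s s' u u' t]) (use ij that in \<open>auto simp only: F_def c prod.case mem_Sigma_iff \<open>i = _\<close> \<open>j = _\<close> mem_Collect_eq\<close>)
        then show "F i \<inter> F j = {}" using ij by auto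
      qed
    qed simp_all
    then show ?thesis
      using True False by (simp only: pf E axis_fraction_def) (simp add: r_def)
  qed
qed

text \<open>Coordinates with respect to an orthonormal frame whose first vector is \<open>(1, 1, 1) / sqrt 3\<close>.\<close>

definition from_vertex_frame :: "real^3 \<Rightarrow> real^3" where
  "from_vertex_frame w = (let p = 1 / sqrt 3; h = 1 / sqrt 2 in
     vector [p * w$1 + 2 * p * h * w$2, p * w$1 - p * h * w$2 + h * w$3, p * w$1 - p * h * w$2 - h * w$3])"

text \<open>Along the circle the three coordinates are p z plus sinusoids shifted by a third of a
  turn, and the cone is left where one of them exceeds 3/2 p z. Two at once would have squares
  summing to more than 3/2 z^2, which is impossible on the sphere once z^2 is at least 2/3.
  Conversely, inside the cone the squares sum to at most 3/2 p z times the coordinate sum, that is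
  to 3/2 z^2, so below 2/3 the circle misses the cone.\<close>

lemma parallel_fraction_vertex_region:
  assumes z: "0 < z" "z < 1" 
  shows "parallel_fraction {w. from_vertex_frame w \<in> vertex_region V} z = ennreal (vertex_fraction z) * indicator V z"
proof -
  define r where "r = sqrt (1 - z\<^sup>2)"
  define p :: real where "p = 1 / sqrt 3"
  define h :: real where "h = 1 / sqrt 2"
  have "z\<^sup>2 < 1" using z by (simp add: power_less_one_iff)
  then have r: "0 < r" "r\<^sup>2 = 1 - z\<^sup>2" by (simp_all add: r_def)
  have p: "0 < p" "p\<^sup>2 = 1 / 3" "sqrt 3 = 3 * p" by (simp_all add: p_def power_divide real_div_sqrt)
  have h: "0 < h" "h\<^sup>2 = 1 / 2" "sqrt 2 = 2 * h" by (simp_all add: h_def power_divide real_div_sqrt)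
  define A where "A i = (if i = 1 then 2 * p * h * r else - p * h * r)" for i :: 3
  define B where "B i = (if i = 1 then 0 else if i = 2 then h * r else - h * r)" for i :: 3
  define X where "X t i = p * z + (A i * cos t + B i * sin t)" for i t
  have AB: "(A i)\<^sup>2 + (B i)\<^sup>2 = (2 * p * h * r)\<^sup>2" for i
    using exhaust_3[of i] by (auto simp: A_def B_def power_mult_distrib p h)
  have frame: "from_vertex_frame (vector [z, r * cos t, r * sin t]) = (\<chi> i. X t i)" for t
    by (simp add: from_vertex_frame_def vector_3_eq_iff X_def A_def B_def algebra_simps flip: p_def h_def)
  have sum: "X t 1 + X t 2 + X t 3 = 3 * p * z" for t
    by (simp add: X_def A_def B_def)
  have norm: "(X t 1)\<^sup>2 + (X t 2)\<^sup>2 + (X t 3)\<^sup>2 = 1" for t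
  proof -
    have "(X t 1)\<^sup>2 + (X t 2)\<^sup>2 + (X t 3)\<^sup>2 =
       3 * p\<^sup>2 * z\<^sup>2 + 6 * p\<^sup>2 * h\<^sup>2 * r\<^sup>2 * (cos t)\<^sup>2 + 2 * h\<^sup>2 * r\<^sup>2 * (sin t)\<^sup>2"
      by (simp add: X_def A_def B_def power2_eq_square algebra_simps)
    also have "\<dots> = z\<^sup>2 + r\<^sup>2 * ((cos t)\<^sup>2 + (sin t)\<^sup>2)"
      by (simp add: p h sin_squared_eq algebra_simps)
    finally show ?thesis using r by simp
  qed
  have mem: "from_vertex_frame (vector [z, r * cos t, r * sin t]) \<in> vertex_region V \<longleftrightarrow>
      z \<in> V \<and> (\<forall>i. 2 * X t i \<le> 3 * p * z)" for t
    using z p by (simp add: vertex_region_def frame sum p(3))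
  show ?thesis
  proof (cases "z \<in> V")
    case False
    then show ?thesis by (simp add: parallel_fraction_def mem flip: r_def)
  next
    case True
    let ?E = "{t\<in>{0..<2*pi}. \<forall>i. 2 * X t i \<le> 3 * p * z}"
    have pf: "parallel_fraction {w. from_vertex_frame w \<in> vertex_region V} z = emeasure lborel ?E / ennreal (2 * pi)"
      using True by (simp add: parallel_fraction_def mem flip: r_def)
    show ?thesis
    proof (cases "z\<^sup>2 < 2 / 3")
      case small: True
      have "\<not> (\<forall>i. 2 * X t i \<le> 3 * p * z)" for t
      proof
        assume le: "\<forall>i. 2 * X t i \<le> 3 * p * z"
        have "0 \<le> X t i" for i
          using exhaust_3[of i] sum[of t] le[rule_format, of 1] le[rule_format, of 2] le[rule_format, of 3] by auto
        then have "(X t i)\<^sup>2 \<le> 3 / 2 * p * z * X t i" for i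
          using mult_right_mono[of "X t i" "3 / 2 * p * z" "X t i"] le[rule_format, of i]
          by (simp add: power2_eq_square)
        then have "(X t 1)\<^sup>2 + (X t 2)\<^sup>2 + (X t 3)\<^sup>2 \<le>
            3 / 2 * p * z * X t 1 + 3 / 2 * p * z * X t 2 + 3 / 2 * p * z * X t 3"
          by (intro add_mono)
        then have "1 \<le> 3 / 2 * p * z * (X t 1 + X t 2 + X t 3)"
          unfolding norm distrib_left .
        also have "\<dots> = 9 / 2 * p\<^sup>2 * z\<^sup>2" unfolding sum by (simp add: power2_eq_square)
        finally show False using small p by simp
      qed
      then have "?E = {}" by blast
      then show ?thesis using small by (simp only: pf vertex_fraction_def) simp
    next
      case False
      \<comment> \<open>A coordinate exceeds 3/2 p z iff its sinusoid exceeds p z / 2, and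
        \<open>?c\<close> is this threshold divided by the amplitude
        \<open>2 * p * h * r\<close>.\<close>
      let ?c = "z / (2 * sqrt 2 * r)"
      define F where "F i = {t\<in>{0..<2*pi}. ?c * (2 * p * h * r) < A i * cos t + B i * sin t}" for i
      have c: "?c * (2 * p * h * r) = p * z / 2" using r h by (simp add: h(3))
      have E: "?E = {0..<2*pi} - (\<Union>i. F i)"
        unfolding F_def c X_def by (auto simp: not_less field_simps) (meson not_le)
      have "emeasure lborel ({0..<2*pi} - (\<Union>i. F i)) / ennreal (2 * pi) =
          ennreal (1 - real (card (UNIV :: 3 set)) * arccos (min 1 ?c) / pi)"
      proof (rule complement_fraction)
        show "F i \<in> sets borel" "F i \<subseteq> {0..<2*pi}" for i
          unfolding F_def by (simp, auto)
        show "emeasure lborel (F i) = ennreal (2 * arccos (min 1 ?c))" for i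
          unfolding F_def by (rule emeasure_arc) (use r z p h AB in auto)
        have "0 \<le> ?c" using z r by simp
      then show "0 \<le> arccos (min 1 ?c)" by (intro arccos_lbound) auto
        show "disjoint_family F"
        proof (unfold disjoint_family_on_def, intro ballI impI)
          fix i j :: 3 assume "i \<noteq> j"
          have sq: "3 / 4 * z\<^sup>2 < (X t i)\<^sup>2" if "t \<in> F i" for t i
          proof -
            have "3 / 2 * p * z < X t i"
              using that unfolding F_def c X_def by simp
            then have "(3 / 2 * p * z)\<^sup>2 < (X t i)\<^sup>2"
              using p z by (intro power_strict_mono) auto
            then show ?thesis by (simp add: power_mult_distrib p power_divide)
          qed
          have two: "(X t i)\<^sup>2 + (X t j)\<^sup>2 \<le> 1" for t
          proof -
            have "(X t i)\<^sup>2 + (X t j)\<^sup>2 = (\<Sum>k\<in>{i, j}. (X t k)\<^sup>2)"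
              using \<open>i \<noteq> j\<close> by simp
            also have "\<dots> \<le> (\<Sum>k\<in>UNIV. (X t k)\<^sup>2)"
              by (rule sum_mono2) auto
            finally show ?thesis by (simp add: sum_3 norm)
          qed
          have False if "t \<in> F i" "t \<in> F j" for t
            using sq[OF that(1)] sq[OF that(2)] two[of t] \<open>\<not> z\<^sup>2 < 2 / 3\<close> by linarith
          then show "F i \<inter> F j = {}" by blast
        qed
      qed simp_all
      then show ?thesis
        using True False by (simp only: pf E vertex_fraction_def) (simp add: r_def)
    qed
  qed
qed

section \<open>Decomposition into cones\<close>

definition radial_width :: "real^3 \<Rightarrow> real" where
  "radial_width x = max (4 * max \<bar>x$1\<bar> (max \<bar>x$2\<bar> \<bar>x$3\<bar>)) (2 * (\<bar>x$1\<bar> + \<bar>x$2\<bar> + \<bar>x$3\<bar>)) / sqrt 3"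

lemma measurable_radial_width [measurable]: "radial_width \<in> borel_measurable borel"
  unfolding radial_width_def by measurable

lemma rotation_cycle: "rotation_matrix (rows3 (vector [0, 1, 0]) (vector [0, 0, 1]) (vector [1, 0, 0]))"
  by (rule rotation_rows3) (simp_all add: det_rows3 inner_vec3)

lemma rotation_flip12: "rotation_matrix (rows3 (vector [-1, 0, 0]) (vector [0, -1, 0]) (vector [0, 0, 1]))"
  by (rule rotation_rows3) (simp_all add: det_rows3 inner_vec3)

lemma rotation_flip23: "rotation_matrix (rows3 (vector [1, 0, 0]) (vector [0, -1, 0]) (vector [0, 0, -1]))"
  by (rule rotation_rows3) (simp_all add: det_rows3 inner_vec3)

text \<open>Diagonal rotations change an even number of signs and so preserve the sign of the
  product of the coordinates. To exchange the two classes of octants, a swap is combined with the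
  negation of all coordinates.\<close>

lemma rotation_swap_neg: "rotation_matrix (rows3 (vector [0, -1, 0]) (vector [-1, 0, 0]) (vector [0, 0, -1]))"
  by (rule rotation_rows3) (simp_all add: det_rows3 inner_vec3)

lemma from_vertex_frame_rotation:
  obtains A where "rotation_matrix A" "\<And>w. from_vertex_frame w = A *v w"
proof
  define p :: real where "p = 1 / sqrt 3"
  define h :: real where "h = 1 / sqrt 2"
  have p: "p * p = 1 / 3" by (simp add: p_def)
  have h: "h * h = 1 / 2" by (simp add: h_def)
  let ?A = "rows3 (vector [p, 2 * p * h, 0]) (vector [p, - (p * h), h]) (vector [p, - (p * h), - h])"
  have ph: "p * h * (p * h) = 1 / 6" "2 * p * h * (2 * p * h) = 2 / 3"
  proof -
    have "p * h * (p * h) = (p * p) * (h * h)" "2 * p * h * (2 * p * h) = 4 * ((p * p) * (h * h))"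
      by (simp_all add: algebra_simps)
    then show "p * h * (p * h) = 1 / 6" "2 * p * h * (2 * p * h) = 2 / 3" by (simp_all add: p h)
  qed
  show "rotation_matrix ?A"
  proof (rule rotation_rows3)
    have "det ?A = 6 * (p * p) * (h * h)"
      by (simp add: det_rows3 algebra_simps)
    then show "det ?A = 1" by (simp add: p h)
  qed (use p h ph in \<open>simp_all add: inner_vec3 algebra_simps\<close>)
  show "from_vertex_frame w = ?A *v w" for w
    by (simp add: rows3_mult from_vertex_frame_def inner_vec3 Let_def flip: p_def h_def)
qed

context rotation_invariant
begin

lemma emeasure_axis_region:
  assumes [measurable]: "V \<in> sets borel"
  shows "emeasure N (axis_region V) =
    (\<integral>\<^sup>+z. ennreal (1 / 2) * (ennreal (axis_fraction z) * indicator V z) * indicator {0<..<1} z \<partial>lborel)"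
proof -
  have "emeasure N (axis_region V) = (\<integral>\<^sup>+z. ennreal (1 / 2) *
      parallel_fraction (axis_region V) z * indicator {0<..<1} z \<partial>lborel)"
  proof (rule emeasure_eq_parallel_fraction)
    show "axis_region V \<in> sets borel" unfolding axis_region_def by measurable
    show "0 < x$1" if "x \<in> axis_region V" for x
      using that abs_ge_zero[of "x$2"] abs_ge_zero[of "x$3"] unfolding axis_region_def by auto
  qed
  also have "\<dots> = (\<integral>\<^sup>+z. ennreal (1 / 2) * (ennreal (axis_fraction z) * indicator V z) * indicator {0<..<1} z \<partial>lborel)"
  proof (rule nn_integral_cong_AE)
    \<comment> \<open>The height at which the arcs touch is discarded as a null set.\<close>
    have "AE z in lborel. z \<noteq> sqrt (1 / 2)" by (rule AE_lborel_singleton)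
    then show "AE z in lborel. ennreal (1 / 2) * parallel_fraction (axis_region V) z * indicator {0<..<1} z =
        ennreal (1 / 2) * (ennreal (axis_fraction z) * indicator V z) * indicator {0<..<1} z"
    proof eventually_elim
      case (elim z)
      then have "z\<^sup>2 \<noteq> 1 / 2" if "0 < z" using that real_sqrt_unique[of z "1 / 2"] by auto
      then show ?case
        using parallel_fraction_axis_region[of z V] by (simp add: indicator_def)
    qed
  qed
  finally show ?thesis .
qed

lemma sets_vertex_region [measurable]:
  assumes [measurable]: "V \<in> sets borel"
  shows "vertex_region V \<in> sets borel"
  unfolding vertex_region_def forall_3 by measurable

text \<open>Slicing by parallel circles is set up for the first axis only, so the diagonal is first
  rotated into it.\<close>

lemma emeasure_vertex_region:
  assumes [measurable]: "V \<in> sets borel"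
  shows "emeasure N (vertex_region V) =
    (\<integral>\<^sup>+z. ennreal (1 / 2) * (ennreal (vertex_fraction z) * indicator V z) * indicator {0<..<1} z \<partial>lborel)"
proof -
  obtain A where A: "rotation_matrix A" "\<And>w. from_vertex_frame w = A *v w"
    using from_vertex_frame_rotation by metis
  have "emeasure N (vertex_region V) = emeasure N {w. from_vertex_frame w \<in> vertex_region V}"
    unfolding A(2) by (rule emeasure_rotation[OF A(1), symmetric]) measurable
  also have "\<dots> = (\<integral>\<^sup>+z. ennreal (1 / 2) *
      parallel_fraction {w. from_vertex_frame w \<in> vertex_region V} z * indicator {0<..<1} z \<partial>lborel)"
  proof (rule emeasure_eq_parallel_fraction)
    show "{w. from_vertex_frame w \<in> vertex_region V} \<in> sets borel" unfolding A(2) by measurable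
    show "0 < x$1" if "x \<in> {w. from_vertex_frame w \<in> vertex_region V}" for x
      using that by (simp add: vertex_region_def from_vertex_frame_def Let_def zero_less_divide_iff)
  qed
  also have "\<dots> = (\<integral>\<^sup>+z. ennreal (1 / 2) * (ennreal (vertex_fraction z) * indicator V z) * indicator {0<..<1} z \<partial>lborel)"
    by (rule nn_integral_cong) (simp add: parallel_fraction_vertex_region indicator_def)
  finally show ?thesis .
qed

text \<open>The symmetry \<open>A\<close> exchanges the two halves of \<open>S\<close> that are separated by the sign of \<open>f\<close>.\<close>

lemma emeasure_halve:
  fixes f :: "real^3 \<Rightarrow> real"
  assumes A: "rotation_matrix A" and S [measurable]: "S \<in> sets borel" and inv: "\<And>x. A *v x \<in> S \<longleftrightarrow> x \<in> S"
    and f [measurable]: "f \<in> borel_measurable borel" and neg: "\<And>x. f (A *v x) = - f x"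
    and null: "emeasure N {x. f x = 0} = 0"
  shows "emeasure N S = 2 * emeasure N (S \<inter> {x. 0 < f x})"
proof -
  have [measurable]: "S \<in> events" using S by (simp add: sets_N)
  have "emeasure N S = emeasure N (S - {x. f x = 0})"
    by (rule emeasure_Diff_null_set[symmetric]) (auto simp: null_sets_def null)
  also have "S - {x. f x = 0} = (S \<inter> {x. 0 < f x}) \<union> (S \<inter> {x. f x < 0})" by auto
  also have "emeasure N \<dots> = emeasure N (S \<inter> {x. 0 < f x}) + emeasure N (S \<inter> {x. f x < 0})"
    by (rule plus_emeasure[symmetric]) auto
  also have "emeasure N (S \<inter> {x. f x < 0}) = emeasure N {x. A *v x \<in> S \<inter> {x. 0 < f x}}"
    by (rule arg_cong[of _ _ "emeasure N"]) (auto simp: inv neg)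
  also have "\<dots> = emeasure N (S \<inter> {x. 0 < f x})"
    by (rule emeasure_rotation[OF A]) simp
  finally show ?thesis by (simp add: mult_2)
qed

lemma emeasure_coord_zero: "emeasure N {x. x$i = 0} = 0"
proof -
  note cycle = emeasure_rotation[OF rotation_cycle, unfolded rows3_mult]
  have "emeasure N {x. x$2 = 0} = emeasure N {x. x$1 = 0}"
    using cycle[of "{x. x$1 = 0}"] by (simp add: inner_vec3)
  moreover have "emeasure N {x. x$3 = 0} = emeasure N {x. x$2 = 0}"
    using cycle[of "{x. x$2 = 0}"] by (simp add: inner_vec3)
  ultimately show ?thesis
    using exhaust_3[of i] emeasure_first_coord_zero by auto
qed

lemma emeasure_coord_product_zero: "emeasure N {x. x$1 * x$2 * x$3 = 0} = 0"
proof -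
  have null: "{x. x$i = 0} \<in> null_sets N" for i
    by (simp add: null_sets_def emeasure_coord_zero)
  have "{x :: real^3. x$1 * x$2 * x$3 = 0} = {x. x$1 = 0} \<union> {x. x$2 = 0} \<union> {x. x$3 = 0}" by auto
  also have "\<dots> \<in> null_sets N" by (intro null_sets.Un null)
  finally show ?thesis by (simp add: null_sets_def)
qed

lemma emeasure_axis_cones:
  assumes [measurable]: "S \<in> sets borel"
  shows "emeasure N {x. radial_width x \<in> S \<and> \<bar>x$2\<bar> + \<bar>x$3\<bar> < \<bar>x$1\<bar>} =
    2 * emeasure N (axis_region {z. 4 / sqrt 3 * z \<in> S})"
proof -
  let ?T = "{x. radial_width x \<in> S \<and> \<bar>x$2\<bar> + \<bar>x$3\<bar> < \<bar>x$1\<bar>}"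
  have "emeasure N ?T = 2 * emeasure N (?T \<inter> {x. 0 < x$1})"
    by (rule emeasure_halve[OF rotation_flip12])
      (simp_all add: rows3_mult inner_vec3 radial_width_def emeasure_coord_zero)
  also have "?T \<inter> {x. 0 < x$1} = axis_region {z. 4 / sqrt 3 * z \<in> S}"
  proof -
    have "radial_width x = 4 / sqrt 3 * x$1" if "\<bar>x$2\<bar> + \<bar>x$3\<bar> < x$1" for x
    proof -
      have "\<bar>x$2\<bar> \<le> x$1" "\<bar>x$3\<bar> \<le> x$1" "\<bar>x$1\<bar> = x$1" "2 * (x$1 + \<bar>x$2\<bar> + \<bar>x$3\<bar>) \<le> 4 * x$1"
        using that by (smt (verit))+
      then show ?thesis by (simp add: radial_width_def max_absorb1)
    qed
    moreover have "0 < x$1" if "\<bar>x$2\<bar> + \<bar>x$3\<bar> < x$1" for x :: "real^3"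
      using that by linarith
    ultimately show ?thesis by (auto simp: axis_region_def)
  qed
  finally show ?thesis .
qed

text \<open>Three halvings, by the signs of the product of the coordinates, of \<open>x$1\<close>
  and of \<open>x$2\<close>, lead from eight octants to the positive one. The order matters: each
  rotation must preserve the conditions imposed before it. What remains differs from the vertex cone
  by points on the coordinate planes, which have no mass.\<close>

lemma emeasure_vertex_cones:
  assumes [measurable]: "S \<in> sets borel"
  shows "emeasure N {x. radial_width x \<in> S \<and> (\<forall>i. 2 * \<bar>x$i\<bar> \<le> \<bar>x$1\<bar> + \<bar>x$2\<bar> + \<bar>x$3\<bar>)} =
    8 * emeasure N (vertex_region {t. 2 * t \<in> S})"
proof -
  let ?T = "{x. radial_width x \<in> S \<and> (\<forall>i. 2 * \<bar>x$i\<bar> \<le> \<bar>x$1\<bar> + \<bar>x$2\<bar> + \<bar>x$3\<bar>)}"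
  let ?P = "{x :: real^3. 0 < x$1 * x$2 * x$3}"
  have T [measurable]: "?T \<in> sets borel" unfolding forall_3 by measurable
  note act = rows3_mult inner_vec3 forall_3 radial_width_def
  have "emeasure N ?T = 2 * emeasure N (?T \<inter> ?P)"
    by (rule emeasure_halve[OF rotation_swap_neg T])
      (use emeasure_coord_product_zero in \<open>auto simp: act ac_simps max.left_commute\<close>)
  also have "emeasure N (?T \<inter> ?P) = 2 * emeasure N (?T \<inter> ?P \<inter> {x. 0 < x$1})"
    by (rule emeasure_halve[OF rotation_flip12]) (auto simp: act emeasure_coord_zero)
  also have "emeasure N (?T \<inter> ?P \<inter> {x. 0 < x$1}) = 2 * emeasure N (?T \<inter> ?P \<inter> {x. 0 < x$1} \<inter> {x. 0 < x$2})"
    by (rule emeasure_halve[OF rotation_flip23]) (auto simp: act emeasure_coord_zero)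
  also have "?T \<inter> ?P \<inter> {x. 0 < x$1} \<inter> {x. 0 < x$2} =
      vertex_region {t. 2 * t \<in> S} - {x. x$1 * x$2 * x$3 = 0}" (is "?L = ?R")
  proof (intro set_eqI iffI)
    have w: "radial_width x = 2 * ((x$1 + x$2 + x$3) / sqrt 3)"
      if "0 < x$1" "0 < x$2" "0 < x$3" "\<forall>i. 2 * x$i \<le> x$1 + x$2 + x$3" for x
      using that unfolding forall_3 radial_width_def by (simp add: max_def)
    fix x
    {
      assume x: "x \<in> ?L"
      then have 12: "0 < x$1" "0 < x$2" and 123: "0 < (x$1 * x$2) * x$3" by auto
      from 123 have "0 < x$3"
        by (rule zero_less_mult_pos) (use 12 in simp)
      with 12 have pos: "0 < x$1" "0 < x$2" "0 < x$3" by blast+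
      with x have le: "\<forall>i. 2 * x$i \<le> x$1 + x$2 + x$3" by (auto simp: forall_3)
      show "x \<in> ?R" using x pos le w[OF pos le] by (auto simp: vertex_region_def)
    next
      assume x: "x \<in> ?R"
      then have le: "\<forall>i. 2 * x$i \<le> x$1 + x$2 + x$3" by (simp add: vertex_region_def)
      from x have "x$1 \<noteq> 0" "x$2 \<noteq> 0" "x$3 \<noteq> 0" by auto
      with le[rule_format, of 1] le[rule_format, of 2] le[rule_format, of 3]
      have pos: "0 < x$1" "0 < x$2" "0 < x$3" by linarith+
      show "x \<in> ?L" using x pos le w[OF pos le] by (auto simp: vertex_region_def forall_3)
    }
  qed
  also have "emeasure N \<dots> = emeasure N (vertex_region {t. 2 * t \<in> S})"
    by (rule emeasure_Diff_null_set) (use emeasure_coord_product_zero in \<open>auto simp: null_sets_def sets_N\<close>)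
  finally show ?thesis by (simp add: mult.assoc[symmetric])
qed

lemma emeasure_radial_width:
  assumes S [measurable]: "S \<in> sets borel"
  shows "emeasure N {x. radial_width x \<in> S} = 6 * emeasure N (axis_region {z. 4 / sqrt 3 * z \<in> S})
    + 8 * emeasure N (vertex_region {t. 2 * t \<in> S})"
proof -
  let ?A1 = "{x. radial_width x \<in> S \<and> \<bar>x$2\<bar> + \<bar>x$3\<bar> < \<bar>x$1\<bar>}"
  let ?A2 = "{x. radial_width x \<in> S \<and> \<bar>x$3\<bar> + \<bar>x$1\<bar> < \<bar>x$2\<bar>}"
  let ?A3 = "{x. radial_width x \<in> S \<and> \<bar>x$1\<bar> + \<bar>x$2\<bar> < \<bar>x$3\<bar>}"
  let ?B = "{x. radial_width x \<in> S \<and> (\<forall>i. 2 * \<bar>x$i\<bar> \<le> \<bar>x$1\<bar> + \<bar>x$2\<bar> + \<bar>x$3\<bar>)}"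
  have B: "?B \<in> sets borel" unfolding forall_3 by measurable
  have cycle: "radial_width (vector [x$2, x$3, x$1]) = radial_width x" for x
    by (simp add: radial_width_def ac_simps max.left_commute)
  note cyc = emeasure_rotation[OF rotation_cycle, unfolded rows3_mult inner_vec3]
  have A2: "emeasure N ?A2 = emeasure N ?A1"
    using cyc[of ?A1] by (simp add: cycle)
  have A3: "emeasure N ?A3 = emeasure N ?A2"
    using cyc[of ?A2] by (simp add: cycle)
  have E1: "{x. radial_width x \<in> S} = ?A1 \<union> (?A2 \<union> (?A3 \<union> ?B))"
    unfolding forall_3 by auto
  have E2: "emeasure N (?A1 \<union> (?A2 \<union> (?A3 \<union> ?B))) = emeasure N ?A1 + emeasure N (?A2 \<union> (?A3 \<union> ?B))"
    by (rule plus_emeasure[symmetric]) (use B in \<open>auto simp: sets_N forall_3\<close>)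
  have E3: "emeasure N (?A2 \<union> (?A3 \<union> ?B)) = emeasure N ?A2 + emeasure N (?A3 \<union> ?B)"
    by (rule plus_emeasure[symmetric]) (use B in \<open>auto simp: sets_N forall_3\<close>)
  have E4: "emeasure N (?A3 \<union> ?B) = emeasure N ?A3 + emeasure N ?B"
    by (rule plus_emeasure[symmetric]) (use B in \<open>auto simp: sets_N forall_3\<close>)
  have six: "(6 :: ennreal) = 2 + (2 + 2)" by simp
  show ?thesis
    unfolding E1 E2 E3 E4 A3 A2 emeasure_axis_cones[OF S] emeasure_vertex_cones[OF S]
    by (simp only: six distrib_right add.assoc)
qed

end

section \<open>The density\<close>

text \<open>Outside \<open>[-1, 1]\<close> both inverse functions have one unspecified constant value.\<close>

lemma measurable_arccos [measurable]: "arccos \<in> borel_measurable borel"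
proof -
  have out: "arccos y = arccos 2" if "y \<notin> {-1..1}" for y
  proof -
    have "cos x \<noteq> y" "cos x \<noteq> 2" for x
      using that cos_le_one[of x] cos_ge_minus_one[of x] by (auto simp del: cos_le_one cos_ge_minus_one)
    then show ?thesis by (simp add: arccos_def)
  qed
  have "arccos = (\<lambda>y. if y \<in> {-1..1} then arccos y else arccos 2)"
  proof
    show "arccos y = (if y \<in> {-1..1} then arccos y else arccos 2)" for y
      using out[of y] by (cases "y \<in> {-1..1}") (simp_all only: if_True if_False not_True_eq_False simp_thms)
  qed
  also have "\<dots> \<in> borel_measurable borel"
    by (rule borel_measurable_continuous_on_if) (auto intro: continuous_on_arccos')
  finally show ?thesis .
qed

lemma measurable_arcsin [measurable]: "arcsin \<in> borel_measurable borel"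
proof -
  have out: "arcsin y = arcsin 2" if "y \<notin> {-1..1}" for y
  proof -
    have "sin x \<noteq> y" "sin x \<noteq> 2" for x
      using that sin_le_one[of x] sin_ge_minus_one[of x] by (auto simp del: sin_le_one sin_ge_minus_one)
    then show ?thesis by (simp add: arcsin_def)
  qed
  have "arcsin = (\<lambda>y. if y \<in> {-1..1} then arcsin y else arcsin 2)"
  proof
    show "arcsin y = (if y \<in> {-1..1} then arcsin y else arcsin 2)" for y
      using out[of y] by (cases "y \<in> {-1..1}") (simp_all only: if_True if_False not_True_eq_False simp_thms)
  qed
  also have "\<dots> \<in> borel_measurable borel"
    by (rule borel_measurable_continuous_on_if) (auto intro: continuous_on_arcsin')
  finally show ?thesis .
qed

lemma measurable_axis_fraction [measurable]: "axis_fraction \<in> borel_measurable borel"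
  unfolding axis_fraction_def by measurable

lemma measurable_vertex_fraction [measurable]: "vertex_fraction \<in> borel_measurable borel"
  unfolding vertex_fraction_def by measurable

lemma measurable_f_R [measurable]: "f_R \<in> borel_measurable borel"
  unfolding f_R_def eta_R_def delta_R_def by measurable

lemma arccos_less: "cos a < c \<Longrightarrow> c \<le> 1 \<Longrightarrow> 0 \<le> a \<Longrightarrow> a \<le> pi \<Longrightarrow> arccos c < a"
  using arccos_less_arccos[of "cos a" c] by (simp add: arccos_cos)

lemma arccos_le: "cos a \<le> c \<Longrightarrow> c \<le> 1 \<Longrightarrow> 0 \<le> a \<Longrightarrow> a \<le> pi \<Longrightarrow> arccos c \<le> a"
  using arccos_le_arccos[of "cos a" c] by (simp add: arccos_cos)

lemma cos_pi_4: "cos (pi / 4) = 1 / sqrt 2"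
  by (simp add: cos_45 field_simps)

text \<open>Strict positivity is needed for the support: it makes \<open>f_R\<close> positive
  between \<open>kappa0\<close> and \<open>kappa3\<close>.\<close>

lemma axis_fraction_pos:
  assumes "0 < z" "z < 1" "1 / 2 < z\<^sup>2"
  shows "0 < axis_fraction z"
proof -
  have sq: "0 < 1 - z\<^sup>2" "1 - z\<^sup>2 < z\<^sup>2" using assms by (simp_all add: power_less_one_iff)
  have "sqrt (1 - z\<^sup>2) < sqrt (z\<^sup>2)" using sq(2) by (rule real_sqrt_less_mono)
  then have "1 < z / sqrt (1 - z\<^sup>2)"
    using sq assms by simp
  then have "1 / sqrt 2 < z / (sqrt 2 * sqrt (1 - z\<^sup>2))"
    by (simp add: divide_strict_right_mono flip: divide_divide_eq_left' divide_divide_eq_left)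
  then have "cos (pi / 4) < min 1 (z / (sqrt 2 * sqrt (1 - z\<^sup>2)))"
    unfolding cos_pi_4 by simp
  then have "arccos (min 1 (z / (sqrt 2 * sqrt (1 - z\<^sup>2)))) < pi / 4"
    by (rule arccos_less) auto
  then show ?thesis using assms by (simp add: axis_fraction_def field_simps)
qed

lemma axis_fraction_nonneg:
  assumes "0 < z" "z < 1"
  shows "0 \<le> axis_fraction z"
proof -
  consider "z\<^sup>2 < 1 / 2" | "z\<^sup>2 = 1 / 2" | "1 / 2 < z\<^sup>2" by linarith
  then show ?thesis
  proof cases
    case 2
    then have "z = 1 / sqrt 2" using assms by (metis real_sqrt_unique less_imp_le real_sqrt_divide real_sqrt_one)
    moreover have "sqrt 2 * sqrt (1 - z\<^sup>2) = 1" using 2 by (simp flip: real_sqrt_mult)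
    ultimately have "min 1 (z / (sqrt 2 * sqrt (1 - z\<^sup>2))) = cos (pi / 4)"
      using assms by (simp add: cos_pi_4 min_absorb2)
    then have "arccos (min 1 (z / (sqrt 2 * sqrt (1 - z\<^sup>2)))) = pi / 4"
      by (simp add: arccos_cos)
    then show ?thesis by (simp add: axis_fraction_def)
  qed (use axis_fraction_pos[OF assms] in \<open>auto simp: axis_fraction_def\<close>)
qed

lemma vertex_fraction_nonneg:
  assumes "0 < z" "z < 1"
  shows "0 \<le> vertex_fraction z"
proof (cases "z\<^sup>2 < 2 / 3")
  case False
  have sq: "0 < 1 - z\<^sup>2" "2 * (1 - z\<^sup>2) \<le> z\<^sup>2" using assms False by (simp_all add: power_less_one_iff)
  have "sqrt (2 * (1 - z\<^sup>2)) \<le> sqrt (z\<^sup>2)" using sq(2) by (rule real_sqrt_le_mono)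
  then have "sqrt 2 * sqrt (1 - z\<^sup>2) \<le> z" using assms by (simp only: real_sqrt_mult real_sqrt_abs abs_of_pos)
  then have "cos (pi / 3) \<le> min 1 (z / (2 * sqrt 2 * sqrt (1 - z\<^sup>2)))"
    using sq by (simp add: cos_60 field_simps)
  then have "arccos (min 1 (z / (2 * sqrt 2 * sqrt (1 - z\<^sup>2)))) \<le> pi / 3"
    by (rule arccos_le) auto
  then show ?thesis using False by (simp add: vertex_fraction_def field_simps)
qed (simp add: vertex_fraction_def)

section \<open>From shares of parallel circles to the density\<close>

lemma kappa_squares: "kappa0\<^sup>2 = 8 / 3" "kappa1\<^sup>2 = 32 / 9" "kappa2\<^sup>2 = 4" "kappa3\<^sup>2 = 16 / 3"
  by (simp_all add: kappa0_def kappa1_def kappa2_def kappa3_def power_divide power_mult_distrib)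

lemma kappa_pos: "0 < kappa0" "0 < kappa1" "0 < kappa2" "0 < kappa3"
  by (simp_all add: kappa0_def kappa1_def kappa2_def kappa3_def)

lemma kappa_order: "kappa0 < kappa1" "kappa1 < kappa2" "kappa2 < kappa3"
  by (rule power2_less_imp_less; simp add: kappa_squares kappa_pos less_imp_le)+

lemma less_kappa_iff:
  assumes "0 \<le> s"
  shows "s < kappa0 \<longleftrightarrow> s\<^sup>2 < 8 / 3" "s < kappa1 \<longleftrightarrow> s\<^sup>2 < 32 / 9"
    "s < kappa2 \<longleftrightarrow> s\<^sup>2 < 4" "s < kappa3 \<longleftrightarrow> s\<^sup>2 < 16 / 3"
  using assms kappa_pos by (auto simp flip: kappa_squares simp: power_strict_mono intro: power2_less_imp_less)

text \<open>Substitute the height belonging to the width \<open>s\<close> and pass from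
  \<open>arccos\<close> to \<open>arcsin\<close>. The bound by \<open>kappa1\<close> keeps the
  argument at most 1, so that the minimum disappears.\<close>

lemma axis_fraction_eta:
  assumes "kappa0 \<le> s" "s < kappa1"
  shows "axis_fraction (sqrt 3 / 4 * s) = 4 / pi * (eta_R s - pi / 4)"
proof -
  have s: "0 < s" using assms kappa_pos(1) by linarith
  then have s2: "8 / 3 \<le> s\<^sup>2" "s\<^sup>2 < 32 / 9"
    using assms less_kappa_iff[of s] by (auto simp: not_less[symmetric])
  define E where "E = sqrt (16 - 3 * s\<^sup>2)"
  have E: "0 < E" "E\<^sup>2 = 16 - 3 * s\<^sup>2" using s2 by (simp_all add: E_def)
  let ?g = "sqrt 6 * s / (2 * E)"
  have "1 - (sqrt 3 / 4 * s)\<^sup>2 = (E / 4)\<^sup>2"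
    by (simp add: power_mult_distrib power_divide E)
  then have root: "sqrt (1 - (sqrt 3 / 4 * s)\<^sup>2) = E / 4" using E by (simp only: real_sqrt_abs)
  have "sqrt 6 = sqrt 3 * sqrt 2" by (simp flip: real_sqrt_mult)
  then have arg: "sqrt 3 / 4 * s / (sqrt 2 * sqrt (1 - (sqrt 3 / 4 * s)\<^sup>2)) = ?g"
    using E unfolding root by (simp add: field_simps)
  have "(sqrt 6 * s)\<^sup>2 \<le> (2 * E)\<^sup>2"
    using s2 by (simp add: power_mult_distrib E)
  then have "sqrt 6 * s \<le> 2 * E" by (rule power2_le_imp_le) (use E in simp)
  then have g: "0 \<le> ?g" "?g \<le> 1" using E s by simp_all
  have arccos: "arccos (min 1 ?g) = pi / 2 - eta_R s"
    using g by (simp add: min_absorb2 arccos_arcsin_eq eta_R_def flip: E_def)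
  have nless: "\<not> (sqrt 3 / 4 * s)\<^sup>2 < 1 / 2"
    using s2 by (simp add: power_mult_distrib power_divide)
  show ?thesis
    unfolding axis_fraction_def arg arccos if_not_P[OF nless] by (simp add: field_simps)
qed

lemma vertex_fraction_delta:
  assumes "kappa0 \<le> s" "s < kappa1"
  shows "vertex_fraction (s / 2) = 3 / pi * (pi / 3 - delta_R s)"
proof -
  have s: "0 < s" using assms kappa_pos(1) by linarith
  then have s2: "8 / 3 \<le> s\<^sup>2" "s\<^sup>2 < 32 / 9"
    using assms less_kappa_iff[of s] by (auto simp: not_less[symmetric])
  define H where "H = sqrt (4 - s\<^sup>2)"
  have H: "0 < H" "H\<^sup>2 = 4 - s\<^sup>2" using s2 by (simp_all add: H_def)
  let ?k = "sqrt 2 * s / (4 * H)"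
  have "1 - (s / 2)\<^sup>2 = (H / 2)\<^sup>2"
    by (simp add: power_divide H)
  then have root: "sqrt (1 - (s / 2)\<^sup>2) = H / 2" using H by (simp only: real_sqrt_abs)
  have arg: "s / 2 / (2 * sqrt 2 * sqrt (1 - (s / 2)\<^sup>2)) = ?k"
    using H unfolding root by (simp add: field_simps)
  have "(sqrt 2 * s)\<^sup>2 \<le> (4 * H)\<^sup>2"
    using s2 by (simp add: power_mult_distrib H)
  then have "sqrt 2 * s \<le> 4 * H" by (rule power2_le_imp_le) (use H in simp)
  then have "?k \<le> 1" using H by simp
  then have "arccos (min 1 ?k) = delta_R s"
    by (simp add: min_absorb2 delta_R_def flip: H_def)
  moreover have "\<not> (s / 2)\<^sup>2 < 2 / 3"
    using s2 by (simp add: power_divide)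
  ultimately show ?thesis
    unfolding vertex_fraction_def arg by (simp add: field_simps)
qed

text \<open>At \<open>z\<^sup>2 = 2 / 3\<close> the argument of \<open>arccos\<close> reaches 1: the
  circle touches the four faces of the cone from inside. This height and the bound 8/9 in
  \<open>vertex_fraction_one\<close> both belong to the width \<open>kappa1\<close>.\<close>

lemma axis_fraction_one:
  assumes "2 / 3 \<le> z\<^sup>2" "0 < z" "z < 1"
  shows "axis_fraction z = 1"
proof -
  have sq: "0 < 1 - z\<^sup>2" "2 * (1 - z\<^sup>2) \<le> z\<^sup>2" using assms by (simp_all add: power_less_one_iff)
  have "sqrt (2 * (1 - z\<^sup>2)) \<le> sqrt (z\<^sup>2)" using sq(2) by (rule real_sqrt_le_mono)
  then have "1 \<le> z / (sqrt 2 * sqrt (1 - z\<^sup>2))" using assms sq by (simp only: real_sqrt_mult real_sqrt_abs) simp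
  then show ?thesis using assms by (simp add: axis_fraction_def)
qed

lemma vertex_fraction_one:
  assumes "8 / 9 \<le> z\<^sup>2" "0 < z" "z < 1"
  shows "vertex_fraction z = 1"
proof -
  have sq: "0 < 1 - z\<^sup>2" "8 * (1 - z\<^sup>2) \<le> z\<^sup>2" using assms by (simp_all add: power_less_one_iff)
  have "sqrt (2\<^sup>2 * 2 * (1 - z\<^sup>2)) \<le> sqrt (z\<^sup>2)" using sq(2) by (intro real_sqrt_le_mono) simp
  then have "1 \<le> z / (2 * sqrt 2 * sqrt (1 - z\<^sup>2))" using assms sq by (simp only: real_sqrt_mult real_sqrt_abs) simp
  then show ?thesis using assms by (simp add: vertex_fraction_def)
qed

text \<open>Each coefficient is the number of cones, times the density 1/2 of the height, times the
  derivative of the height with respect to the width: 6 * 1/2 * \<open>sqrt 3 / 4\<close> and 8 *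
  1/2 * 1/2.\<close>

lemma f_R_eq_fractions:
  "f_R s = (if 0 < s \<and> s < kappa3 then 3 * sqrt 3 / 4 * axis_fraction (sqrt 3 / 4 * s) else 0)
     + (if 0 < s \<and> s < kappa2 then 2 * vertex_fraction (s / 2) else 0)"
proof (cases "0 < s")
  case False
  then show ?thesis using kappa_pos by (simp add: f_R_def)
next
  case True
  note lt = less_kappa_iff[OF less_imp_le[OF True]]
  have z2: "(sqrt 3 / 4 * s)\<^sup>2 = 3 / 16 * s\<^sup>2" "(s / 2)\<^sup>2 = s\<^sup>2 / 4"
    by (simp_all add: power_mult_distrib power_divide)
  consider "s < kappa0" | "kappa0 \<le> s" "s < kappa1" | "kappa1 \<le> s" "s < kappa3" | "kappa3 \<le> s" by linarith
  then show ?thesis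
  proof cases
    case 1
    then have "s\<^sup>2 < 8 / 3" using lt by simp
    then have "axis_fraction (sqrt 3 / 4 * s) = 0" "vertex_fraction (s / 2) = 0"
      unfolding axis_fraction_def vertex_fraction_def z2 by simp_all
    then show ?thesis using 1 by (simp add: f_R_def)
  next
    case 2
    then show ?thesis
      unfolding axis_fraction_eta[OF 2] vertex_fraction_delta[OF 2]
      using True kappa_order by (simp add: f_R_def) (simp add: field_simps)
  next
    case 3
    then have s2: "32 / 9 \<le> s\<^sup>2" "s\<^sup>2 < 16 / 3" using lt by (auto simp: not_less[symmetric])
    have "(sqrt 3 / 4 * s)\<^sup>2 < 1\<^sup>2" using s2 unfolding z2 by simp
    then have "sqrt 3 / 4 * s < 1" by (rule power2_less_imp_less) simp
    then have "axis_fraction (sqrt 3 / 4 * s) = 1"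
      using s2 True by (intro axis_fraction_one) (simp_all only: z2, simp_all)
    moreover have "vertex_fraction (s / 2) = 1" if "s < kappa2"
      using s2 True that by (intro vertex_fraction_one) (simp_all only: z2, simp_all add: kappa2_def)
    ultimately show ?thesis using 3 True kappa_order by (auto simp: f_R_def)
  next
    case 4
    then show ?thesis using kappa_order by (simp add: f_R_def)
  qed
qed

lemma kappa3_eq: "kappa3 = 4 / sqrt 3"
  by (simp add: kappa3_def field_simps)

context rotation_invariant
begin

lemma emeasure_axis_region_scaled:
  assumes [measurable]: "S \<in> sets borel"
  shows "6 * emeasure N (axis_region {z. 4 / sqrt 3 * z \<in> S}) =
    (\<integral>\<^sup>+s. ennreal (if 0 < s \<and> s < kappa3 then 3 * sqrt 3 / 4 * axis_fraction (sqrt 3 / 4 * s) else 0)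
       * indicator S s \<partial>lborel)"
proof -
  let ?c = "sqrt 3 / 4" and ?V = "{z. 4 / sqrt 3 * z \<in> S}"
  let ?g = "\<lambda>z. ennreal (1 / 2) * (ennreal (axis_fraction z) * indicator ?V z) * indicator {0<..<1} z"
  have [measurable]: "?V \<in> sets borel" by measurable
  have "emeasure N (axis_region ?V) = (\<integral>\<^sup>+z. ?g z \<partial>lborel)"
    by (rule emeasure_axis_region) measurable
  also have "\<dots> = ennreal \<bar>?c\<bar> * (\<integral>\<^sup>+s. ?g (0 + ?c * s) \<partial>lborel)"
    by (rule nn_integral_real_affine) simp_all
  finally have E: "emeasure N (axis_region ?V) = ennreal \<bar>?c\<bar> * (\<integral>\<^sup>+s. ?g (0 + ?c * s) \<partial>lborel)" .
  have "6 * emeasure N (axis_region ?V) = ennreal (6 * ?c) * (\<integral>\<^sup>+s. ?g (?c * s) \<partial>lborel)"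
  proof -
    have "6 * ennreal \<bar>?c\<bar> = ennreal (6 * ?c)"
      by (subst ennreal_numeral[symmetric], subst ennreal_mult[symmetric]) simp_all
    then show ?thesis by (simp only: E add_0 mult.assoc[symmetric])
  qed
  also have "\<dots> = (\<integral>\<^sup>+s. ennreal (6 * ?c) * ?g (?c * s) \<partial>lborel)"
    by (rule nn_integral_cmult[symmetric]) measurable
  also have "\<dots> = (\<integral>\<^sup>+s. ennreal (if 0 < s \<and> s < kappa3 then 3 * sqrt 3 / 4 * axis_fraction (sqrt 3 / 4 * s) else 0)
       * indicator S s \<partial>lborel)"
  proof (rule nn_integral_cong)
    fix s :: real
    have V: "?c * s \<in> ?V \<longleftrightarrow> s \<in> S" by simp
    have I: "?c * s \<in> {0<..<1} \<longleftrightarrow> 0 < s \<and> s < kappa3"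
      by (auto simp: kappa3_eq zero_less_mult_iff field_simps)
    have e: "ennreal (6 * ?c) * (ennreal (1 / 2) * ennreal a) = ennreal (3 * sqrt 3 / 4 * a)" if "0 \<le> a" for a
      using that by (subst ennreal_mult[symmetric], simp, simp, subst ennreal_mult[symmetric]) simp_all
    show "ennreal (6 * ?c) * ?g (?c * s) = ennreal (if 0 < s \<and> s < kappa3
        then 3 * sqrt 3 / 4 * axis_fraction (sqrt 3 / 4 * s) else 0) * indicator S s"
    proof (cases "s \<in> S \<and> 0 < s \<and> s < kappa3")
      case True
      then have "0 \<le> axis_fraction (?c * s)" using I by (intro axis_fraction_nonneg) auto
      moreover have "indicator ?V (?c * s) = (1 :: ennreal)" "indicator {0<..<1} (?c * s) = (1 :: ennreal)"
        "indicator S s = (1 :: ennreal)" using True V I by (simp_all only: indicator_simps)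
      ultimately show ?thesis using True e[of "axis_fraction (?c * s)"]
        by (simp only: if_True mult_1_right simp_thms)
    next
      case False
      then show ?thesis using V I by (auto simp: indicator_def simp del: greaterThanLessThan_iff)
    qed
  qed
  finally show ?thesis .
qed

lemma emeasure_vertex_region_scaled:
  assumes [measurable]: "S \<in> sets borel"
  shows "8 * emeasure N (vertex_region {t. 2 * t \<in> S}) =
    (\<integral>\<^sup>+s. ennreal (if 0 < s \<and> s < kappa2 then 2 * vertex_fraction (s / 2) else 0)
       * indicator S s \<partial>lborel)"
proof -
  let ?c = "1 / 2 :: real" and ?V = "{t. 2 * t \<in> S}"
  let ?g = "\<lambda>z. ennreal (1 / 2) * (ennreal (vertex_fraction z) * indicator ?V z) * indicator {0<..<1} z"
  have [measurable]: "?V \<in> sets borel" by measurable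
  have "emeasure N (vertex_region ?V) = (\<integral>\<^sup>+z. ?g z \<partial>lborel)"
    by (rule emeasure_vertex_region) measurable
  also have "\<dots> = ennreal \<bar>?c\<bar> * (\<integral>\<^sup>+s. ?g (0 + ?c * s) \<partial>lborel)"
    by (rule nn_integral_real_affine) simp_all
  finally have "8 * emeasure N (vertex_region ?V) = 8 * ennreal ?c * (\<integral>\<^sup>+s. ?g (s / 2) \<partial>lborel)"
    by (simp only: mult.assoc add_0 times_divide_eq_left mult_1_left) simp
  also have "8 * ennreal ?c = ennreal 4"
    by (subst ennreal_numeral[symmetric], subst ennreal_mult[symmetric]) simp_all
  also have "ennreal 4 * (\<integral>\<^sup>+s. ?g (s / 2) \<partial>lborel) = (\<integral>\<^sup>+s. ennreal 4 * ?g (s / 2) \<partial>lborel)"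
    by (rule nn_integral_cmult[symmetric]) measurable
  also have "\<dots> = (\<integral>\<^sup>+s. ennreal (if 0 < s \<and> s < kappa2 then 2 * vertex_fraction (s / 2) else 0)
       * indicator S s \<partial>lborel)"
  proof (rule nn_integral_cong)
    fix s :: real
    have V: "s / 2 \<in> ?V \<longleftrightarrow> s \<in> S" by simp
    have I: "s / 2 \<in> {0<..<1} \<longleftrightarrow> 0 < s \<and> s < kappa2"
      by (auto simp: kappa2_def)
    have e: "ennreal 4 * (ennreal (1 / 2) * ennreal a) = ennreal (2 * a)" if "0 \<le> a" for a
      using that by (subst ennreal_mult[symmetric], simp, simp, subst ennreal_mult[symmetric]) simp_all
    show "ennreal 4 * ?g (s / 2) = ennreal (if 0 < s \<and> s < kappa2
        then 2 * vertex_fraction (s / 2) else 0) * indicator S s"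
    proof (cases "s \<in> S \<and> 0 < s \<and> s < kappa2")
      case True
      then have "0 \<le> vertex_fraction (s / 2)" using I by (intro vertex_fraction_nonneg) auto
      moreover have "indicator ?V (s / 2) = (1 :: ennreal)" "indicator {0<..<1} (s / 2) = (1 :: ennreal)"
        "indicator S s = (1 :: ennreal)" using True V I by (simp_all only: indicator_simps)
      ultimately show ?thesis using True e[of "vertex_fraction (s / 2)"]
        by (simp only: if_True mult_1_right simp_thms)
    next
      case False
      then show ?thesis using V I by (auto simp: indicator_def simp del: greaterThanLessThan_iff)
    qed
  qed
  finally show ?thesis .
qed

end

lemma f_R_parts_nonneg:
  "0 \<le> (if 0 < s \<and> s < kappa3 then 3 * sqrt 3 / 4 * axis_fraction (sqrt 3 / 4 * s) else 0)" (is "0 \<le> ?a")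
  "0 \<le> (if 0 < s \<and> s < kappa2 then 2 * vertex_fraction (s / 2) else 0)" (is "0 \<le> ?b")
proof -
  have "0 \<le> axis_fraction (sqrt 3 / 4 * s)" if "0 < s" "s < kappa3"
    using that by (intro axis_fraction_nonneg) (simp_all add: kappa3_eq field_simps)
  then show "0 \<le> ?a" by simp
  have "0 \<le> vertex_fraction (s / 2)" if "0 < s" "s < kappa2"
    using that by (intro vertex_fraction_nonneg) (simp_all add: kappa2_def)
  then show "0 \<le> ?b" by simp
qed

lemma f_R_nonneg: "0 \<le> f_R s"
  unfolding f_R_eq_fractions by (intro add_nonneg_nonneg f_R_parts_nonneg)

lemma f_R_pos:
  assumes "kappa0 < s" "s < kappa3"
  shows "0 < f_R s"
proof -
  have s: "0 < s" using assms kappa_pos by linarith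
  have "8 / 3 < s\<^sup>2" using power_strict_mono[OF assms(1), of 2] kappa_pos by (simp add: kappa_squares)
  then have "0 < axis_fraction (sqrt 3 / 4 * s)"
    using s assms by (intro axis_fraction_pos) (simp_all add: kappa3_eq power_mult_distrib power_divide field_simps)
  then show ?thesis
    unfolding f_R_eq_fractions using s assms f_R_parts_nonneg(2)[of s]
    by (intro add_pos_nonneg) simp_all
qed

lemma (in rotation_invariant) emeasure_radial_width_density:
  assumes [measurable]: "S \<in> sets borel"
  shows "emeasure N {x. radial_width x \<in> S} = (\<integral>\<^sup>+s. ennreal (f_R s) * indicator S s \<partial>lborel)"
proof -
  have "emeasure N {x. radial_width x \<in> S} =
     (\<integral>\<^sup>+s. ennreal (if 0 < s \<and> s < kappa3 then 3 * sqrt 3 / 4 * axis_fraction (sqrt 3 / 4 * s) else 0)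
       * indicator S s \<partial>lborel) +
     (\<integral>\<^sup>+s. ennreal (if 0 < s \<and> s < kappa2 then 2 * vertex_fraction (s / 2) else 0) * indicator S s \<partial>lborel)"
    by (simp only: emeasure_radial_width[OF assms] emeasure_axis_region_scaled[OF assms]
        emeasure_vertex_region_scaled[OF assms])
  also have "\<dots> = (\<integral>\<^sup>+s. ennreal (if 0 < s \<and> s < kappa3 then 3 * sqrt 3 / 4 * axis_fraction (sqrt 3 / 4 * s) else 0)
       * indicator S s + ennreal (if 0 < s \<and> s < kappa2 then 2 * vertex_fraction (s / 2) else 0) * indicator S s \<partial>lborel)"
    by (rule nn_integral_add[symmetric]) measurable
  also have "\<dots> = (\<integral>\<^sup>+s. ennreal (f_R s) * indicator S s \<partial>lborel)"
    unfolding f_R_eq_fractions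
    by (simp only: ennreal_plus[OF f_R_parts_nonneg] distrib_right)
  finally show ?thesis .
qed

section \<open>The distribution function\<close>

text \<open>One minus the squared argument of \<open>arcsin\<close> is a multiple of
  \<open>32 - 9 * s\<^sup>2\<close>. This vanishes at \<open>kappa1\<close>, where the derivative
  blows up; therefore the bound is strict.\<close>

lemma eta_R_derivative:
  assumes "0 < s" "9 * s\<^sup>2 < 32"
  shows "(eta_R has_real_derivative 16 * sqrt 3 / ((16 - 3 * s\<^sup>2) * sqrt (32 - 9 * s\<^sup>2))) (at s)"
proof -
  define E where "E = sqrt (16 - 3 * s\<^sup>2)"
  define D where "D = sqrt (32 - 9 * s\<^sup>2)"
  have E: "0 < E" "E\<^sup>2 = 16 - 3 * s\<^sup>2" using assms by (simp_all add: E_def)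
  have D: "0 < D" "D\<^sup>2 = 32 - 9 * s\<^sup>2" using assms by (simp_all add: D_def)
  let ?g = "sqrt 6 * s / (2 * E)"
  have "1 - ?g\<^sup>2 = (4 * E\<^sup>2 - 6 * s\<^sup>2) / (4 * E\<^sup>2)"
    using E(1) by (simp add: power_divide power_mult_distrib field_simps)
  also have "4 * E\<^sup>2 - 6 * s\<^sup>2 = 2 * D\<^sup>2" by (simp add: E(2) D(2))
  also have "2 * D\<^sup>2 / (4 * E\<^sup>2) = (D / (sqrt 2 * E))\<^sup>2"
    by (simp add: power_divide power_mult_distrib)
  finally have sq: "1 - ?g\<^sup>2 = (D / (sqrt 2 * E))\<^sup>2" .
  have "0 < D / (sqrt 2 * E)" using D(1) E(1) by simp
  with sq have root: "sqrt (1 - ?g\<^sup>2) = D / (sqrt 2 * E)" by (simp only: real_sqrt_abs abs_of_pos)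
  have "0 < (D / (sqrt 2 * E))\<^sup>2" using \<open>0 < D / (sqrt 2 * E)\<close> by (rule zero_less_power)
  then have "?g\<^sup>2 < 1" using sq by linarith
  then have g1: "- 1 < ?g" "?g < 1" unfolding abs_square_less_1 abs_less_iff by simp_all
  have "((\<lambda>s. sqrt 6 * s / (2 * sqrt (16 - 3 * s\<^sup>2))) has_real_derivative
      (sqrt 6 * (2 * E) - sqrt 6 * s * (2 * (inverse E / 2 * (- 6 * s)))) / (2 * E)\<^sup>2) (at s)"
    unfolding E_def using assms
    by (auto intro!: derivative_eq_intros simp: power2_eq_square)
  also have "(sqrt 6 * (2 * E) - sqrt 6 * s * (2 * (inverse E / 2 * (- 6 * s)))) / (2 * E)\<^sup>2
      = 8 * sqrt 6 / (E\<^sup>2 * E)"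
  proof -
    have "sqrt 6 * (2 * E) - sqrt 6 * s * (2 * (inverse E / 2 * (- 6 * s))) =
      sqrt 6 * (2 * E\<^sup>2 + 6 * s\<^sup>2) / E"
      using E(1) by (simp add: field_simps power2_eq_square)
    also have "2 * E\<^sup>2 + 6 * s\<^sup>2 = 32" by (simp add: E(2))
    finally show ?thesis by (simp add: power_mult_distrib)
  qed
  finally have dg: "((\<lambda>s. sqrt 6 * s / (2 * sqrt (16 - 3 * s\<^sup>2))) has_real_derivative 8 * sqrt 6 / (E\<^sup>2 * E)) (at s)" .
  have "((\<lambda>s. arcsin (sqrt 6 * s / (2 * sqrt (16 - 3 * s\<^sup>2)))) has_real_derivative
      inverse (sqrt (1 - ?g\<^sup>2)) * (8 * sqrt 6 / (E\<^sup>2 * E))) (at s)"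
    unfolding E_def by (rule DERIV_chain2[OF DERIV_arcsin dg[unfolded E_def]]) (use g1 in \<open>simp_all add: E_def\<close>)
  also have "inverse (sqrt (1 - ?g\<^sup>2)) * (8 * sqrt 6 / (E\<^sup>2 * E)) = 16 * sqrt 3 / (E\<^sup>2 * D)"
  proof -
    have "sqrt 6 = sqrt 3 * sqrt 2" by (simp flip: real_sqrt_mult)
    then show ?thesis unfolding root using D(1) E(1) by (simp add: field_simps)
  qed
  finally show ?thesis
    unfolding E(2) D_def eta_R_def[abs_def] .
qed

lemma delta_R_derivative:
  assumes "0 < s" "9 * s\<^sup>2 < 32"
  shows "(delta_R has_real_derivative - (4 / ((4 - s\<^sup>2) * sqrt (32 - 9 * s\<^sup>2)))) (at s)"
proof -
  define H where "H = sqrt (4 - s\<^sup>2)"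
  define D where "D = sqrt (32 - 9 * s\<^sup>2)"
  have H: "0 < H" "H\<^sup>2 = 4 - s\<^sup>2" using assms by (simp_all add: H_def)
  have D: "0 < D" "D\<^sup>2 = 32 - 9 * s\<^sup>2" using assms by (simp_all add: D_def)
  let ?k = "sqrt 2 * s / (4 * H)"
  have "1 - ?k\<^sup>2 = (16 * H\<^sup>2 - 2 * s\<^sup>2) / (16 * H\<^sup>2)"
    using H(1) by (simp add: power_divide power_mult_distrib field_simps)
  also have "16 * H\<^sup>2 - 2 * s\<^sup>2 = 2 * D\<^sup>2" by (simp add: H(2) D(2))
  also have "2 * D\<^sup>2 / (16 * H\<^sup>2) = (D / (2 * sqrt 2 * H))\<^sup>2"
    by (simp add: power_divide power_mult_distrib)
  finally have sq: "1 - ?k\<^sup>2 = (D / (2 * sqrt 2 * H))\<^sup>2" .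
  have "0 < D / (2 * sqrt 2 * H)" using D(1) H(1) by simp
  with sq have root: "sqrt (1 - ?k\<^sup>2) = D / (2 * sqrt 2 * H)" by (simp only: real_sqrt_abs abs_of_pos)
  have "0 < (D / (2 * sqrt 2 * H))\<^sup>2" using \<open>0 < D / (2 * sqrt 2 * H)\<close> by (rule zero_less_power)
  then have "?k\<^sup>2 < 1" using sq by linarith
  then have k1: "- 1 < ?k" "?k < 1" unfolding abs_square_less_1 abs_less_iff by simp_all
  have "((\<lambda>s. sqrt 2 * s / (4 * sqrt (4 - s\<^sup>2))) has_real_derivative
      (sqrt 2 * (4 * H) - sqrt 2 * s * (4 * (inverse H / 2 * (- 2 * s)))) / (4 * H)\<^sup>2) (at s)"
    unfolding H_def using assms
    by (auto intro!: derivative_eq_intros simp: power2_eq_square)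
  also have "(sqrt 2 * (4 * H) - sqrt 2 * s * (4 * (inverse H / 2 * (- 2 * s)))) / (4 * H)\<^sup>2
      = sqrt 2 / (H\<^sup>2 * H)"
  proof -
    have "sqrt 2 * (4 * H) - sqrt 2 * s * (4 * (inverse H / 2 * (- 2 * s))) =
      sqrt 2 * (4 * H\<^sup>2 + 4 * s\<^sup>2) / H"
      using H(1) by (simp add: field_simps power2_eq_square)
    also have "4 * H\<^sup>2 + 4 * s\<^sup>2 = 16" by (simp add: H(2))
    finally show ?thesis by (simp add: power_mult_distrib)
  qed
  finally have dk: "((\<lambda>s. sqrt 2 * s / (4 * sqrt (4 - s\<^sup>2))) has_real_derivative sqrt 2 / (H\<^sup>2 * H)) (at s)" .
  have "((\<lambda>s. arccos (sqrt 2 * s / (4 * sqrt (4 - s\<^sup>2)))) has_real_derivative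
      inverse (- sqrt (1 - ?k\<^sup>2)) * (sqrt 2 / (H\<^sup>2 * H))) (at s)"
    unfolding H_def by (rule DERIV_chain2[OF DERIV_arccos dk[unfolded H_def]]) (use k1 in \<open>simp_all add: H_def\<close>)
  also have "inverse (- sqrt (1 - ?k\<^sup>2)) * (sqrt 2 / (H\<^sup>2 * H)) = - (4 / (H\<^sup>2 * D))"
    unfolding root using D(1) H(1) by (simp add: field_simps)
  finally show ?thesis
    unfolding H(2) D_def delta_R_def[abs_def] .
qed

text \<open>For \<open>c = 1\<close> and \<open>c = 2\<close> the last factor is a multiple of
  \<open>16 - 3 * s\<^sup>2\<close> and of \<open>4 - s\<^sup>2\<close>, the denominators in the
  derivatives of \<open>eta_R\<close> and \<open>delta_R\<close>. This is the origin of the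
  arguments of \<open>arctan\<close> in \<open>J_max_R\<close> and \<open>J_Sigma_R\<close>.\<close>

lemma arctan_root_derivative:
  assumes "0 < s" "9 * s\<^sup>2 < 32" and c: "0 < c"
  shows "((\<lambda>s. arctan (c * sqrt (2 * (1 - 9 * s\<^sup>2 / 32)))) has_real_derivative
     - (9 * c * s / (4 * sqrt (32 - 9 * s\<^sup>2) * (1 + c\<^sup>2 * (32 - 9 * s\<^sup>2) / 16)))) (at s)"
proof -
  define D where "D = sqrt (32 - 9 * s\<^sup>2)"
  have D: "0 < D" "D\<^sup>2 = 32 - 9 * s\<^sup>2" using assms by (simp_all add: D_def)
  have root: "sqrt (2 * (1 - 9 * t\<^sup>2 / 32)) = sqrt (32 - 9 * t\<^sup>2) / 4" for t :: real
  proof -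
    have "2 * (1 - 9 * t\<^sup>2 / 32) = (32 - 9 * t\<^sup>2) / 4\<^sup>2" by simp
    then show ?thesis by (simp only: real_sqrt_divide real_sqrt_abs abs_numeral)
  qed
  have "((\<lambda>s. arctan (c * (sqrt (32 - 9 * s\<^sup>2) / 4))) has_real_derivative
     inverse (1 + (c * (D / 4))\<^sup>2) * (c * (inverse D / 2 * (- 18 * s) / 4))) (at s)"
    unfolding D_def using assms
    by (auto intro!: derivative_eq_intros)
  also have "inverse (1 + (c * (D / 4))\<^sup>2) * (c * (inverse D / 2 * (- 18 * s) / 4)) =
     - (9 * c * s / (4 * D * (1 + c\<^sup>2 * D\<^sup>2 / 16)))"
  proof -
    have "1 + (c * (D / 4))\<^sup>2 = 1 + c\<^sup>2 * D\<^sup>2 / 16"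
      by (simp add: power_mult_distrib power_divide)
    moreover have "inverse Q * (c * (inverse D / 2 * (- 18 * s) / 4)) = - (9 * c * s / (4 * D * Q))" for Q
      by (simp add: divide_simps)
    ultimately show ?thesis by (simp only:)
  qed
  finally show ?thesis unfolding D(2) unfolding root D_def .
qed

text \<open>Integration by parts: the \<open>arctan\<close> term is there to cancel the product of
  \<open>s\<close> with the derivative of \<open>eta_R\<close>.\<close>

lemma J_max_R_derivative:
  assumes "0 < s" "9 * s\<^sup>2 < 32"
  shows "(J_max_R has_real_derivative sqrt 3 / 8 * eta_R s) (at s)"
proof -
  define D where "D = sqrt (32 - 9 * s\<^sup>2)"
  have D: "0 < D" using assms by (simp add: D_def)
  have E: "0 < 16 - 3 * s\<^sup>2" using assms by simp
  have "((\<lambda>s. sqrt 3 / 8 * s * eta_R s + 1 / 2 * arctan (1 * sqrt (2 * (1 - 9 * s\<^sup>2 / 32)))) has_real_derivative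
     sqrt 3 / 8 * s * (16 * sqrt 3 / ((16 - 3 * s\<^sup>2) * D)) + sqrt 3 / 8 * eta_R s +
     1 / 2 * - (9 * 1 * s / (4 * D * (1 + 1\<^sup>2 * (32 - 9 * s\<^sup>2) / 16)))) (at s)"
    unfolding D_def
    by (rule derivative_eq_intros eta_R_derivative[OF assms] arctan_root_derivative[OF assms] refl zero_less_one)+ simp
  also have "sqrt 3 / 8 * s * (16 * sqrt 3 / ((16 - 3 * s\<^sup>2) * D)) + sqrt 3 / 8 * eta_R s +
     1 / 2 * - (9 * 1 * s / (4 * D * (1 + 1\<^sup>2 * (32 - 9 * s\<^sup>2) / 16))) = sqrt 3 / 8 * eta_R s"
  proof -
    have "1 + 1\<^sup>2 * (32 - 9 * s\<^sup>2) / 16 = 3 * (16 - 3 * s\<^sup>2) / 16" by simp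
    then have 1: "1 / 2 * - (9 * 1 * s / (4 * D * (1 + 1\<^sup>2 * (32 - 9 * s\<^sup>2) / 16))) = - (6 * s / ((16 - 3 * s\<^sup>2) * D))"
      using D E by (simp only:) (simp add: divide_simps)
    have "sqrt 3 / 8 * s * (16 * sqrt 3 / ((16 - 3 * s\<^sup>2) * D)) = (sqrt 3 * sqrt 3) * 2 * s / ((16 - 3 * s\<^sup>2) * D)"
      by (simp add: divide_simps)
    then show ?thesis unfolding 1 by simp
  qed
  finally show ?thesis by (simp add: J_max_R_def[abs_def])
qed

lemma J_Sigma_R_derivative:
  assumes "0 < s" "9 * s\<^sup>2 < 32"
  shows "(J_Sigma_R has_real_derivative sqrt 3 / 8 * delta_R s) (at s)"
proof -
  define D where "D = sqrt (32 - 9 * s\<^sup>2)"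
  have D: "0 < D" using assms by (simp add: D_def)
  have E: "0 < 4 - s\<^sup>2" using assms by simp
  have "((\<lambda>s. sqrt 3 / 8 * s * delta_R s - sqrt 3 / 4 * arctan (2 * sqrt (2 * (1 - 9 * s\<^sup>2 / 32)))) has_real_derivative
     sqrt 3 / 8 * s * - (4 / ((4 - s\<^sup>2) * D)) + sqrt 3 / 8 * delta_R s -
     sqrt 3 / 4 * - (9 * 2 * s / (4 * D * (1 + 2\<^sup>2 * (32 - 9 * s\<^sup>2) / 16)))) (at s)"
    unfolding D_def
    by (rule derivative_eq_intros delta_R_derivative[OF assms] arctan_root_derivative[OF assms] refl zero_less_numeral)+ simp
  also have "sqrt 3 / 8 * s * - (4 / ((4 - s\<^sup>2) * D)) + sqrt 3 / 8 * delta_R s -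
     sqrt 3 / 4 * - (9 * 2 * s / (4 * D * (1 + 2\<^sup>2 * (32 - 9 * s\<^sup>2) / 16))) = sqrt 3 / 8 * delta_R s"
  proof -
    have "1 + 2\<^sup>2 * (32 - 9 * s\<^sup>2) / 16 = 9 * (4 - s\<^sup>2) / 4" by simp
    then have "sqrt 3 / 4 * - (9 * 2 * s / (4 * D * (1 + 2\<^sup>2 * (32 - 9 * s\<^sup>2) / 16))) =
        sqrt 3 / 8 * s * - (4 / ((4 - s\<^sup>2) * D))"
      using D E by (simp only:) (simp add: divide_simps)
    then show ?thesis by simp
  qed
  finally show ?thesis by (simp add: J_Sigma_R_def[abs_def])
qed

lemma Phi_R_derivative:
  assumes "kappa0 < s" "s < kappa1"
  shows "(Phi_R has_real_derivative f_R s) (at s)"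
proof -
  have s: "0 < s" using assms kappa_pos by linarith
  then have "9 * s\<^sup>2 < 32" using assms less_kappa_iff(2)[of s] by simp
  note J = J_max_R_derivative[OF s this] J_Sigma_R_derivative[OF s this]
  have "(Phi_R has_real_derivative
     24 / pi * (sqrt 3 / 8 * eta_R s - pi * sqrt 3 / 32) +
     48 / (pi * sqrt 3) * (pi * sqrt 3 / 24 - sqrt 3 / 8 * delta_R s)) (at s)"
    unfolding Phi_R_def[abs_def] by (auto intro!: derivative_eq_intros J)
  also have "24 / pi * (sqrt 3 / 8 * eta_R s - pi * sqrt 3 / 32) +
     48 / (pi * sqrt 3) * (pi * sqrt 3 / 24 - sqrt 3 / 8 * delta_R s) = f_R s"
    using assms by (simp add: f_R_def) (simp add: field_simps)
  finally show ?thesis .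
qed

text \<open>Since the derivatives of \<open>eta_R\<close> and \<open>delta_R\<close> blow up at
  \<open>kappa1\<close>, the fundamental theorem is applied with continuity on the closed interval
  and derivatives inside only.\<close>

lemma continuous_on_Phi_R: "continuous_on {kappa0..kappa1} Phi_R"
proof -
  have sq: "0 \<le> s" "s\<^sup>2 \<le> 32 / 9" if "s \<in> {kappa0..kappa1}" for s
    using that kappa_pos less_kappa_iff(2)[of s] power_mono[of s kappa1 2] by (auto simp: kappa_squares)
  have "continuous_on {kappa0..kappa1} eta_R"
    unfolding eta_R_def[abs_def]
  proof (intro continuous_intros ballI)
    fix s assume s: "s \<in> {kappa0..kappa1}"
    have "sqrt 6 * s \<le> 2 * sqrt (16 - 3 * s\<^sup>2)"
      by (rule power2_le_imp_le) (use sq[OF s] in \<open>simp_all add: power_mult_distrib\<close>)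
    then have "sqrt 6 * s / (2 * sqrt (16 - 3 * s\<^sup>2)) \<le> 1"
      by (cases "sqrt (16 - 3 * s\<^sup>2) = 0") (use sq[OF s] in \<open>simp_all add: divide_le_eq\<close>)
    moreover have "0 \<le> sqrt 6 * s / (2 * sqrt (16 - 3 * s\<^sup>2))" using sq[OF s] by simp
    ultimately show "- 1 \<le> sqrt 6 * s / (2 * sqrt (16 - 3 * s\<^sup>2)) \<and> sqrt 6 * s / (2 * sqrt (16 - 3 * s\<^sup>2)) \<le> 1" by linarith
  qed (use sq in force)
  moreover have "continuous_on {kappa0..kappa1} delta_R"
    unfolding delta_R_def[abs_def]
  proof (intro continuous_intros ballI)
    fix s assume s: "s \<in> {kappa0..kappa1}"
    have "sqrt 2 * s \<le> 4 * sqrt (4 - s\<^sup>2)"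
      by (rule power2_le_imp_le) (use sq[OF s] in \<open>simp_all add: power_mult_distrib\<close>)
    then have "sqrt 2 * s / (4 * sqrt (4 - s\<^sup>2)) \<le> 1"
      by (cases "sqrt (4 - s\<^sup>2) = 0") (use sq[OF s] in \<open>simp_all add: divide_le_eq\<close>)
    moreover have "0 \<le> sqrt 2 * s / (4 * sqrt (4 - s\<^sup>2))" using sq[OF s] by simp
    ultimately show "- 1 \<le> sqrt 2 * s / (4 * sqrt (4 - s\<^sup>2)) \<and> sqrt 2 * s / (4 * sqrt (4 - s\<^sup>2)) \<le> 1" by linarith
  qed (use sq in force)
  ultimately show ?thesis
    unfolding Phi_R_def[abs_def] J_max_R_def[abs_def] J_Sigma_R_def[abs_def]
    by (intro continuous_intros) auto
qed

lemma eta_R_kappa: "eta_R kappa0 = pi / 4" "eta_R kappa1 = pi / 2"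
proof -
  have "sqrt 6 * kappa0 = 4" by (simp add: kappa0_def)
  moreover have "sqrt (16 - 3 * kappa0\<^sup>2) = 2 * sqrt 2"
    by (rule real_sqrt_unique) (simp_all add: kappa_squares power_mult_distrib)
  ultimately have "sqrt 6 * kappa0 / (2 * sqrt (16 - 3 * kappa0\<^sup>2)) = sin (pi / 4)"
    by (simp add: sin_45 field_simps)
  then show "eta_R kappa0 = pi / 4" by (simp only: eta_R_def) (rule arcsin_sin; simp)
  have "sqrt (16 - 3 * kappa1\<^sup>2) = sqrt 6 * kappa1 / 2"
    by (rule real_sqrt_unique) (use kappa_pos in \<open>simp_all add: kappa_squares power_mult_distrib power_divide\<close>)
  then have "sqrt 6 * kappa1 / (2 * sqrt (16 - 3 * kappa1\<^sup>2)) = 1" using kappa_pos by (simp only:) simp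
  then show "eta_R kappa1 = pi / 2" by (simp only: eta_R_def arcsin_1)
qed

lemma delta_R_kappa: "delta_R kappa0 = pi / 3" "delta_R kappa1 = 0"
proof -
  have "sqrt (4 - kappa0\<^sup>2) = sqrt 2 * kappa0 / 2"
    by (rule real_sqrt_unique) (use kappa_pos in \<open>simp_all add: kappa_squares power_mult_distrib power_divide\<close>)
  then have "sqrt 2 * kappa0 / (4 * sqrt (4 - kappa0\<^sup>2)) = cos (pi / 3)"
    using kappa_pos by (simp only: cos_60) simp
  then show "delta_R kappa0 = pi / 3" by (simp only: delta_R_def) (rule arccos_cos; simp)
  have "sqrt (4 - kappa1\<^sup>2) = sqrt 2 * kappa1 / 4"
    by (rule real_sqrt_unique) (use kappa_pos in \<open>simp_all add: kappa_squares power_mult_distrib power_divide\<close>)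
  then have "sqrt 2 * kappa1 / (4 * sqrt (4 - kappa1\<^sup>2)) = 1" using kappa_pos by (simp only:) simp
  then show "delta_R kappa1 = 0" by (simp only: delta_R_def arccos_1)
qed

lemma Phi_R_kappa0: "Phi_R kappa0 = 0"
  by (simp add: Phi_R_def)

text \<open>At \<open>kappa0\<close> the two \<open>arctan\<close> terms have reciprocal arguments,
  so with equal weights -12/pi they add up to -6; at \<open>kappa1\<close> both vanish.\<close>

lemma Phi_R_kappa1: "Phi_R kappa1 = (2 + 3 * sqrt 3 / 4) * kappa1 - 6"
proof -
  have "arctan (sqrt 2) = pi / 2 - arctan (1 / sqrt 2)"
    using arctan_inverse[of "sqrt 2"] by (simp add: inverse_eq_divide)
  moreover have "2 * sqrt (1 / 2) = sqrt 2"
    by (simp add: real_sqrt_divide real_div_sqrt)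
  ultimately have arctan: "arctan (2 * sqrt (1 / 2)) = pi / 2 - arctan (sqrt (1 / 2))"
    by (simp add: real_sqrt_divide)
  show ?thesis
    unfolding Phi_R_def J_max_R_def J_Sigma_R_def eta_R_kappa delta_R_kappa kappa_squares
    by (simp add: arctan) (simp add: field_simps)
qed

text \<open>The pieces can be joined because consecutive branches of \<open>F_R\<close> agree at
  each breakpoint. The values of \<open>f_R\<close> at the breakpoints themselves are a finite
  exception.\<close>

lemma f_R_has_integral:
  assumes "kappa0 \<le> s"
  shows "(f_R has_integral F_R s) {kappa0..s}"
proof -
  note less_imp_le[OF kappa_order(1)] less_imp_le[OF kappa_order(2)] less_imp_le[OF kappa_order(3)]
  note order = this kappa_order
  have 1: "(f_R has_integral Phi_R s) {kappa0..s}" if "kappa0 \<le> s" "s \<le> kappa1" for s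
  proof -
    have "(f_R has_integral Phi_R s - Phi_R kappa0) {kappa0..s}"
      using that
      by (intro fundamental_theorem_of_calculus_interior continuous_on_subset[OF continuous_on_Phi_R])
        (auto simp: has_real_derivative_iff_has_vector_derivative[symmetric] intro!: Phi_R_derivative)
    then show ?thesis by (simp add: Phi_R_kappa0)
  qed
  have linear: "(f_R has_integral c * (b - a)) {a..b}" if "a \<le> b" "\<And>x. a < x \<Longrightarrow> x < b \<Longrightarrow> f_R x = c" for a b c
  proof -
    have "((\<lambda>x. c) has_integral c * (b - a)) {a..b}"
      using has_integral_const_real[of c a b] \<open>a \<le> b\<close> by (simp add: mult.commute)
    then show ?thesis
      by (rule has_integral_spike_finite[of "{a, b}", rotated 2]) (use that in auto)
  qed
  have 2: "(f_R has_integral (2 + 3 * sqrt 3 / 4) * s - 6) {kappa0..s}" if "kappa1 \<le> s" "s \<le> kappa2" for s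
  proof -
    have "(f_R has_integral (2 + 3 * sqrt 3 / 4) * (s - kappa1)) {kappa1..s}"
      using that order by (intro linear) (auto simp: f_R_def)
    from has_integral_combine[OF order(1) that(1) 1[OF order(1) order_refl] this] show ?thesis
      unfolding Phi_R_kappa1 by (simp add: right_diff_distrib)
  qed
  have 3: "(f_R has_integral 3 * sqrt 3 / 4 * s - 2) {kappa0..s}" if "kappa2 \<le> s" "s \<le> kappa3" for s
  proof -
    have *: "(f_R has_integral 3 * sqrt 3 / 4 * (s - kappa2)) {kappa2..s}"
      using that order by (intro linear) (auto simp: f_R_def)
    have "(2 + 3 * sqrt 3 / 4) * kappa2 - 6 + 3 * sqrt 3 / 4 * (s - kappa2) = 3 * sqrt 3 / 4 * s - 2"
      by (simp add: kappa2_def field_simps)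
    then show ?thesis
      using has_integral_combine[OF order_trans[OF order(1,2)] that(1) 2[OF order(2) order_refl] *]
      by (simp only:)
  qed
  have 4: "(f_R has_integral 1) {kappa0..s}" if "kappa3 \<le> s" for s
  proof -
    have "(f_R has_integral 0 * (s - kappa3)) {kappa3..s}"
      using that order by (intro linear) (auto simp: f_R_def)
    from has_integral_combine[OF _ that(1) 3[OF order(3) order_refl] this] show ?thesis
      using order by (simp add: kappa3_def)
  qed
  show ?thesis
    using 1[of s] 2[of s] 3[of s] 4[of s] assms order
    by (cases "s < kappa1"; cases "s < kappa2"; cases "s < kappa3") (simp_all add: F_R_def)
qed

section \<open>Law, support and distribution function of the width\<close>

lemma width_eq_radial_width: "width rhombic_dodecahedron = radial_width"
  by (rule ext) (simp add: width_rhombic_dodecahedron sum_abs_inner_xi radial_width_def)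

lemma width_eq_brightness:
  "norm u = 1 \<Longrightarrow> width rhombic_dodecahedron u = 8 / sqrt 3 * brightness tetrahedron u"
  by (simp add: width_rhombic_dodecahedron brightness_tetrahedron field_simps)

lemma nn_integral_f_R:
  assumes "kappa0 \<le> a" "a \<le> b"
  shows "(\<integral>\<^sup>+s. ennreal (f_R s) * indicator {a..b} s \<partial>lborel) = ennreal (F_R b - F_R a)"
proof (rule nn_integral_has_integral_lebesgue'[OF f_R_nonneg])
  have "(f_R has_integral integral {a..b} f_R) {a..b}"
    by (rule integrable_integral, rule integrable_subinterval_real[OF has_integral_integrable[OF f_R_has_integral[of b]]])
      (use assms in auto)
  from has_integral_combine[OF assms f_R_has_integral[OF assms(1)] this]
  have "integral {a..b} f_R = F_R b - F_R a"
    using f_R_has_integral[of b] assms by (auto dest: has_integral_unique)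
  with \<open>(f_R has_integral integral {a..b} f_R) {a..b}\<close>
  show "(f_R has_integral F_R b - F_R a) {a..b}" by simp
qed

lemma F_R_kappa0: "F_R kappa0 = 0"
  using kappa_order by (simp add: F_R_def Phi_R_kappa0)

lemma nn_integral_f_R_atMost:
  "(\<integral>\<^sup>+s. ennreal (f_R s) * indicator {..b} s \<partial>lborel) = ennreal (F_R b)"
proof (cases "kappa0 \<le> b")
  case True
  have "(\<integral>\<^sup>+s. ennreal (f_R s) * indicator {..b} s \<partial>lborel) = (\<integral>\<^sup>+s. ennreal (f_R s) * indicator {kappa0..b} s \<partial>lborel)"
    by (rule nn_integral_cong) (auto simp: indicator_def f_R_def)
  then show ?thesis using nn_integral_f_R[OF order_refl True] by (simp add: F_R_kappa0)
next
  case False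
  have "(\<integral>\<^sup>+s. ennreal (f_R s) * indicator {..b} s \<partial>lborel) = (\<integral>\<^sup>+s. 0 \<partial>(lborel :: real measure))"
    by (rule nn_integral_cong) (use False in \<open>auto simp: indicator_def f_R_def\<close>)
  then show ?thesis using False by (simp add: F_R_def)
qed

lemma F_R_nonneg: "0 \<le> F_R b"
  using has_integral_nonneg[OF f_R_has_integral f_R_nonneg, of b] by (cases "kappa0 \<le> b") (auto simp: F_R_def)

text \<open>The density vanishes at both ends of the interval, so only its positivity in the
  interior is available. An open set around an end point still meets the interior, and in a set of
  positive Lebesgue measure.\<close>

lemma measure_support_density_f_R:
  "measure_support (density lborel (\<lambda>s. ennreal (f_R s))) = {kappa0..kappa3}"
proof (intro equalityI subsetI)
  let ?D = "density lborel (\<lambda>s. ennreal (f_R s))"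
  fix x assume x: "x \<in> measure_support ?D"
  show "x \<in> {kappa0..kappa3}"
  proof (rule ccontr)
    assume "x \<notin> {kappa0..kappa3}"
    then have "0 < emeasure ?D (- {kappa0..kappa3})"
      using x by (auto simp: measure_support_def dest!: spec[of _ "- {kappa0..kappa3}"])
    moreover have "emeasure ?D (- {kappa0..kappa3}) = (\<integral>\<^sup>+s. 0 \<partial>(lborel :: real measure))"
      by (subst emeasure_density, simp, simp, rule nn_integral_cong)
        (use kappa_order in \<open>auto simp: indicator_def f_R_def\<close>)
    ultimately show False by simp
  qed
next
  let ?D = "density lborel (\<lambda>s. ennreal (f_R s))"
  fix x assume x: "x \<in> {kappa0..kappa3}"
  show "x \<in> measure_support ?D"
    unfolding measure_support_def
  proof (intro CollectI allI impI)
    fix V :: "real set" assume V: "open V \<and> x \<in> V"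
    have "kappa0 < kappa3" using kappa_order by simp
    then have "x \<in> closure {kappa0<..<kappa3}" using x by simp
    then have "V \<inter> {kappa0<..<kappa3} \<noteq> {}"
      using V open_Int_closure_eq_empty[of V "{kappa0<..<kappa3}"] by blast
    then have ne: "emeasure lborel (V \<inter> {kappa0<..<kappa3}) \<noteq> 0"
      using V open_not_negligible[of "V \<inter> {kappa0<..<kappa3}"]
      by (auto simp: negligible_iff_emeasure0 open_Int)
    have meas: "V \<inter> {kappa0<..<kappa3} \<in> sets lborel" using V by simp
    have "emeasure ?D (V \<inter> {kappa0<..<kappa3}) \<noteq> 0"
    proof
      assume "emeasure ?D (V \<inter> {kappa0<..<kappa3}) = 0"
      then have "(\<integral>\<^sup>+s. ennreal (f_R s) * indicator (V \<inter> {kappa0<..<kappa3}) s \<partial>lborel) = 0"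
        using meas by (subst (asm) emeasure_density) simp_all
      then have "AE s in lborel. ennreal (f_R s) * indicator (V \<inter> {kappa0<..<kappa3}) s = 0"
        using meas by (subst (asm) nn_integral_0_iff_AE) simp_all
      then have "AE s in lborel. s \<notin> V \<inter> {kappa0<..<kappa3}"
      proof eventually_elim
        case (elim s)
        then show ?case
          using f_R_pos[of s] by (auto simp: indicator_def ennreal_eq_0_iff split: if_splits)
      qed
      then show False using ne AE_iff_null_sets[OF meas] by blast
    qed
    then have "0 < emeasure ?D (V \<inter> {kappa0<..<kappa3})" by (simp add: zero_less_iff_neq_zero)
    also have "\<dots> \<le> emeasure ?D V" using V by (intro emeasure_mono) auto
    finally show "0 < emeasure ?D V" .
  qed
qed

theorem theorem5p9:
  fixes M :: "'a measure" and U :: "'a \<Rightarrow> real^3" and W_R B_T :: "'a \<Rightarrow> real"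
  assumes "prob_space M"
    and "uniform_on_sphere M U"
    and "W_R = (\<lambda>\<omega>. width rhombic_dodecahedron (U \<omega>))"
    and "B_T = (\<lambda>\<omega>. brightness tetrahedron (U \<omega>))"
  shows "(\<forall>\<omega>\<in>space M. W_R \<omega> = 8 / sqrt 3 * B_T \<omega>)
    \<and> W_R \<in> borel_measurable M
    \<and> absolutely_continuous lborel (distr M borel W_R)
    \<and> measure_support (distr M borel W_R) = {kappa0..kappa3}
    \<and> (\<forall>s. 0 \<le> f_R s)
    \<and> distributed M lborel W_R (\<lambda>s. ennreal (f_R s))
    \<and> (\<forall>s. cdf (distr M borel W_R) s = F_R s)"
proof -
  interpret M: prob_space M by fact
  have U: "U \<in> M \<rightarrow>\<^sub>M restrict_space borel (sphere 0 1)"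
    and inv: "\<And>A. rotation_matrix A \<Longrightarrow> distr M borel (\<lambda>\<omega>. A *v U \<omega>) = distr M borel U"
    using assms(2) by (auto simp: uniform_on_sphere_def)
  have norm_U: "norm (U \<omega>) = 1" if "\<omega> \<in> space M" for \<omega>
    using measurable_space[OF U that] by (simp add: space_restrict_space)
  have [measurable]: "U \<in> borel_measurable M"
    using U by (simp add: measurable_restrict_space2_iff)
  have W: "W_R = (\<lambda>\<omega>. radial_width (U \<omega>))"
    by (simp add: assms(3) width_eq_radial_width)
  have W_meas [measurable]: "W_R \<in> borel_measurable M"
    unfolding W by measurable
  interpret N: rotation_invariant "distr M borel U"
  proof (intro rotation_invariant.intro rotation_invariant_axioms.intro)
    show "prob_space (distr M borel U)" by (rule M.prob_space_distr) simp
    show "AE x in distr M borel U. norm x = 1"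
      by (subst AE_distr_iff) (auto simp: norm_U)
    show "distr (distr M borel U) borel ((*v) A) = distr M borel U" if "rotation_matrix A" for A
      using inv[OF that] by (simp add: distr_distr o_def)
  qed simp
  \<comment> \<open>Once the law is identified on all Borel sets, absolute continuity, support and
    distribution function are statements about the density alone.\<close>
  have law: "distr M borel W_R = density lborel (\<lambda>s. ennreal (f_R s))"
  proof (rule measure_eqI)
    fix S assume "S \<in> sets (distr M borel W_R)"
    then have S [measurable]: "S \<in> sets borel" by simp
    have "emeasure (distr M borel W_R) S = emeasure (distr M borel U) {x. radial_width x \<in> S}"
      unfolding W by (simp add: emeasure_distr vimage_def)
    also have "\<dots> = emeasure (density lborel (\<lambda>s. ennreal (f_R s))) S"
      by (simp add: N.emeasure_radial_width_density emeasure_density)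
    finally show "emeasure (distr M borel W_R) S = emeasure (density lborel (\<lambda>s. ennreal (f_R s))) S" .
  qed simp
  have "absolutely_continuous lborel (distr M borel W_R)"
    unfolding law by (rule absolutely_continuousI_density) simp
  moreover have "distributed M lborel W_R (\<lambda>s. ennreal (f_R s))"
    unfolding distributed_def using law by (simp cong: distr_cong)
  moreover have "cdf (distr M borel W_R) s = F_R s" for s
    unfolding law cdf_def measure_def
    by (subst emeasure_density) (simp_all add: nn_integral_f_R_atMost F_R_nonneg)
  moreover have "measure_support (distr M borel W_R) = {kappa0..kappa3}"
    unfolding law by (rule measure_support_density_f_R)
  moreover have "\<forall>\<omega>\<in>space M. W_R \<omega> = 8 / sqrt 3 * B_T \<omega>"
    by (simp add: assms(3,4) width_eq_brightness norm_U)
  ultimately show ?thesis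
    using W_meas f_R_nonneg by blast
qed

end
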